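(* Let $M=M(S)$ be a matroid of rank $n$ on a set $S$, let $m\in\mathbb{Z}^+$, and let $W^m(M)=\mathrm{Skew}(S)^{\otimes m}/I(M)$ be its $m$-th Whitney algebra. Let $\Phi:\mathrm{Skew}[S|\underline{m}]\to\mathrm{Skew}(S)^{\otimes m}$ be the $\mathbb{Z}$-algebra isomorphism sending $(x|i)$ to $1\otimes\cdots\otimes x\otimes\cdots\otimes1$ ($x$ in the $i$-th factor), and let $J(M)$ be the bilateral ideal of $\mathrm{Skew}[S|\underline{m}]$ generated by the biproducts $(w|1^{(p_1)}\cdots m^{(p_m)})$ for all words $w=x_1x_2\cdots x_p$ whose corresponding set $\{x_1,\dots,x_p\}\subseteq S$ is dependent in $M$ and all nonnegative integers $p_1,\dots,p_m$ with $p_1+\cdots+p_m=p$. Then: (1) $\Phi(J(M))=I(M)$, so $\Phi$ induces an isomorphism $\Phi_M:\mathrm{Skew}[S|\underline{m}]/J(M)\to W^m(M)$; (2) the divided powers $D^{(h)}_{ji}$ ($i\ne j$, $h\in\mathbb{Z}^+$) of place polarizations on $\mathrm{Skew}[S|\underline{m}]$ leave the ideal $J(M)$ invariant; consequently the geometric products $\diamond^{(h)}_{ji}$ on $\mathrm{Skew}(S)^{\otimes m}$ leave $I(M)$ invariant, and so are well defined on the Whitney algebra $W^m(M)$; (3) the mapping sending each $m\times m$ elementary matrix with $1$ in the $(i,j)$-th entry (and $0$ elsewhere) to the simple geometric product $\diamond_{ij}$ induces a Lie representation of the general linear Lie algebra $gl(m,\mathbb{Z})$ in the Lie algebra of derivations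 of $W^m(M)$.
   Context: For a set $X$, $\mathrm{Skew}(X)$ is the free associative skew-symmetric unital $\mathbb{Z}$-algebra generated by $X$, i.e. the exterior algebra of the free $\mathbb{Z}$-module on $X$ ($xy=-yx$, $xx=0$ for $x,y\in X$). $\mathrm{Skew}(S)^{\otimes m}$ is the $m$-th tensor power over $\mathbb{Z}$ in the category of $\mathbb{Z}_2$-graded algebras. "Derivation" means ordinary (unsigned) derivation. Slices: for a word $w=x_1\cdots x_p$ on $S$ and nonnegative integers $p_1,\dots,p_m$ with sum $p$, $$\Delta_{(p_1,\dots,p_m)}(w)=\sum_{(w)_{(p_1,\dots,p_m)}}w_{(1)}\otimes\cdots\otimes w_{(m)}=\sum\operatorname{sgn}(I_1,\dots,I_m)\,x_{I_1}\otimes\cdots\otimes x_{I_m},$$ the sum being over ordered partitions $(I_1,\dots,I_m)$ of $\{1,\dots,p\}$ with $|I_k|=p_k$, where $x_I$ is the product in increasing order of index and $\operatorname{sgn}$ is the sign of the permutation listing $I_1,\dots,I_m$ in order, each increasingly. A slice with a negative index is $0$. Whitney algebra: $I(M)$ is the bilateral ideal of $\mathrm{Skew}(S)^{\otimes m}$ generated by all slices $\Delta_{(i_1,\dots,i_m)}(v_1\cdots v_p)$, $i_1+\cdots+i_m=p$, for all dependent subsets $\{v_1,\dots,v_p\}$ of $M$; $W^m(M)=\mathrm{Skew}(S)^{\otimes m}/I(M)$. Letterplace algebra: $\underline{m}=\{1,\dots,m\}$; $\mathrm{Skew}[S|\underline{m}]$ is the free associative skew-symmetric unital $\mathbb{Z}$-algebra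 generated by the symbols $(x|i)$, $x\in S$, $i\in\underline{m}$, i.e. the exterior algebra of the free $\mathbb{Z}$-module on the set of these symbols. The biproduct of a word $w$ of length $p_1+\cdots+p_m$ is $$(w|1^{(p_1)}\cdots m^{(p_m)})=\sum_{(w)_{(p_1,\dots,p_m)}}(w_{(1)}|1^{(p_1)})\cdots(w_{(m)}|m^{(p_m)}),$$ where $(y_1\cdots y_q|i^{(q)})=(y_1|i)\cdots(y_q|i)$ (equal to $1$ for $q=0$). The place polarization $D_{ji}$ is the unique derivation of $\mathrm{Skew}[S|\underline{m}]$ with $D_{ji}(x|k)=\delta_{ik}(x|j)$; for $i\ne j$ the divided power $D_{ji}^{(h)}=D_{ji}^{\,h}/h!$ is well defined on $\mathrm{Skew}[S|\underline{m}]$. Geometric products on $\mathrm{Skew}(S)^{\otimes m}$: let $A_1,\dots,A_m$ be monomials of degrees $a_1,\dots,a_m$ and let $i<j$. Then $$\diamond^{(h)}_{ji}(A_1\otimes\cdots\otimes A_m)=(-1)^{h(a_{i+1}+\cdots+a_{j-1})}\sum_{(A_i)_{(a_i-h,h)}}A_1\otimes\cdots\otimes (A_i)_{(1)}\otimes\cdots\otimes(A_i)_{(2)}A_j\otimes\cdots\otimes A_m,$$ $$\diamond^{(h)}_{ij}(A_1\otimes\cdots\otimes A_m)=(-1)^{h(a_{i+1}+\cdots+a_{j-1})}\sum_{(A_j)_{(h,a_j-h)}}A_1\otimes\cdots\otimes A_i(A_j)_{(1)}\otimes\cdots\otimes(A_j)_{(2)}\otimes\cdots\otimes A_m,$$ where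 the displayed modified factors are in positions $i$ and $j$; these are extended $\mathbb{Z}$-linearly. The simple geometric products are $\diamond_{ij}=\diamond^{(1)}_{ij}$ for $i\ne j$, and $\diamond_{ii}=\Phi\circ D_{ii}\circ\Phi^{-1}$; on $W^m(M)$ the same symbols denote the induced operators. *)

theory Defs
  imports
    "HOL-Algebra.QuotRing"
    "HOL-Library.Poly_Mapping"
    "HOL-Library.FuncSet"
    "HOL-Library.Disjoint_Sets"
    "HOL-Combinatorics.Permutations"
    "Jordan_Normal_Form.Matrix"
begin

section \<open>Matroids\<close>

text \<open>
  The ground set is not required to be finite. For a finite ground set the two predicates
  below say that the sets satisfying \<open>indep\<close> form a matroid of rank \<open>n\<close> in the usual sense;
  in general they describe matroids of finite rank \<open>n\<close>.
\<close>

definition matroid :: "'a set \<Rightarrow> ('a set \<Rightarrow> bool) \<Rightarrow> bool" where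
  "matroid S indep \<longleftrightarrow>
     (\<forall>A. indep A \<longrightarrow> A \<subseteq> S) \<and>
     indep {} \<and>
     (\<forall>A B. indep B \<longrightarrow> A \<subseteq> B \<longrightarrow> indep A) \<and>
     (\<forall>A B. indep A \<longrightarrow> indep B \<longrightarrow> finite A \<longrightarrow> finite B \<longrightarrow> card A < card B \<longrightarrow>
        (\<exists>b\<in>B - A. indep (insert b A)))"

definition has_rank :: "('a set \<Rightarrow> bool) \<Rightarrow> nat \<Rightarrow> bool" where
  "has_rank indep n \<longleftrightarrow>
     (\<forall>A. indep A \<longrightarrow> finite A \<and> card A \<le> n) \<and> (\<exists>B. indep B \<and> card B = n)"

definition dependent_in :: "'a set \<Rightarrow> ('a set \<Rightarrow> bool) \<Rightarrow> 'a set \<Rightarrow> bool" where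
  "dependent_in S indep A \<longleftrightarrow> A \<subseteq> S \<and> \<not> indep A"


section \<open>Maps between rings, viewed as algebras over the integers\<close>

text \<open>
  A \<open>\<int>\<close>-algebra is a (not necessarily commutative) ring and a \<open>\<int>\<close>-linear map is an additive map.
  Maps are extensional on the carrier, so that two maps are equal as soon as they agree on it.
\<close>

definition additive_map :: "('a, 'c) ring_scheme \<Rightarrow> ('b, 'd) ring_scheme \<Rightarrow> ('a \<Rightarrow> 'b) \<Rightarrow> bool" where
  "additive_map R R' f \<longleftrightarrow>
     f \<in> carrier R \<rightarrow>\<^sub>E carrier R' \<and>
     (\<forall>a\<in>carrier R. \<forall>b\<in>carrier R. f (a \<oplus>\<^bsub>R\<^esub> b) = f a \<oplus>\<^bsub>R'\<^esub> f b)"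

definition derivation :: "('a, 'c) ring_scheme \<Rightarrow> ('a \<Rightarrow> 'a) \<Rightarrow> bool" where
  "derivation R D \<longleftrightarrow>
     additive_map R R D \<and>
     (\<forall>a\<in>carrier R. \<forall>b\<in>carrier R.
        D (a \<otimes>\<^bsub>R\<^esub> b) = (D a \<otimes>\<^bsub>R\<^esub> b) \<oplus>\<^bsub>R\<^esub> (a \<otimes>\<^bsub>R\<^esub> D b))"

text \<open>
  The map \<open>R/I \<rightarrow> R'/I'\<close> induced by \<open>f\<close>: a coset is sent to the union of the cosets
  \<open>I' + f a\<close> of its elements, which is a single coset if \<open>f\<close> is additive and maps \<open>I\<close> into \<open>I'\<close>.
\<close>

definition induced_map ::
    "('a, 'c) ring_scheme \<Rightarrow> 'a set \<Rightarrow> ('b, 'd) ring_scheme \<Rightarrow> 'b set \<Rightarrow> ('a \<Rightarrow> 'b) \<Rightarrow> 'a set \<Rightarrow> 'b set" where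
  "induced_map R I R' I' f = (\<lambda>C\<in>carrier (R Quot I). \<Union>a\<in>C. I' +>\<^bsub>R'\<^esub> f a)"

definition well_defined_on_quotient ::
    "('a, 'c) ring_scheme \<Rightarrow> 'a set \<Rightarrow> ('b, 'd) ring_scheme \<Rightarrow> 'b set \<Rightarrow> ('a \<Rightarrow> 'b) \<Rightarrow> bool" where
  "well_defined_on_quotient R I R' I' f \<longleftrightarrow>
     (\<forall>a\<in>carrier R. induced_map R I R' I' f (I +>\<^bsub>R\<^esub> a) = I' +>\<^bsub>R'\<^esub> f a)"

definition ring_list_prod :: "('a, 'c) ring_scheme \<Rightarrow> 'a list \<Rightarrow> 'a" where
  "ring_list_prod R xs = foldr (\<otimes>\<^bsub>R\<^esub>) xs \<one>\<^bsub>R\<^esub>"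


section \<open>Free skew-symmetric algebras\<close>

text \<open>
  The \<open>\<int>\<close>-algebra with \<open>\<int>\<close>-basis \<open>B\<close> in which the product of basis elements \<open>u\<close>, \<open>v\<close> is
  \<open>c u v\<close> times the basis element \<open>op u v\<close>, and whose unit is the basis element \<open>e\<close>.
\<close>

definition twisted_monoid_algebra ::
    "'b set \<Rightarrow> ('b \<Rightarrow> 'b \<Rightarrow> int) \<Rightarrow> ('b \<Rightarrow> 'b \<Rightarrow> 'b) \<Rightarrow> 'b \<Rightarrow> ('b \<Rightarrow>\<^sub>0 int) ring" where
  "twisted_monoid_algebra B c op e =
     \<lparr>carrier = {f. Poly_Mapping.keys f \<subseteq> B},
      monoid.mult = (\<lambda>f g. \<Sum>u\<in>Poly_Mapping.keys f. \<Sum>v\<in>Poly_Mapping.keys g.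
                Poly_Mapping.single (op u v)
                  (c u v * Poly_Mapping.lookup f u * Poly_Mapping.lookup g v)),
      one = Poly_Mapping.single e 1,
      zero = 0,
      add = (+)\<rparr>"

definition free_algebra :: "'x set \<Rightarrow> ('x list \<Rightarrow>\<^sub>0 int) ring" where
  "free_algebra X = twisted_monoid_algebra (lists X) (\<lambda>_ _. 1) (@) []"

definition skew_ideal :: "'x set \<Rightarrow> ('x list \<Rightarrow>\<^sub>0 int) set" where
  "skew_ideal X =
     Idl\<^bsub>free_algebra X\<^esub>
       ({Poly_Mapping.single [x, y] 1 + Poly_Mapping.single [y, x] 1 | x y. x \<in> X \<and> y \<in> X} \<union>
        {Poly_Mapping.single [x, x] 1 | x. x \<in> X})"

definition Skew :: "'x set \<Rightarrow> ('x list \<Rightarrow>\<^sub>0 int) set ring" where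
  "Skew X = free_algebra X Quot skew_ideal X"

definition skew_mon :: "'x set \<Rightarrow> 'x list \<Rightarrow> ('x list \<Rightarrow>\<^sub>0 int) set" where
  "skew_mon X w = skew_ideal X +>\<^bsub>free_algebra X\<^esub> Poly_Mapping.single w 1"

text \<open>The \<open>\<int>\<^sub>2\<close>-grading by parity of the degree; \<open>True\<close> stands for odd.\<close>

definition skew_part :: "'x set \<Rightarrow> bool \<Rightarrow> ('x list \<Rightarrow>\<^sub>0 int) set set" where
  "skew_part X e =
     {skew_ideal X +>\<^bsub>free_algebra X\<^esub> f | f.
        f \<in> carrier (free_algebra X) \<and> (\<forall>w\<in>Poly_Mapping.keys f. odd (length w) = e)}"


section \<open>Tensor powers of graded algebras\<close>

text \<open>
  Let \<open>R\<close> be a \<open>\<int>\<^sub>2\<close>-graded algebra with homogeneous components \<open>G False\<close> and \<open>G True\<close>.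
  As a \<open>\<int>\<close>-module, its \<open>m\<close>-th tensor power is the direct sum of the modules
  \<open>G e\<^sub>1 \<otimes> \<dots> \<otimes> G e\<^sub>m\<close> over all families of parities, that is, the free module on the
  \<open>m\<close>-tuples of homogeneous elements (each recorded with its parity, as \<open>0\<close> has both)
  modulo additivity in each place. The product of two tuples \<open>s\<close>, \<open>t\<close> is placewise, with the
  sign coming from moving the \<open>l\<close>-th entry of \<open>t\<close> past the \<open>k\<close>-th entry of \<open>s\<close> for \<open>l < k\<close>.
  The additivity relations span a submodule that is already an ideal for this product.
\<close>

definition hom_tuples :: "(bool \<Rightarrow> 'r set) \<Rightarrow> nat \<Rightarrow> (nat \<Rightarrow> 'r \<times> bool) set" where
  "hom_tuples G m = {1..m} \<rightarrow>\<^sub>E {(a, e). a \<in> G e}"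

definition koszul_sign :: "nat \<Rightarrow> (nat \<Rightarrow> 'r \<times> bool) \<Rightarrow> (nat \<Rightarrow> 'r \<times> bool) \<Rightarrow> int" where
  "koszul_sign m s t =
     (-1) ^ card {(k, l). k \<in> {1..m} \<and> l \<in> {1..m} \<and> l < k \<and> snd (s k) \<and> snd (t l)}"

definition graded_tuple_algebra ::
    "('r, 'c) ring_scheme \<Rightarrow> (bool \<Rightarrow> 'r set) \<Rightarrow> nat \<Rightarrow> ((nat \<Rightarrow> 'r \<times> bool) \<Rightarrow>\<^sub>0 int) ring" where
  "graded_tuple_algebra R G m =
     twisted_monoid_algebra (hom_tuples G m) (koszul_sign m)
       (\<lambda>s t. \<lambda>k\<in>{1..m}. (fst (s k) \<otimes>\<^bsub>R\<^esub> fst (t k), snd (s k) \<noteq> snd (t k)))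
       (\<lambda>k\<in>{1..m}. (\<one>\<^bsub>R\<^esub>, False))"

definition multilinear_ideal ::
    "('r, 'c) ring_scheme \<Rightarrow> (bool \<Rightarrow> 'r set) \<Rightarrow> nat \<Rightarrow> ((nat \<Rightarrow> 'r \<times> bool) \<Rightarrow>\<^sub>0 int) set" where
  "multilinear_ideal R G m =
     Idl\<^bsub>graded_tuple_algebra R G m\<^esub>
       {Poly_Mapping.single (t(k := (a \<oplus>\<^bsub>R\<^esub> b, e))) 1
          - Poly_Mapping.single (t(k := (a, e))) 1 - Poly_Mapping.single (t(k := (b, e))) 1
        | t k a b e. t \<in> hom_tuples G m \<and> k \<in> {1..m} \<and> a \<in> G e \<and> b \<in> G e}"

definition graded_tensor_power ::
    "('r, 'c) ring_scheme \<Rightarrow> (bool \<Rightarrow> 'r set) \<Rightarrow> nat \<Rightarrow> ((nat \<Rightarrow> 'r \<times> bool) \<Rightarrow>\<^sub>0 int) set ring" where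
  "graded_tensor_power R G m = graded_tuple_algebra R G m Quot multilinear_ideal R G m"

definition pure_tensor ::
    "('r, 'c) ring_scheme \<Rightarrow> (bool \<Rightarrow> 'r set) \<Rightarrow> nat \<Rightarrow> (nat \<Rightarrow> 'r \<times> bool) \<Rightarrow>
      ((nat \<Rightarrow> 'r \<times> bool) \<Rightarrow>\<^sub>0 int) set" where
  "pure_tensor R G m t =
     multilinear_ideal R G m +>\<^bsub>graded_tuple_algebra R G m\<^esub>
       Poly_Mapping.single (restrict t {1..m}) 1"

type_synonym 'x skew_elem = "('x list \<Rightarrow>\<^sub>0 int) set"
type_synonym 'x tensor_elem = "((nat \<Rightarrow> 'x skew_elem \<times> bool) \<Rightarrow>\<^sub>0 int) set"

definition SkewT :: "'a set \<Rightarrow> nat \<Rightarrow> 'a tensor_elem ring" where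
  "SkewT S m = graded_tensor_power (Skew S) (skew_part S) m"

text \<open>\<open>tensor_mon S m A\<close> is \<open>A 1 \<otimes> \<dots> \<otimes> A m\<close> for a family \<open>A\<close> of words on \<open>S\<close>.\<close>

definition tensor_mon :: "'a set \<Rightarrow> nat \<Rightarrow> (nat \<Rightarrow> 'a list) \<Rightarrow> 'a tensor_elem" where
  "tensor_mon S m A =
     pure_tensor (Skew S) (skew_part S) m (\<lambda>k. (skew_mon S (A k), odd (length (A k))))"


section \<open>Slices\<close>

text \<open>The positions of a word are numbered from \<open>0\<close>, as is usual for lists; places from \<open>1\<close>.\<close>

definition ordered_partitions :: "nat \<Rightarrow> (nat \<Rightarrow> nat) \<Rightarrow> nat \<Rightarrow> (nat \<Rightarrow> nat set) set" where
  "ordered_partitions m P p =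
     {I \<in> {1..m} \<rightarrow>\<^sub>E Pow {..<p}.
        disjoint_family_on I {1..m} \<and> (\<Union>k\<in>{1..m}. I k) = {..<p} \<and>
        (\<forall>k\<in>{1..m}. card (I k) = P k)}"

definition partition_perm :: "nat \<Rightarrow> nat \<Rightarrow> (nat \<Rightarrow> nat set) \<Rightarrow> nat \<Rightarrow> nat" where
  "partition_perm m p I =
     (\<lambda>s. if s < p then concat (map (\<lambda>k. sorted_list_of_set (I k)) [1..<Suc m]) ! s else s)"

text \<open>
  The signed sum over the slices of \<open>w\<close> of type \<open>(P 1, \<dots>, P m)\<close> of \<open>F\<close> applied to the family
  of subwords \<open>w\<^sub>(\<^sub>1\<^sub>), \<dots>, w\<^sub>(\<^sub>m\<^sub>)\<close>. It is empty unless \<open>P 1 + \<dots> + P m = length w\<close>.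
\<close>

definition slice_sum ::
    "('b, 'c) ring_scheme \<Rightarrow> nat \<Rightarrow> (nat \<Rightarrow> nat) \<Rightarrow> 'a list \<Rightarrow> ((nat \<Rightarrow> 'a list) \<Rightarrow> 'b) \<Rightarrow> 'b" where
  "slice_sum R m P w F =
     (\<Oplus>\<^bsub>R\<^esub>I\<in>ordered_partitions m P (length w).
        [(sign (partition_perm m (length w) I))] \<cdot>\<^bsub>R\<^esub> F (\<lambda>k. nths w (I k)))"

definition slice :: "'a set \<Rightarrow> nat \<Rightarrow> (nat \<Rightarrow> nat) \<Rightarrow> 'a list \<Rightarrow> 'a tensor_elem" where
  "slice S m P w = slice_sum (SkewT S m) m P w (tensor_mon S m)"


section \<open>Whitney algebra\<close>

definition whitney_ideal :: "'a set \<Rightarrow> ('a set \<Rightarrow> bool) \<Rightarrow> nat \<Rightarrow> 'a tensor_elem set" where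
  "whitney_ideal S indep m =
     Idl\<^bsub>SkewT S m\<^esub>
       {slice S m P v | P v. distinct v \<and> dependent_in S indep (set v) \<and>
          (\<Sum>k\<in>{1..m}. P k) = length v}"

definition whitney_algebra :: "'a set \<Rightarrow> ('a set \<Rightarrow> bool) \<Rightarrow> nat \<Rightarrow> 'a tensor_elem set ring" where
  "whitney_algebra S indep m = SkewT S m Quot whitney_ideal S indep m"


section \<open>Letterplace algebra\<close>

text \<open>The symbol \<open>(x|i)\<close> is the pair \<open>(x, i)\<close>.\<close>

definition letterplace :: "'a set \<Rightarrow> nat \<Rightarrow> ('a \<times> nat) skew_elem ring" where
  "letterplace S m = Skew (S \<times> {1..m})"

definition lp_gen :: "'a set \<Rightarrow> nat \<Rightarrow> 'a \<Rightarrow> nat \<Rightarrow> ('a \<times> nat) skew_elem" where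
  "lp_gen S m x i = skew_mon (S \<times> {1..m}) [(x, i)]"

definition lp_mon :: "'a set \<Rightarrow> nat \<Rightarrow> 'a list \<Rightarrow> nat \<Rightarrow> ('a \<times> nat) skew_elem" where
  "lp_mon S m w i = ring_list_prod (letterplace S m) (map (\<lambda>y. lp_gen S m y i) w)"

definition biproduct :: "'a set \<Rightarrow> nat \<Rightarrow> (nat \<Rightarrow> nat) \<Rightarrow> 'a list \<Rightarrow> ('a \<times> nat) skew_elem" where
  "biproduct S m P w =
     slice_sum (letterplace S m) m P w
       (\<lambda>V. ring_list_prod (letterplace S m) (map (\<lambda>k. lp_mon S m (V k) k) [1..<Suc m]))"

definition biproduct_ideal :: "'a set \<Rightarrow> ('a set \<Rightarrow> bool) \<Rightarrow> nat \<Rightarrow> ('a \<times> nat) skew_elem set" where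
  "biproduct_ideal S indep m =
     Idl\<^bsub>letterplace S m\<^esub>
       {biproduct S m P w | P w. dependent_in S indep (set w) \<and>
          (\<Sum>k\<in>{1..m}. P k) = length w}"

definition Phi :: "'a set \<Rightarrow> nat \<Rightarrow> ('a \<times> nat) skew_elem \<Rightarrow> 'a tensor_elem" where
  "Phi S m =
     (THE \<phi>. \<phi> \<in> ring_iso (letterplace S m) (SkewT S m) \<and>
        \<phi> \<in> extensional (carrier (letterplace S m)) \<and>
        (\<forall>x\<in>S. \<forall>i\<in>{1..m}. \<phi> (lp_gen S m x i) = tensor_mon S m ((\<lambda>_. [])(i := [x]))))"

text \<open>\<open>polarization S m j i\<close> is \<open>D\<^sub>j\<^sub>i\<close>, which replaces place \<open>i\<close> by place \<open>j\<close>.\<close>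

definition polarization ::
    "'a set \<Rightarrow> nat \<Rightarrow> nat \<Rightarrow> nat \<Rightarrow> ('a \<times> nat) skew_elem \<Rightarrow> ('a \<times> nat) skew_elem" where
  "polarization S m j i =
     (THE D. derivation (letterplace S m) D \<and>
        (\<forall>x\<in>S. \<forall>k\<in>{1..m}.
           D (lp_gen S m x k) = (if k = i then lp_gen S m x j else \<zero>\<^bsub>letterplace S m\<^esub>)))"

definition divided_power :: "('a, 'c) ring_scheme \<Rightarrow> ('a \<Rightarrow> 'a) \<Rightarrow> nat \<Rightarrow> 'a \<Rightarrow> 'a" where
  "divided_power R D h =
     (\<lambda>f\<in>carrier R. THE g. g \<in> carrier R \<and> [(fact h :: nat)] \<cdot>\<^bsub>R\<^esub> g = (D ^^ h) f)"


section \<open>Geometric products\<close>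

text \<open>
  \<open>geometric_mon S m h b a A\<close> is the value of \<open>\<diamond>\<^sub>b\<^sub>a\<^sup>(\<^sup>h\<^sup>)\<close> on \<open>A 1 \<otimes> \<dots> \<otimes> A m\<close>: a part of degree \<open>h\<close>
  of the factor in place \<open>a\<close> is moved to place \<open>b\<close>. If \<open>h\<close> exceeds the degree of \<open>A a\<close>,
  the truncated difference does not matter: the two slice sizes then fail to add up to
  \<open>length (A a)\<close> and the sum is empty.
\<close>

definition geometric_mon ::
    "'a set \<Rightarrow> nat \<Rightarrow> nat \<Rightarrow> nat \<Rightarrow> nat \<Rightarrow> (nat \<Rightarrow> 'a list) \<Rightarrow> 'a tensor_elem" where
  "geometric_mon S m h b a A =
     (if a < b then
        [((-1 :: int) ^ (h * (\<Sum>k\<in>{a<..<b}. length (A k))))] \<cdot>\<^bsub>SkewT S m\<^esub>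
          slice_sum (SkewT S m) 2 (\<lambda>r. if r = 1 then length (A a) - h else h) (A a)
            (\<lambda>V. tensor_mon S m (A(a := V 1, b := V 2 @ A b)))
      else
        [((-1 :: int) ^ (h * (\<Sum>k\<in>{b<..<a}. length (A k))))] \<cdot>\<^bsub>SkewT S m\<^esub>
          slice_sum (SkewT S m) 2 (\<lambda>r. if r = 1 then h else length (A a) - h) (A a)
            (\<lambda>V. tensor_mon S m (A(b := A b @ V 1, a := V 2))))"

definition geometric_product ::
    "'a set \<Rightarrow> nat \<Rightarrow> nat \<Rightarrow> nat \<Rightarrow> nat \<Rightarrow> 'a tensor_elem \<Rightarrow> 'a tensor_elem" where
  "geometric_product S m h b a =
     (THE g. additive_map (SkewT S m) (SkewT S m) g \<and>
        (\<forall>A\<in>{1..m} \<rightarrow> lists S. g (tensor_mon S m A) = geometric_mon S m h b a A))"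

definition simple_geometric_product ::
    "'a set \<Rightarrow> nat \<Rightarrow> nat \<Rightarrow> nat \<Rightarrow> 'a tensor_elem \<Rightarrow> 'a tensor_elem" where
  "simple_geometric_product S m i j =
     (if i \<noteq> j then geometric_product S m 1 i j
      else (\<lambda>t\<in>carrier (SkewT S m).
              Phi S m (polarization S m i i (inv_into (carrier (letterplace S m)) (Phi S m) t))))"


section \<open>Lie algebras over the integers\<close>

record 'a lie_ring = "'a partial_object" +
  lie_add :: "'a \<Rightarrow> 'a \<Rightarrow> 'a"
  lie_bracket :: "'a \<Rightarrow> 'a \<Rightarrow> 'a"

definition gl_int :: "nat \<Rightarrow> int mat lie_ring" where
  "gl_int m =
     \<lparr>carrier = carrier_mat m m, lie_add = (+), lie_bracket = (\<lambda>A B. A * B - B * A)\<rparr>"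

text \<open>The library indexes matrix entries from \<open>0\<close>; here \<open>i\<close> and \<open>j\<close> range over \<open>{1..m}\<close>.\<close>

definition elementary_mat :: "nat \<Rightarrow> nat \<Rightarrow> nat \<Rightarrow> int mat" where
  "elementary_mat m i j = mat m m (\<lambda>(r, s). if Suc r = i \<and> Suc s = j then 1 else 0)"

definition der_lie :: "('a, 'c) ring_scheme \<Rightarrow> ('a \<Rightarrow> 'a) lie_ring" where
  "der_lie R =
     \<lparr>carrier = {D. derivation R D},
      lie_add = (\<lambda>D E. \<lambda>a\<in>carrier R. D a \<oplus>\<^bsub>R\<^esub> E a),
      lie_bracket = (\<lambda>D E. \<lambda>a\<in>carrier R. D (E a) \<ominus>\<^bsub>R\<^esub> E (D a))\<rparr>"

definition lie_hom :: "('a, 'c) lie_ring_scheme \<Rightarrow> ('b, 'd) lie_ring_scheme \<Rightarrow> ('a \<Rightarrow> 'b) \<Rightarrow> bool" where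
  "lie_hom L L' \<rho> \<longleftrightarrow>
     \<rho> \<in> carrier L \<rightarrow>\<^sub>E carrier L' \<and>
     (\<forall>A\<in>carrier L. \<forall>B\<in>carrier L.
        \<rho> (lie_add L A B) = lie_add L' (\<rho> A) (\<rho> B) \<and>
        \<rho> (lie_bracket L A B) = lie_bracket L' (\<rho> A) (\<rho> B))"

end

theory Submission
  imports Defs "HOL-Algebra.UnivPoly"
begin

text \<open>
  The letterplace algebra is an exterior algebra, so homomorphisms out of it are given by
  anticommuting images of square \<open>0\<close> for the letters (\<open>skew_lift\<close>). Letters in the factors of
  the tensor power satisfy these relations by the sign rule, and the embeddings of the factors at
  the single places multiply to a map in the other direction; the two maps are inverse to each
  other (\<open>Phi_spec\<close>). The isomorphism sends the biproduct of a word to the slice of the same word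
  (\<open>Phi_biproduct\<close>). The only difference between the two systems of generators is that biproducts
  are taken of all words and slices only of words without repetitions, and the biproduct of a word
  with a repeated letter vanishes (\<open>biproduct_repeated\<close>). This gives \<open>\<Phi>(J) = I\<close>.

  All operators in the theorem come from one construction. For an integer matrix \<open>M\<close> there is a
  homomorphism from the letterplace algebra to the polynomials in \<open>t\<close> over it that sends \<open>(x|k)\<close>
  to \<open>(x|k) + t \<Sum>\<^sub>l M\<^sub>l\<^sub>k (x|l)\<close>; the coefficients of \<open>t\<^sup>h\<close> define operators \<open>D\<^sub>h\<close>
  (\<open>higher_deriv\<close>, \<open>mat_deriv\<close>). They satisfy \<open>D\<^sub>h(ab) = \<Sum>\<^sub>i D\<^sub>i(a) D\<^sub>h\<^sub>-\<^sub>i(b)\<close>, so that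
  \<open>D\<^sub>h\<close> leaves an ideal invariant if \<open>D\<^sub>0, \<dots>, D\<^sub>h\<close> map its generators into it (\<open>mat_deriv_J\<close>). If \<open>M\<close> is an elementary matrix off the
  diagonal, then \<open>D\<^sub>1\<close> is a polarization with \<open>D\<^sub>1\<^sup>h = h! D\<^sub>h\<close> (\<open>D_1_funpow\<close>), and because exterior
  algebras over the integers are torsion-free (\<open>skew_torsion_free\<close>), \<open>D\<^sub>h\<close> is its divided power
  (\<open>divided_power_eq\<close>).

  The sign of a slice is the cost of sorting anticommuting factors, so a biproduct is the unsigned
  sum of all ways to put the letters of the word, in their given order, into places with prescribed
  multiplicities (\<open>slice_sum_placements\<close>). Moving \<open>h\<close> letters from place \<open>i\<close> to place \<open>j\<close> in such
  a sum gives a binomial multiple of another biproduct of the same word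
  (\<open>mat_deriv_placement_sum\<close>). Hence \<open>J\<close> is invariant. The same description, applied to the letters
  of a single place, identifies the geometric products with the \<open>D\<^sub>h\<close> carried over to the tensor
  power (\<open>Phi_mat_deriv_eq_geometric_mon\<close>), so \<open>I = \<Phi>(J)\<close> is invariant under them.

  Finally \<open>D\<^sub>1\<close> depends additively on \<open>M\<close> and takes the commutator of matrices to the commutator of
  derivations, since a derivation is determined by its values on letters, where the operators
  multiply like matrices (\<open>mat_deriv_commutator\<close>). The induced derivations of the Whitney algebra
  form the required representation; it is unique because the elementary matrices generate all
  integer matrices additively (\<open>additive_on_matrices\<close>).
\<close>

section \<open>Additive maps and quotient rings\<close>

definition add_hom :: "('a, 'c) ring_scheme \<Rightarrow> ('b, 'd) ring_scheme \<Rightarrow> ('a \<Rightarrow> 'b) \<Rightarrow> bool" where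
  "add_hom R R' f \<longleftrightarrow> f \<in> carrier R \<rightarrow> carrier R' \<and>
     (\<forall>a\<in>carrier R. \<forall>b\<in>carrier R. f (a \<oplus>\<^bsub>R\<^esub> b) = f a \<oplus>\<^bsub>R'\<^esub> f b)"

lemma add_homI:
  assumes "\<And>a. a \<in> carrier R \<Longrightarrow> f a \<in> carrier R'"
    and "\<And>a b. a \<in> carrier R \<Longrightarrow> b \<in> carrier R \<Longrightarrow> f (a \<oplus>\<^bsub>R\<^esub> b) = f a \<oplus>\<^bsub>R'\<^esub> f b"
  shows "add_hom R R' f"
  using assms by (auto simp: add_hom_def)

lemma add_hom_closed: "add_hom R R' f \<Longrightarrow> a \<in> carrier R \<Longrightarrow> f a \<in> carrier R'"
  by (auto simp: add_hom_def)

lemma add_hom_add: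
  "add_hom R R' f \<Longrightarrow> a \<in> carrier R \<Longrightarrow> b \<in> carrier R \<Longrightarrow> f (a \<oplus>\<^bsub>R\<^esub> b) = f a \<oplus>\<^bsub>R'\<^esub> f b"
  by (auto simp: add_hom_def)

lemma add_hom_group_hom:
  assumes "ring R" "ring R'" "add_hom R R' f"
  shows "group_hom (add_monoid R) (add_monoid R') f"
proof -
  interpret R: ring R by fact
  interpret R': ring R' by fact
  show ?thesis
    using assms(3) by unfold_locales (auto simp: hom_def add_hom_def)
qed

lemma add_hom_zero:
  assumes "ring R" "ring R'" "add_hom R R' f" shows "f \<zero>\<^bsub>R\<^esub> = \<zero>\<^bsub>R'\<^esub>"
  using group_hom.hom_one[OF add_hom_group_hom[OF assms]] by simp

lemma add_hom_neg:
  assumes "ring R" "ring R'" "add_hom R R' f" "a \<in> carrier R" shows "f (\<ominus>\<^bsub>R\<^esub> a) = \<ominus>\<^bsub>R'\<^esub> f a"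
  using group_hom.hom_inv[OF add_hom_group_hom[OF assms(1-3)], of a] assms(4)
  by (simp add: a_inv_def)

lemma add_hom_int:
  assumes "ring R" "ring R'" "add_hom R R' f" "a \<in> carrier R"
  shows "f ([(k::int)] \<cdot>\<^bsub>R\<^esub> a) = [k] \<cdot>\<^bsub>R'\<^esub> f a"
  using group_hom.hom_int_pow[OF add_hom_group_hom[OF assms(1-3)], of a k] assms(4)
  by (simp add: add_pow_def)

lemma add_hom_finsum:
  assumes "ring R" "ring R'" "add_hom R R' f" "g \<in> A \<rightarrow> carrier R"
  shows "f (\<Oplus>\<^bsub>R\<^esub>i\<in>A. g i) = (\<Oplus>\<^bsub>R'\<^esub>i\<in>A. f (g i))"
proof -
  interpret R: ring R by fact
  interpret R': ring R' by fact
  show ?thesis using assms(4)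
  proof (induction A rule: infinite_finite_induct)
    case (insert x F)
    have "(\<lambda>i. f (g i)) \<in> F \<rightarrow> carrier R'" "f (g x) \<in> carrier R'"
      using insert.prems add_hom_closed[OF assms(3)] by blast+
    then show ?case
      using insert add_hom_add[OF assms(3), of "g x" "\<Oplus>\<^bsub>R\<^esub>i\<in>F. g i"]
      by (simp add: Pi_def)
  qed (simp_all add: add_hom_zero[OF assms(1-3)])
qed

lemma ring_hom_add_hom: "f \<in> Ring.ring_hom R R' \<Longrightarrow> add_hom R R' f"
  by (auto simp: add_hom_def Ring.ring_hom_def)

lemma additive_map_add_hom: "additive_map R R' f \<longleftrightarrow> add_hom R R' f \<and> f \<in> extensional (carrier R)"
  by (auto simp: additive_map_def add_hom_def PiE_def)

lemma add_hom_compose: "add_hom R R' f \<Longrightarrow> add_hom R' R'' g \<Longrightarrow> add_hom R R'' (\<lambda>x. g (f x))"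
  by (auto simp: add_hom_def Pi_def)

lemma add_hom_restrict:
  assumes "ring R"
  shows "add_hom R R' (restrict f (carrier R)) \<longleftrightarrow> add_hom R R' f"
proof -
  interpret ring R by fact
  show ?thesis by (auto simp: add_hom_def Pi_def)
qed

lemma (in ideal) coset_eqI:
  assumes "a \<in> carrier R" "b \<in> carrier R" "a \<ominus> b \<in> I" shows "I +> a = I +> b"
  using quotient_eq_iff_same_a_r_cos[OF ideal_axioms assms(1,2)] assms(3) by simp

lemma (in ideal) coset_eqD:
  assumes "a \<in> carrier R" "b \<in> carrier R" "I +> a = I +> b" shows "a \<ominus> b \<in> I"
  using quotient_eq_iff_same_a_r_cos[OF ideal_axioms assms(1,2)] assms(3) by simp

lemma (in ideal) coset_zero_iff:
  assumes "a \<in> carrier R" shows "I +> a = I \<longleftrightarrow> a \<in> I"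
proof
  show "a \<in> I" if "I +> a = I" using that assms by (metis a_rcos_self)
  show "I +> a = I" if "a \<in> I" using that by (rule a_rcos_const)
qed

lemma (in ideal) rcos_const: "a \<in> I \<Longrightarrow> I +> a = I"
  by (rule a_rcos_const)

lemma (in ideal) quot_carrier: "carrier (R Quot I) = {I +> a | a. a \<in> carrier R}"
  by (auto simp: FactRing_def A_RCOSETS_def')

lemma (in ideal) quot_closed: "a \<in> carrier R \<Longrightarrow> I +> a \<in> carrier (R Quot I)"
  by (auto simp: quot_carrier)

lemma (in ideal) quot_add:
  "a \<in> carrier R \<Longrightarrow> b \<in> carrier R \<Longrightarrow> (I +> a) \<oplus>\<^bsub>R Quot I\<^esub> (I +> b) = I +> (a \<oplus> b)"
  by (simp add: FactRing_def a_rcos_sum)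

lemma (in ideal) quot_mult:
  "a \<in> carrier R \<Longrightarrow> b \<in> carrier R \<Longrightarrow> (I +> a) \<otimes>\<^bsub>R Quot I\<^esub> (I +> b) = I +> (a \<otimes> b)"
  by (simp add: FactRing_def rcoset_mult_add)

lemma quot_simps [simp]: "\<zero>\<^bsub>R Quot I\<^esub> = I" "\<one>\<^bsub>R Quot I\<^esub> = I +>\<^bsub>R\<^esub> \<one>\<^bsub>R\<^esub>"
  by (simp_all add: FactRing_def)

lemma (in ideal) rcos_add_hom: "add_hom R (R Quot I) ((+>) I)"
  by (rule ring_hom_add_hom) (rule rcos_ring_hom)

lemma (in ideal) rcos_neg: "a \<in> carrier R \<Longrightarrow> I +> (\<ominus> a) = \<ominus>\<^bsub>R Quot I\<^esub> (I +> a)"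
  by (rule add_hom_neg[OF ring_axioms quotient_is_ring rcos_add_hom])

lemma (in ideal) rcos_int: "a \<in> carrier R \<Longrightarrow> I +> ([(k::int)] \<cdot> a) = [k] \<cdot>\<^bsub>R Quot I\<^esub> (I +> a)"
  by (rule add_hom_int[OF ring_axioms quotient_is_ring rcos_add_hom])

lemma quot_lift:
  fixes R (structure)
  assumes "ideal I R" "ring R'" "add_hom R R' f" "\<And>x. x \<in> I \<Longrightarrow> f x = \<zero>\<^bsub>R'\<^esub>"
  obtains f' where "add_hom (R Quot I) R' f'" "\<And>a. a \<in> carrier R \<Longrightarrow> f' (I +>\<^bsub>R\<^esub> a) = f a"
proof -
  interpret ideal I R by fact
  interpret R': ring R' by fact
  define f' where "f' C = f (SOME a. a \<in> carrier R \<and> C = I +> a)" for C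
  have val: "f' (I +> a) = f a" if "a \<in> carrier R" for a
  proof -
    define b where "b = (SOME b. b \<in> carrier R \<and> I +> a = I +> b)"
    have b: "b \<in> carrier R" "I +> a = I +> b"
      using someI[of "\<lambda>b. b \<in> carrier R \<and> I +> a = I +> b" a] that unfolding b_def by auto
    have "a \<ominus> b \<in> I" using coset_eqD[OF that b] .
    then have "f (a \<ominus> b) = \<zero>\<^bsub>R'\<^esub>" by (rule assms(4))
    moreover have "a = (a \<ominus> b) \<oplus> b" using that b(1) by algebra
    ultimately have "f a = f b"
      using add_hom_add[OF assms(3), of "a \<ominus> b" b] that b(1) add_hom_closed[OF assms(3)] by simp
    then show ?thesis by (simp add: f'_def b_def)
  qed
  have "add_hom (R Quot I) R' f'"
  proof (rule add_homI)
    fix C assume "C \<in> carrier (R Quot I)"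
    then show "f' C \<in> carrier R'" using val add_hom_closed[OF assms(3)] by (auto simp: quot_carrier)
    fix D assume "D \<in> carrier (R Quot I)"
    then show "f' (C \<oplus>\<^bsub>R Quot I\<^esub> D) = f' C \<oplus>\<^bsub>R'\<^esub> f' D"
      using \<open>C \<in> carrier (R Quot I)\<close> add_hom_add[OF assms(3)]
      by (auto simp: quot_carrier quot_add val)
  qed
  then show thesis using val by (rule that)
qed

lemma quot_lift_ring_hom:
  fixes R (structure)
  assumes "ideal I R" "ring R'" "f \<in> Ring.ring_hom R R'" "\<And>x. x \<in> I \<Longrightarrow> f x = \<zero>\<^bsub>R'\<^esub>"
  obtains f' where "f' \<in> Ring.ring_hom (R Quot I) R'" "\<And>a. a \<in> carrier R \<Longrightarrow> f' (I +>\<^bsub>R\<^esub> a) = f a"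
proof -
  interpret ideal I R by fact
  obtain f' where f': "add_hom (R Quot I) R' f'" "\<And>a. a \<in> carrier R \<Longrightarrow> f' (I +> a) = f a"
    using quot_lift[OF assms(1,2) ring_hom_add_hom[OF assms(3)] assms(4)] by blast
  have "f' \<in> Ring.ring_hom (R Quot I) R'"
  proof (rule ring_hom_memI)
    fix C D assume *: "C \<in> carrier (R Quot I)" "D \<in> carrier (R Quot I)"
    show "f' C \<in> carrier R'" using add_hom_closed[OF f'(1)] * by blast
    show "f' (C \<oplus>\<^bsub>R Quot I\<^esub> D) = f' C \<oplus>\<^bsub>R'\<^esub> f' D" using add_hom_add[OF f'(1)] * by blast
    show "f' (C \<otimes>\<^bsub>R Quot I\<^esub> D) = f' C \<otimes>\<^bsub>R'\<^esub> f' D"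
      using * ring_hom_mult[OF assms(3)] by (auto simp: quot_carrier quot_mult f'(2))
  qed (use ring_hom_one[OF assms(3)] in \<open>simp add: f'(2)\<close>)
  then show thesis using f'(2) by (rule that)
qed

text \<open>Kernels of ring homomorphisms are ideals, so vanishing is tested on generators.\<close>

lemma ring_hom_vanish_Idl:
  assumes "ring R" "ring R'" "f \<in> Ring.ring_hom R R'" "G \<subseteq> carrier R" "\<And>x. x \<in> G \<Longrightarrow> f x = \<zero>\<^bsub>R'\<^esub>"
    and "x \<in> Idl\<^bsub>R\<^esub> G"
  shows "f x = \<zero>\<^bsub>R'\<^esub>"
proof -
  interpret R: ring R by fact
  have "ideal (a_kernel R R' f) R"
    by (rule ring_hom_ring.kernel_is_ideal) (rule ring_hom_ringI2[OF assms(1-3)])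
  moreover have "G \<subseteq> a_kernel R R' f"
    using assms(4,5) unfolding a_kernel_def' by blast
  ultimately have "x \<in> a_kernel R R' f"
    using R.genideal_minimal assms(6) by blast
  then show ?thesis unfolding a_kernel_def' by blast
qed

text \<open>
  The elements of a coset of \<open>I\<close> have congruent images, so the union in the definition of
  \<open>induced_map\<close> is a union of equal cosets.
\<close>

lemma induced_map_coset:
  assumes "ideal I R" "ideal I' R'" "add_hom R R' f" "f ` I \<subseteq> I'" "a \<in> carrier R"
  shows "induced_map R I R' I' f (I +>\<^bsub>R\<^esub> a) = I' +>\<^bsub>R'\<^esub> f a"
proof -
  interpret I: ideal I R by fact
  interpret I': ideal I' R' by fact
  have coset_eq: "I' +>\<^bsub>R'\<^esub> (i \<oplus>\<^bsub>R'\<^esub> y) = I' +>\<^bsub>R'\<^esub> y" if "i \<in> I'" "y \<in> carrier R'" for i y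
  proof (rule I'.coset_eqI)
    have "(i \<oplus>\<^bsub>R'\<^esub> y) \<ominus>\<^bsub>R'\<^esub> y = i" using that I'.a_Hcarr[of i] by algebra
    then show "(i \<oplus>\<^bsub>R'\<^esub> y) \<ominus>\<^bsub>R'\<^esub> y \<in> I'" using that by simp
  qed (use that I'.a_Hcarr[of i] in auto)
  have "I' +>\<^bsub>R'\<^esub> f b = I' +>\<^bsub>R'\<^esub> f a" if "b \<in> I +>\<^bsub>R\<^esub> a" for b
  proof -
    have "b \<in> (\<Union>c\<in>I. {c \<oplus>\<^bsub>R\<^esub> a})" using that by (simp only: a_r_coset_def')
    then obtain c where c: "c \<in> I" "b = c \<oplus>\<^bsub>R\<^esub> a" by (elim UN_E singletonE)
    then have "f b = f c \<oplus>\<^bsub>R'\<^esub> f a" using assms(5) by (simp add: add_hom_add[OF assms(3)])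
    moreover have "f c \<in> I'" using c assms(4) by auto
    ultimately show ?thesis
      using coset_eq[OF _ add_hom_closed[OF assms(3,5)]] by simp
  qed
  then have "(\<Union>b\<in>I +>\<^bsub>R\<^esub> a. I' +>\<^bsub>R'\<^esub> f b) = (\<Union>b\<in>I +>\<^bsub>R\<^esub> a. I' +>\<^bsub>R'\<^esub> f a)"
    by (intro SUP_cong) auto
  moreover have "a \<in> I +>\<^bsub>R\<^esub> a" using assms(5) by (rule I.a_rcos_self)
  ultimately show ?thesis
    using I.quot_closed[OF assms(5)] by (auto simp: induced_map_def)
qed

lemma well_defined_on_quotientI:
  assumes "ideal I R" "ideal I' R'" "add_hom R R' f" "f ` I \<subseteq> I'"
  shows "well_defined_on_quotient R I R' I' f"
  using induced_map_coset[OF assms] by (simp add: well_defined_on_quotient_def)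

section \<open>Integer multiples\<close>

context ring
begin

lemma int_mult_closed [simp, intro]: "x \<in> carrier R \<Longrightarrow> [(a::int)] \<cdot> x \<in> carrier R"
  by simp

lemma int_mult_0 [simp]: "[(0::int)] \<cdot> x = \<zero>"
  by (simp add: add_pow_def)

lemma int_mult_1 [simp]: "x \<in> carrier R \<Longrightarrow> [(1::int)] \<cdot> x = x"
  by (rule add.int_pow_1)

lemma int_mult_neg: "x \<in> carrier R \<Longrightarrow> [(- a)] \<cdot> x = \<ominus> ([(a::int)] \<cdot> x)"
  by (rule add.int_pow_neg)

lemma int_mult_int_mult [simp]: "x \<in> carrier R \<Longrightarrow> [(a::int)] \<cdot> ([(b::int)] \<cdot> x) = [(a * b)] \<cdot> x"
  by (simp add: add.int_pow_pow mult.commute)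

lemma int_mult_add_left: "x \<in> carrier R \<Longrightarrow> [(a + b::int)] \<cdot> x = [a] \<cdot> x \<oplus> [b] \<cdot> x"
  by (rule add.int_pow_mult)

lemma int_mult_add_right:
  "x \<in> carrier R \<Longrightarrow> y \<in> carrier R \<Longrightarrow> [(a::int)] \<cdot> (x \<oplus> y) = [a] \<cdot> x \<oplus> [a] \<cdot> y"
  by (rule add.int_pow_distrib)

lemma int_mult_minus_right: "x \<in> carrier R \<Longrightarrow> [(a::int)] \<cdot> (\<ominus> x) = \<ominus> ([a] \<cdot> x)"
  by (rule add.int_pow_inv)

lemma int_mult_add_hom: "add_hom R R (\<lambda>x. [(a::int)] \<cdot> x)"
  by (rule add_homI) (simp_all add: int_mult_add_right)

end

section \<open>Products of lists\<close>

context ring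
begin

lemma list_prod_Nil [simp]: "ring_list_prod R [] = \<one>"
  and list_prod_Cons [simp]: "ring_list_prod R (x # xs) = x \<otimes> ring_list_prod R xs"
  by (simp_all add: ring_list_prod_def)

lemma list_prod_closed [simp, intro]: "set xs \<subseteq> carrier R \<Longrightarrow> ring_list_prod R xs \<in> carrier R"
  by (induction xs) auto

lemma list_prod_append [simp]:
  "set xs \<subseteq> carrier R \<Longrightarrow> set ys \<subseteq> carrier R \<Longrightarrow>
    ring_list_prod R (xs @ ys) = ring_list_prod R xs \<otimes> ring_list_prod R ys"
  by (induction xs) (auto simp: m_assoc)

lemma list_prod_concat:
  "(\<And>xs. xs \<in> set xss \<Longrightarrow> set xs \<subseteq> carrier R) \<Longrightarrow>
    ring_list_prod R (map (ring_list_prod R) xss) = ring_list_prod R (concat xss)"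
  by (induction xss) (auto simp: UN_subset_iff)

end

lemma ring_hom_list_prod:
  assumes "ring R" "ring R'" "f \<in> Ring.ring_hom R R'" "set xs \<subseteq> carrier R"
  shows "f (ring_list_prod R xs) = ring_list_prod R' (map f xs)"
proof -
  interpret R: ring R by fact
  interpret R': ring R' by fact
  show ?thesis using assms(4)
    by (induction xs) (auto simp: ring_hom_one[OF assms(3)] ring_hom_mult[OF assms(3)])
qed

section \<open>Twisted monoid algebras\<close>

text \<open>
  The product of \<open>twisted_monoid_algebra\<close>, written as an iterated linear extension to make its
  bilinearity immediate.
\<close>

definition twisted_mult :: "('b \<Rightarrow> 'b \<Rightarrow> int) \<Rightarrow> ('b \<Rightarrow> 'b \<Rightarrow> 'b) \<Rightarrow> ('b \<Rightarrow>\<^sub>0 int) \<Rightarrow> ('b \<Rightarrow>\<^sub>0 int) \<Rightarrow> ('b \<Rightarrow>\<^sub>0 int)"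
  where "twisted_mult c op f g =
    frag_extend (\<lambda>u. frag_extend (\<lambda>v. frag_cmul (c u v) (frag_of (op u v))) g) f"

lemma frag_cmul_single: "frag_cmul c (Poly_Mapping.single u d) = Poly_Mapping.single u (c * d)"
  by (rule poly_mapping_eqI) (simp add: lookup_single when_def)

lemma twisted_mult_eq:
  "(\<Sum>u\<in>Poly_Mapping.keys f. \<Sum>v\<in>Poly_Mapping.keys g.
      Poly_Mapping.single (op u v) (c u v * Poly_Mapping.lookup f u * Poly_Mapping.lookup g v)) =
   twisted_mult c op f g"
  unfolding twisted_mult_def frag_extend_def frag_cmul_sum
  by (simp add: frag_cmul_single mult_ac)

lemma twisted_mult_diff_left: "twisted_mult c op (f - f') g = twisted_mult c op f g - twisted_mult c op f' g"
  by (simp add: twisted_mult_def frag_extend_diff)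

lemma frag_extend_diff_fun: "frag_extend (\<lambda>u. a u - b u) f = frag_extend a f - frag_extend b f"
  using subset_UNIV by (induction f rule: frag_induction) (auto simp: frag_extend_diff)

lemma frag_extend_add_fun: "frag_extend (\<lambda>u. a u + b u) f = frag_extend a f + frag_extend b f"
  using subset_UNIV by (induction f rule: frag_induction) (auto simp: frag_extend_diff)

lemma twisted_mult_diff_right: "twisted_mult c op f (g - g') = twisted_mult c op f g - twisted_mult c op f g'"
  by (simp add: twisted_mult_def frag_extend_diff frag_extend_diff_fun)

lemma twisted_mult_add_left: "twisted_mult c op (f + f') g = twisted_mult c op f g + twisted_mult c op f' g"
  by (simp add: twisted_mult_def frag_extend_add)

lemma twisted_mult_add_right: "twisted_mult c op f (g + g') = twisted_mult c op f g + twisted_mult c op f g'"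
  by (simp add: twisted_mult_def frag_extend_add frag_extend_add_fun)

lemma twisted_mult_zero [simp]: "twisted_mult c op 0 g = 0" "twisted_mult c op f 0 = 0"
  using twisted_mult_diff_left[of c op 0 0 g] twisted_mult_diff_right[of c op f 0 0] by simp_all

lemma twisted_mult_frag_of [simp]:
  "twisted_mult c op (frag_of u) (frag_of v) = frag_cmul (c u v) (frag_of (op u v))"
  by (simp add: twisted_mult_def)

lemma twisted_mult_cmul_left: "twisted_mult c op (frag_cmul k f) g = frag_cmul k (twisted_mult c op f g)"
  by (simp add: twisted_mult_def frag_extend_cmul)

lemma twisted_mult_cmul_right: "twisted_mult c op f (frag_cmul k g) = frag_cmul k (twisted_mult c op f g)"
proof -
  have diff: "frag_cmul k (a - b) = frag_cmul k a - frag_cmul k b" for a b :: "'a \<Rightarrow>\<^sub>0 int"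
    by (rule poly_mapping_eqI) (simp add: lookup_minus right_diff_distrib)
  show ?thesis using subset_UNIV
    by (induction f rule: frag_induction)
      (simp_all only: twisted_mult_diff_left diff, simp_all add: twisted_mult_def frag_extend_cmul)
qed

lemma keys_twisted_mult:
  assumes "\<And>u v. u \<in> B \<Longrightarrow> v \<in> B \<Longrightarrow> op u v \<in> B" "Poly_Mapping.keys f \<subseteq> B" "Poly_Mapping.keys g \<subseteq> B"
  shows "Poly_Mapping.keys (twisted_mult c op f g) \<subseteq> B"
proof -
  have "Poly_Mapping.keys (frag_extend (\<lambda>v. frag_cmul (c u v) (frag_of (op u v))) g) \<subseteq> B" if "u \<in> B" for u
    using that assms(1,3) by (auto dest!: keys_frag_extend[THEN subsetD])
  then have "(\<Union>u\<in>Poly_Mapping.keys f.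
      Poly_Mapping.keys (frag_extend (\<lambda>v. frag_cmul (c u v) (frag_of (op u v))) g)) \<subseteq> B"
    using assms(2) by blast
  then show ?thesis unfolding twisted_mult_def using keys_frag_extend by (rule subset_trans[rotated])
qed

text \<open>
  The cocycle identity is what associativity of the twisted product amounts to on basis elements.
\<close>

locale twisted_monoid =
  fixes B :: "'b set" and c :: "'b \<Rightarrow> 'b \<Rightarrow> int" and op :: "'b \<Rightarrow> 'b \<Rightarrow> 'b" and e :: 'b
  assumes op_closed: "\<And>u v. u \<in> B \<Longrightarrow> v \<in> B \<Longrightarrow> op u v \<in> B"
    and unit_closed: "e \<in> B"
    and op_assoc: "\<And>u v w. u \<in> B \<Longrightarrow> v \<in> B \<Longrightarrow> w \<in> B \<Longrightarrow> op (op u v) w = op u (op v w)"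
    and op_unit: "\<And>u. u \<in> B \<Longrightarrow> op e u = u" "\<And>u. u \<in> B \<Longrightarrow> op u e = u"
    and cocycle: "\<And>u v w. u \<in> B \<Longrightarrow> v \<in> B \<Longrightarrow> w \<in> B \<Longrightarrow> c u v * c (op u v) w = c v w * c u (op v w)"
    and c_unit: "\<And>u. u \<in> B \<Longrightarrow> c e u = 1" "\<And>u. u \<in> B \<Longrightarrow> c u e = 1"
begin

abbreviation "A \<equiv> twisted_monoid_algebra B c op e"

lemma carrier_A: "f \<in> carrier A \<longleftrightarrow> Poly_Mapping.keys f \<subseteq> B"
  and mult_A: "f \<otimes>\<^bsub>A\<^esub> g = twisted_mult c op f g"
  and add_A: "f \<oplus>\<^bsub>A\<^esub> g = f + g"
  and zero_A: "\<zero>\<^bsub>A\<^esub> = 0"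
  and one_A: "\<one>\<^bsub>A\<^esub> = frag_of e"
  by (simp_all add: twisted_monoid_algebra_def twisted_mult_eq)

lemma ring_A: "ring A"
proof (rule ringI)
  show "abelian_group A"
  proof (rule abelian_groupI)
    fix x assume "x \<in> carrier A"
    then show "\<exists>y\<in>carrier A. y \<oplus>\<^bsub>A\<^esub> x = \<zero>\<^bsub>A\<^esub>"
      by (intro bexI[of _ "- x"]) (simp_all add: carrier_A add_A zero_A)
  qed (auto simp: carrier_A add_A zero_A add.assoc add.commute dest!: keys_add[THEN subsetD])
  show "Group.monoid A"
  proof (rule monoidI)
    fix f g h assume "f \<in> carrier A" "g \<in> carrier A" "h \<in> carrier A"
    then have f: "Poly_Mapping.keys f \<subseteq> B" and g: "Poly_Mapping.keys g \<subseteq> B" and h: "Poly_Mapping.keys h \<subseteq> B"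
      by (simp_all add: carrier_A)
    have 1: "twisted_mult c op (twisted_mult c op (frag_of u) (frag_of v)) (frag_of w) =
      twisted_mult c op (frag_of u) (twisted_mult c op (frag_of v) (frag_of w))"
      if "u \<in> B" "v \<in> B" "w \<in> B" for u v w
      using that cocycle[of u v w] op_assoc[of u v w]
      by (simp add: twisted_mult_cmul_left twisted_mult_cmul_right)
    have 2: "twisted_mult c op (twisted_mult c op (frag_of u) (frag_of v)) h =
      twisted_mult c op (frag_of u) (twisted_mult c op (frag_of v) h)" if "u \<in> B" "v \<in> B" for u v
      using h by (induction h rule: frag_induction)
        (use that 1 in \<open>simp_all only: twisted_mult_diff_right twisted_mult_zero\<close>)
    have 3: "twisted_mult c op (twisted_mult c op (frag_of u) g) h =
      twisted_mult c op (frag_of u) (twisted_mult c op g h)" if "u \<in> B" for u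
      using g by (induction g rule: frag_induction)
        (use that 2 in \<open>simp_all only: twisted_mult_diff_right twisted_mult_diff_left twisted_mult_zero\<close>)
    have "twisted_mult c op (twisted_mult c op f g) h = twisted_mult c op f (twisted_mult c op g h)"
      using f by (induction f rule: frag_induction)
        (use 3 in \<open>simp_all only: twisted_mult_diff_left twisted_mult_zero\<close>)
    then show "f \<otimes>\<^bsub>A\<^esub> g \<otimes>\<^bsub>A\<^esub> h = f \<otimes>\<^bsub>A\<^esub> (g \<otimes>\<^bsub>A\<^esub> h)" by (simp add: mult_A)
  next
    fix f assume "f \<in> carrier A"
    then have f: "Poly_Mapping.keys f \<subseteq> B" by (simp add: carrier_A)
    show "\<one>\<^bsub>A\<^esub> \<otimes>\<^bsub>A\<^esub> f = f"
      using f by (induction f rule: frag_induction)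
        (auto simp: mult_A one_A twisted_mult_diff_right op_unit c_unit)
    show "f \<otimes>\<^bsub>A\<^esub> \<one>\<^bsub>A\<^esub> = f"
      using f by (induction f rule: frag_induction)
        (auto simp: mult_A one_A twisted_mult_diff_left op_unit c_unit)
  qed (simp_all add: carrier_A mult_A one_A unit_closed keys_twisted_mult[OF op_closed])
qed (auto simp: add_A mult_A twisted_mult_add_left twisted_mult_add_right)

sublocale A: ring A by (rule ring_A)

lemma neg_A: "f \<in> carrier A \<Longrightarrow> \<ominus>\<^bsub>A\<^esub> f = - f"
  by (rule A.minus_equality) (auto simp: add_A zero_A carrier_A)

lemma minus_A: "f \<in> carrier A \<Longrightarrow> g \<in> carrier A \<Longrightarrow> f \<ominus>\<^bsub>A\<^esub> g = f - g"
  by (simp add: a_minus_def neg_A add_A)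

lemma frag_of_A [simp]: "u \<in> B \<Longrightarrow> frag_of u \<in> carrier A"
  by (simp add: carrier_A)

lemma nat_A: "f \<in> carrier A \<Longrightarrow> [(k::nat)] \<cdot>\<^bsub>A\<^esub> f = frag_cmul (int k) f"
  by (induction k) (auto simp: zero_A add_A frag_cmul_distrib add_ac)

lemma int_A: "f \<in> carrier A \<Longrightarrow> [(k::int)] \<cdot>\<^bsub>A\<^esub> f = frag_cmul k f"
  by (cases "k \<ge> 0")
    (simp_all add: add_pow_int_ge add_pow_int_lt nat_A neg_A carrier_A order_trans[OF keys_cmul])

lemma add_subgroup_induct [consumes 1, case_names zero one neg add]:
  assumes "f \<in> carrier A" "P \<zero>\<^bsub>A\<^esub>" "\<And>u. u \<in> B \<Longrightarrow> P (frag_of u)"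
    "\<And>f. f \<in> carrier A \<Longrightarrow> P f \<Longrightarrow> P (\<ominus>\<^bsub>A\<^esub> f)"
    "\<And>f g. f \<in> carrier A \<Longrightarrow> g \<in> carrier A \<Longrightarrow> P f \<Longrightarrow> P g \<Longrightarrow> P (f \<oplus>\<^bsub>A\<^esub> g)"
  shows "P f"
proof -
  have "f \<in> carrier A \<and> P f"
    using assms(1)[unfolded carrier_A]
  proof (induction f rule: frag_induction)
    case (diff a b)
    then have "P (a \<oplus>\<^bsub>A\<^esub> \<ominus>\<^bsub>A\<^esub> b)" "a \<ominus>\<^bsub>A\<^esub> b \<in> carrier A" by (auto intro!: assms(4,5))
    then show ?case using diff by (simp add: minus_A a_minus_def[symmetric])
  qed (use assms(2,3) zero_A A.zero_closed in auto)
  then show ?thesis by blast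
qed

end

definition lin_ext :: "('r, 'c) ring_scheme \<Rightarrow> ('b \<Rightarrow> 'r) \<Rightarrow> ('b \<Rightarrow>\<^sub>0 int) \<Rightarrow> 'r" where
  "lin_ext R F f = (\<Oplus>\<^bsub>R\<^esub>u\<in>Poly_Mapping.keys f. [Poly_Mapping.lookup f u] \<cdot>\<^bsub>R\<^esub> F u)"

context ring
begin

lemma lin_ext_superset:
  assumes "F \<in> B \<rightarrow> carrier R" "finite K" "K \<subseteq> B" "Poly_Mapping.keys f \<subseteq> K"
  shows "lin_ext R F f = (\<Oplus>u\<in>K. [Poly_Mapping.lookup f u] \<cdot> F u)"
proof -
  have "[(0::int)] \<cdot> x = \<zero>" for x by (simp add: add_pow_def)
  then show ?thesis
    unfolding lin_ext_def
    by (intro add.finprod_mono_neutral_cong_left)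
      (use assms in \<open>auto simp: in_keys_iff Pi_iff subset_iff\<close>)
qed

lemma lin_ext_closed:
  "F \<in> B \<rightarrow> carrier R \<Longrightarrow> Poly_Mapping.keys f \<subseteq> B \<Longrightarrow> lin_ext R F f \<in> carrier R"
  unfolding lin_ext_def by (rule finsum_closed) auto

lemma lin_ext_frag_of: "F u \<in> carrier R \<Longrightarrow> lin_ext R F (frag_of u) = F u"
  by (simp add: lin_ext_def)

lemma lin_ext_add:
  assumes F: "F \<in> B \<rightarrow> carrier R" "Poly_Mapping.keys f \<subseteq> B" "Poly_Mapping.keys g \<subseteq> B"
  shows "lin_ext R F (f + g) = lin_ext R F f \<oplus> lin_ext R F g"
proof -
  let ?K = "Poly_Mapping.keys f \<union> Poly_Mapping.keys g"
  have K: "finite ?K" "?K \<subseteq> B" using assms by auto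
  have FK: "F \<in> ?K \<rightarrow> carrier R" using F(1) K(2) by auto
  have "lin_ext R F (f + g) = (\<Oplus>u\<in>?K. [Poly_Mapping.lookup (f + g) u] \<cdot> F u)"
    by (rule lin_ext_superset[OF F(1) K]) (rule keys_add)
  also have "\<dots> = (\<Oplus>u\<in>?K. [Poly_Mapping.lookup f u] \<cdot> F u \<oplus> [Poly_Mapping.lookup g u] \<cdot> F u)"
    using FK by (intro finsum_cong') (auto simp: lookup_add add.int_pow_mult Pi_iff)
  also have "\<dots> = (\<Oplus>u\<in>?K. [Poly_Mapping.lookup f u] \<cdot> F u) \<oplus> (\<Oplus>u\<in>?K. [Poly_Mapping.lookup g u] \<cdot> F u)"
    using FK by (intro finsum_addf) auto
  also have "\<dots> = lin_ext R F f \<oplus> lin_ext R F g"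
    by (simp add: lin_ext_superset[OF F(1) K])
  finally show ?thesis .
qed

end

text \<open>
  The map \<open>N\<close> is only additive, so its kernel need not be an ideal. The proof works with the
  largest ideal contained in the kernel; membership in it is additive in both multipliers, which
  therefore range over basis elements only.
\<close>

lemma (in twisted_monoid) vanish_Idl:
  fixes N :: "('b \<Rightarrow>\<^sub>0 int) \<Rightarrow> 'g :: ab_group_add"
  assumes G: "G \<subseteq> carrier A"
    and N_add: "\<And>f g. f \<in> carrier A \<Longrightarrow> g \<in> carrier A \<Longrightarrow> N (f \<oplus>\<^bsub>A\<^esub> g) = N f + N g"
    and gen: "\<And>u g v. u \<in> B \<Longrightarrow> g \<in> G \<Longrightarrow> v \<in> B \<Longrightarrow> N (frag_of u \<otimes>\<^bsub>A\<^esub> g \<otimes>\<^bsub>A\<^esub> frag_of v) = 0"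
    and f: "f \<in> Idl\<^bsub>A\<^esub> G"
  shows "N f = 0"
proof -
  have N_zero: "N \<zero>\<^bsub>A\<^esub> = 0" using N_add[of "\<zero>\<^bsub>A\<^esub>" "\<zero>\<^bsub>A\<^esub>"] by simp
  have N_neg: "N (\<ominus>\<^bsub>A\<^esub> g) = - N g" if "g \<in> carrier A" for g
    using N_add[of g "\<ominus>\<^bsub>A\<^esub> g"] that by (simp add: A.r_neg N_zero eq_neg_iff_add_eq_0 add.commute)
  let ?K = "{f \<in> carrier A. \<forall>a\<in>carrier A. \<forall>b\<in>carrier A. N (a \<otimes>\<^bsub>A\<^esub> f \<otimes>\<^bsub>A\<^esub> b) = 0}"
  have "ideal ?K A"
  proof (rule idealI[OF ring_A])
    show "subgroup ?K (add_monoid A)"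
      by (rule A.add.subgroupI)
        (auto simp: N_zero N_add N_neg A.l_distr A.r_distr A.l_minus A.r_minus
          simp flip: a_inv_def intro: exI[of _ "\<zero>\<^bsub>A\<^esub>"])
    fix a x assume a: "a \<in> ?K" "x \<in> carrier A"
    have "b \<otimes>\<^bsub>A\<^esub> (x \<otimes>\<^bsub>A\<^esub> a) \<otimes>\<^bsub>A\<^esub> c = (b \<otimes>\<^bsub>A\<^esub> x) \<otimes>\<^bsub>A\<^esub> a \<otimes>\<^bsub>A\<^esub> c"
      "b \<otimes>\<^bsub>A\<^esub> (a \<otimes>\<^bsub>A\<^esub> x) \<otimes>\<^bsub>A\<^esub> c = b \<otimes>\<^bsub>A\<^esub> a \<otimes>\<^bsub>A\<^esub> (x \<otimes>\<^bsub>A\<^esub> c)"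
      if "b \<in> carrier A" "c \<in> carrier A" for b c
      using that a by (simp_all add: A.m_assoc)
    then show "x \<otimes>\<^bsub>A\<^esub> a \<in> ?K" "a \<otimes>\<^bsub>A\<^esub> x \<in> ?K" using a by auto
  qed
  moreover have "G \<subseteq> ?K"
  proof safe
    fix g assume g: "g \<in> G"
    then show gc: "g \<in> carrier A" using G by blast
    fix a b assume a: "a \<in> carrier A" and b: "b \<in> carrier A"
    show "N (a \<otimes>\<^bsub>A\<^esub> g \<otimes>\<^bsub>A\<^esub> b) = 0" using a
    proof (induction a rule: add_subgroup_induct)
      case (one u)
      show ?case using b
        by (induction b rule: add_subgroup_induct)
          (use one gc gen[OF one g] in \<open>simp_all add: A.r_distr A.r_minus N_zero N_add N_neg\<close>)
    qed (use b gc in \<open>simp_all add: A.l_distr A.l_minus N_zero N_add N_neg\<close>)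
  qed
  ultimately have "f \<in> ?K" using A.genideal_minimal f by blast
  then have "N (\<one>\<^bsub>A\<^esub> \<otimes>\<^bsub>A\<^esub> f \<otimes>\<^bsub>A\<^esub> \<one>\<^bsub>A\<^esub>) = 0" "f \<in> carrier A" by blast+
  then show ?thesis by simp
qed

lemma (in twisted_monoid) lin_ext_add_hom:
  assumes "ring R" "F \<in> B \<rightarrow> carrier R"
  shows "add_hom A R (lin_ext R F)"
  using ring.lin_ext_add[OF assms] ring.lin_ext_closed[OF assms]
  by (auto simp: add_hom_def carrier_A add_A)

lemma (in twisted_monoid) lin_ext_ring_hom:
  assumes "ring R" "F \<in> B \<rightarrow> carrier R" "F e = \<one>\<^bsub>R\<^esub>"
    and "\<And>u v. u \<in> B \<Longrightarrow> v \<in> B \<Longrightarrow> F u \<otimes>\<^bsub>R\<^esub> F v = [c u v] \<cdot>\<^bsub>R\<^esub> F (op u v)"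
  shows "lin_ext R F \<in> Ring.ring_hom A R"
proof -
  interpret R: ring R by fact
  note hom = lin_ext_add_hom[OF assms(1,2)]
  let ?L = "lin_ext R F"
  have FB: "F u \<in> carrier R" if "u \<in> B" for u using that assms(2) by auto
  note cl = add_hom_closed[OF hom] and neg = add_hom_neg[OF ring_A assms(1) hom]
    and add = add_hom_add[OF hom] and zero = add_hom_zero[OF ring_A assms(1) hom]
  have mult: "?L (f \<otimes>\<^bsub>A\<^esub> g) = ?L f \<otimes>\<^bsub>R\<^esub> ?L g" if f: "f \<in> carrier A" and g: "g \<in> carrier A" for f g
    using f
  proof (induction f rule: add_subgroup_induct)
    case (one u)
    show ?case using g
    proof (induction g rule: add_subgroup_induct)
      case (one v)
      have "?L (frag_of u \<otimes>\<^bsub>A\<^esub> frag_of v) = ?L ([c u v] \<cdot>\<^bsub>A\<^esub> frag_of (op u v))"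
        using \<open>u \<in> B\<close> one by (simp add: mult_A int_A op_closed)
      also have "\<dots> = [c u v] \<cdot>\<^bsub>R\<^esub> F (op u v)"
        using \<open>u \<in> B\<close> one
        by (simp add: add_hom_int[OF ring_A assms(1) hom] op_closed R.lin_ext_frag_of FB)
      finally show ?case using \<open>u \<in> B\<close> one by (simp add: assms(4) R.lin_ext_frag_of FB)
    qed (use \<open>u \<in> B\<close> in \<open>simp_all add: A.r_distr R.r_distr A.r_minus R.r_minus neg add zero cl\<close>)
  qed (use g in \<open>simp_all add: A.l_distr R.l_distr A.l_minus R.l_minus neg add zero cl\<close>)
  show ?thesis
    by (rule ring_hom_memI) (use cl add mult in \<open>simp_all add: one_A R.lin_ext_frag_of FB unit_closed assms(3)\<close>)
qed

section \<open>Free skew-symmetric algebras\<close>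

declare Cons_in_lists_iff [simp]

interpretation FA: twisted_monoid "lists X" "\<lambda>_ _. 1" "(@)" "[]"
  rewrites "twisted_monoid_algebra (lists X) (\<lambda>_ _. 1) (@) [] = free_algebra X"
  for X :: "'x set"
  by unfold_locales (auto simp: free_algebra_def)

lemma skew_gens_subset:
  "{frag_of [x, y] + frag_of [y, x] | x y. x \<in> X \<and> y \<in> X} \<union>
    {frag_of [x, x] | x. x \<in> X} \<subseteq> carrier (free_algebra X)"
  by (auto simp: FA.carrier_A dest!: keys_add[THEN subsetD] split: if_splits)

lemma ideal_skew_ideal: "ideal (skew_ideal X) (free_algebra X)"
  unfolding skew_ideal_def by (rule FA.A.genideal_ideal[OF skew_gens_subset])

interpretation Sk: ring "Skew X" for X :: "'x set"
  unfolding Skew_def by (rule ideal.quotient_is_ring[OF ideal_skew_ideal])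

lemma skew_mon_closed [simp]: "w \<in> lists X \<Longrightarrow> skew_mon X w \<in> carrier (Skew X)"
  by (simp add: skew_mon_def Skew_def ideal.quot_closed[OF ideal_skew_ideal])

lemma skew_mon_append:
  "u \<in> lists X \<Longrightarrow> v \<in> lists X \<Longrightarrow> skew_mon X (u @ v) = skew_mon X u \<otimes>\<^bsub>Skew X\<^esub> skew_mon X v"
  by (simp add: skew_mon_def Skew_def ideal.quot_mult[OF ideal_skew_ideal] FA.mult_A)

lemma skew_mon_Nil: "skew_mon X [] = \<one>\<^bsub>Skew X\<^esub>"
  by (simp add: skew_mon_def Skew_def FA.one_A)

lemma skew_mon_Cons:
  "x \<in> X \<Longrightarrow> w \<in> lists X \<Longrightarrow> skew_mon X (x # w) = skew_mon X [x] \<otimes>\<^bsub>Skew X\<^esub> skew_mon X w"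
  using skew_mon_append[of "[x]" X w] by simp

lemma skew_mon_anti:
  assumes "x \<in> X" "y \<in> X"
  shows "skew_mon X [x, y] = \<ominus>\<^bsub>Skew X\<^esub> skew_mon X [y, x]"
proof -
  have "frag_of [x, y] + frag_of [y, x] \<in> skew_ideal X"
    unfolding skew_ideal_def using assms by (intro FA.A.genideal_self[OF skew_gens_subset, THEN subsetD]) blast
  then have "skew_mon X [x, y] \<oplus>\<^bsub>Skew X\<^esub> skew_mon X [y, x] = \<zero>\<^bsub>Skew X\<^esub>"
    using assms ideal.rcos_const[OF ideal_skew_ideal] by (simp add: skew_mon_def Skew_def ideal.quot_add[OF ideal_skew_ideal] FA.add_A)
  then show ?thesis using assms by (intro Sk.minus_equality[symmetric]) auto
qed

lemma skew_mon_square: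
  assumes "x \<in> X" shows "skew_mon X [x, x] = \<zero>\<^bsub>Skew X\<^esub>"
proof -
  have "frag_of [x, x] \<in> skew_ideal X"
    unfolding skew_ideal_def using assms by (intro FA.A.genideal_self[OF skew_gens_subset, THEN subsetD]) blast
  then show ?thesis by (simp add: skew_mon_def Skew_def ideal.rcos_const[OF ideal_skew_ideal])
qed

lemma skew_coset_zero: "skew_ideal X +>\<^bsub>free_algebra X\<^esub> 0 = \<zero>\<^bsub>Skew X\<^esub>"
  using ideal.rcos_const[OF ideal_skew_ideal additive_subgroup.zero_closed[OF
      ideal.axioms(1)[OF ideal_skew_ideal[of X]]]]
  by (simp add: Skew_def FA.zero_A)

lemma skew_induct [consumes 1, case_names zero mon neg add]:
  assumes "a \<in> carrier (Skew X)" "P \<zero>\<^bsub>Skew X\<^esub>" "\<And>w. w \<in> lists X \<Longrightarrow> P (skew_mon X w)"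
    "\<And>a. a \<in> carrier (Skew X) \<Longrightarrow> P a \<Longrightarrow> P (\<ominus>\<^bsub>Skew X\<^esub> a)"
    "\<And>a b. a \<in> carrier (Skew X) \<Longrightarrow> b \<in> carrier (Skew X) \<Longrightarrow> P a \<Longrightarrow> P b \<Longrightarrow> P (a \<oplus>\<^bsub>Skew X\<^esub> b)"
  shows "P a"
proof -
  obtain f where f: "f \<in> carrier (free_algebra X)" "a = skew_ideal X +>\<^bsub>free_algebra X\<^esub> f"
    using assms(1) by (auto simp: Skew_def ideal.quot_carrier[OF ideal_skew_ideal])
  have "P (skew_ideal X +>\<^bsub>free_algebra X\<^esub> f)"
    using f(1)
  proof (induction f rule: FA.add_subgroup_induct)
    case zero
    show ?case using assms(2) skew_coset_zero[of X] by (simp only: FA.zero_A)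
  next
    case (one w)
    then show ?case using assms(3) by (simp add: skew_mon_def)
  next
    case (neg f)
    then show ?case
      using assms(4)[of "skew_ideal X +>\<^bsub>free_algebra X\<^esub> f"] ideal.rcos_neg[OF ideal_skew_ideal neg(1)]
        ideal.quot_closed[OF ideal_skew_ideal neg(1)] by (simp add: Skew_def)
  next
    case (add f g)
    then show ?case
      using assms(5)[of "skew_ideal X +>\<^bsub>free_algebra X\<^esub> f" "skew_ideal X +>\<^bsub>free_algebra X\<^esub> g"]
        ideal.quot_closed[OF ideal_skew_ideal add(1)] ideal.quot_closed[OF ideal_skew_ideal add(2)]
        ideal.quot_add[OF ideal_skew_ideal add(1,2)] by (simp add: Skew_def)
  qed
  then show ?thesis using f(2) by simp
qed

lemma skew_add_hom_eqI:
  assumes "ring R" "add_hom (Skew X) R f" "add_hom (Skew X) R g"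
    and "\<And>w. w \<in> lists X \<Longrightarrow> f (skew_mon X w) = g (skew_mon X w)" and "a \<in> carrier (Skew X)"
  shows "f a = g a"
  using assms(5)
  by (induction a rule: skew_induct)
    (simp_all add: assms(4) add_hom_zero[OF Sk.ring_axioms assms(1)] add_hom_neg[OF Sk.ring_axioms assms(1)]
      add_hom_add[OF assms(2)] add_hom_add[OF assms(3)] assms(2,3))

lemma skew_mon_list_prod: "w \<in> lists X \<Longrightarrow> skew_mon X w = ring_list_prod (Skew X) (map (\<lambda>x. skew_mon X [x]) w)"
proof (induction w)
  case (Cons x w)
  then show ?case using skew_mon_Cons[of x X w] by simp
qed (simp add: skew_mon_Nil)

lemma skew_ring_hom_eqI:
  assumes "ring R" "f \<in> Ring.ring_hom (Skew X) R" "g \<in> Ring.ring_hom (Skew X) R"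
    and "\<And>x. x \<in> X \<Longrightarrow> f (skew_mon X [x]) = g (skew_mon X [x])" and "a \<in> carrier (Skew X)"
  shows "f a = g a"
proof (rule skew_add_hom_eqI[OF assms(1) ring_hom_add_hom[OF assms(2)] ring_hom_add_hom[OF assms(3)] _ assms(5)])
  fix w assume w: "w \<in> lists X"
  then have "set (map (\<lambda>x. skew_mon X [x]) w) \<subseteq> carrier (Skew X)" by auto
  moreover have "map f (map (\<lambda>x. skew_mon X [x]) w) = map g (map (\<lambda>x. skew_mon X [x]) w)"
    using w assms(4) by auto
  ultimately show "f (skew_mon X w) = g (skew_mon X w)"
    by (simp only: skew_mon_list_prod[OF w] ring_hom_list_prod[OF Sk.ring_axioms assms(1,2)]
        ring_hom_list_prod[OF Sk.ring_axioms assms(1,3)])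
qed

text \<open>
  The universal property of the exterior algebra. Anticommuting elements need not have square
  \<open>0\<close>, only a square annihilated by \<open>2\<close>, so both relations are required of the images.
\<close>

lemma skew_lift:
  assumes "ring R" "y \<in> X \<rightarrow> carrier R"
    and anti: "\<And>x x'. x \<in> X \<Longrightarrow> x' \<in> X \<Longrightarrow> y x \<otimes>\<^bsub>R\<^esub> y x' = \<ominus>\<^bsub>R\<^esub> (y x' \<otimes>\<^bsub>R\<^esub> y x)"
    and sq: "\<And>x. x \<in> X \<Longrightarrow> y x \<otimes>\<^bsub>R\<^esub> y x = \<zero>\<^bsub>R\<^esub>"
  obtains h where "h \<in> Ring.ring_hom (Skew X) R"
    "\<And>w. w \<in> lists X \<Longrightarrow> h (skew_mon X w) = ring_list_prod R (map y w)"
proof -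
  interpret R: ring R by fact
  let ?F = "\<lambda>w. ring_list_prod R (map y w)"
  have ycl: "y x \<in> carrier R" if "x \<in> X" for x using that assms(2) by auto
  have Fcl: "?F w \<in> carrier R" if "w \<in> lists X" for w
    using that assms(2) by (intro R.list_prod_closed) auto
  have set_y: "set (map y w) \<subseteq> carrier R" if "w \<in> lists X" for w using that assms(2) by auto
  have hom: "lin_ext R ?F \<in> Ring.ring_hom (free_algebra X) R"
    by (rule FA.lin_ext_ring_hom[OF assms(1)]) (use Fcl set_y in auto)
  have val: "lin_ext R ?F (frag_of w) = ?F w" if "w \<in> lists X" for w
    by (rule R.lin_ext_frag_of) (rule Fcl[OF that])
  note add = ring_hom_add[OF hom, unfolded FA.add_A]
  have van: "lin_ext R ?F f = \<zero>\<^bsub>R\<^esub>" if "f \<in> skew_ideal X" for f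
  proof (rule ring_hom_vanish_Idl[OF FA.ring_A assms(1) hom skew_gens_subset _ that[unfolded skew_ideal_def]])
    fix g assume "g \<in> {frag_of [x, y] + frag_of [y, x] |x y. x \<in> X \<and> y \<in> X} \<union> {frag_of [x, x] |x. x \<in> X}"
    then consider (a) x x' where "x \<in> X" "x' \<in> X" "g = frag_of [x, x'] + frag_of [x', x]"
      | (b) x where "x \<in> X" "g = frag_of [x, x]" by blast
    then show "lin_ext R ?F g = \<zero>\<^bsub>R\<^esub>"
    proof cases
      case a
      then show ?thesis using anti[of x x'] by (simp add: add val ycl R.l_neg)
    qed (simp add: val ycl sq)
  qed
  obtain h where h: "h \<in> Ring.ring_hom (free_algebra X Quot skew_ideal X) R"
    "\<And>a. a \<in> carrier (free_algebra X) \<Longrightarrow> h (skew_ideal X +>\<^bsub>free_algebra X\<^esub> a) = lin_ext R ?F a"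
    using quot_lift_ring_hom[OF ideal_skew_ideal assms(1) hom van] by blast
  then show thesis using val by (intro that[of h]) (auto simp: skew_mon_def Skew_def)
qed

lemma skew_mon_swap:
  assumes "x \<in> X" "y \<in> X" "u \<in> lists X" "v \<in> lists X"
  shows "skew_mon X (u @ x # y # v) = \<ominus>\<^bsub>Skew X\<^esub> skew_mon X (u @ y # x # v)"
proof -
  have 1: "skew_mon X (u @ x # y # v) = skew_mon X u \<otimes>\<^bsub>Skew X\<^esub> (skew_mon X [x, y] \<otimes>\<^bsub>Skew X\<^esub> skew_mon X v)"
    if "x \<in> X" "y \<in> X" for x y
    using that assms skew_mon_append[of u X "[x, y] @ v"] skew_mon_append[of "[x, y]" X v] by simp
  show ?thesis unfolding 1[OF assms(1,2)] 1[OF assms(2,1)] skew_mon_anti[OF assms(1,2)]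
    using assms by (simp add: Sk.l_minus Sk.r_minus)
qed

lemma skew_mon_move:
  assumes "x \<in> X" "u \<in> lists X" "v \<in> lists X" "t \<in> lists X"
  shows "skew_mon X (t @ x # u @ v) = [((-1::int) ^ length u)] \<cdot>\<^bsub>Skew X\<^esub> skew_mon X (t @ u @ x # v)"
  using assms(2,4)
proof (induction u arbitrary: t rule: list.induct)
  case (Cons y u)
  have "skew_mon X (t @ x # (y # u) @ v) = \<ominus>\<^bsub>Skew X\<^esub> skew_mon X ((t @ [y]) @ x # u @ v)"
    using skew_mon_swap[of x X y t "u @ v"] Cons.prems assms by simp
  also have "\<dots> = \<ominus>\<^bsub>Skew X\<^esub> ([((-1::int) ^ length u)] \<cdot>\<^bsub>Skew X\<^esub> skew_mon X ((t @ [y]) @ u @ x # v))"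
    using Cons.IH[of "t @ [y]"] Cons.prems by simp
  also have "\<dots> = [((-1::int) ^ length (y # u))] \<cdot>\<^bsub>Skew X\<^esub> skew_mon X (t @ (y # u) @ x # v)"
    using Cons.prems assms by (simp add: Sk.int_mult_neg)
  finally show ?case .
qed (use assms in simp)

lemma skew_mon_commute:
  assumes "u \<in> lists X" "u' \<in> lists X" "v \<in> lists X" "t \<in> lists X"
  shows "skew_mon X (t @ u @ u' @ v) = [((-1::int) ^ (length u * length u'))] \<cdot>\<^bsub>Skew X\<^esub> skew_mon X (t @ u' @ u @ v)"
  using assms(1,4)
proof (induction u arbitrary: t rule: list.induct)
  case (Cons x u)
  have "skew_mon X (t @ (x # u) @ u' @ v) = skew_mon X ((t @ [x]) @ u @ u' @ v)" by simp
  also have "\<dots> = [((-1::int) ^ (length u * length u'))] \<cdot>\<^bsub>Skew X\<^esub> skew_mon X ((t @ [x]) @ u' @ u @ v)"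
    by (rule Cons.IH) (use Cons.prems in auto)
  also have "skew_mon X ((t @ [x]) @ u' @ u @ v) = [((-1::int) ^ length u')] \<cdot>\<^bsub>Skew X\<^esub> skew_mon X (t @ u' @ x # u @ v)"
    using skew_mon_move[of x X u' "u @ v" t] Cons.prems assms by simp
  finally show ?case using Cons.prems assms by (simp add: power_add mult.commute)
qed (use assms in simp)

subsection \<open>Absence of torsion\<close>

text \<open>
  The sign of the permutation that sorts the word along \<open>\<kappa>\<close>; a repeated letter gives \<open>0\<close>.
\<close>

primrec word_sign :: "('x \<Rightarrow> nat) \<Rightarrow> 'x list \<Rightarrow> int" where
  "word_sign \<kappa> [] = 1"
| "word_sign \<kappa> (x # w) =
     (if x \<in> set w then 0 else (-1) ^ card {y \<in> set w. \<kappa> y < \<kappa> x} * word_sign \<kappa> w)"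

lemma word_sign_eq_0_iff: "word_sign \<kappa> w = 0 \<longleftrightarrow> \<not> distinct w"
  by (induction w) auto

lemma word_sign_square: "distinct w \<Longrightarrow> word_sign \<kappa> w * word_sign \<kappa> w = 1"
  by (induction w) (auto simp: power_mult_distrib[symmetric] mult.assoc mult.left_commute
      simp flip: power_add mult_2)

lemma word_sign_swap:
  assumes "\<kappa> x \<noteq> \<kappa> y"
  shows "word_sign \<kappa> (u @ x # y # v) = - word_sign \<kappa> (u @ y # x # v)"
proof (induction u)
  case Nil
  have *: "{z \<in> set (y # v). \<kappa> z < \<kappa> x} =
      (if \<kappa> y < \<kappa> x then insert y {z \<in> set v. \<kappa> z < \<kappa> x} else {z \<in> set v. \<kappa> z < \<kappa> x})" for x y
    by auto
  have "x \<noteq> y" using assms by auto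
  show ?case
  proof (cases "x \<in> set v \<or> y \<in> set v")
    case False
    then show ?thesis using assms \<open>x \<noteq> y\<close> *[of x y] *[of y x]
      by (auto simp del: list.set(2) simp: set_ConsD[of x y v] set_ConsD[of y x v])
        (auto dest: set_ConsD)
  qed auto
next
  case (Cons a u)
  have "set (u @ x # y # v) = set (u @ y # x # v)" by auto
  then show ?case unfolding append_Cons word_sign.simps Cons.IH by simp
qed

lemma word_sign_double: "word_sign \<kappa> (u @ x # x # v) = 0"
  by (simp add: word_sign_eq_0_iff)

lemma word_sign_move:
  assumes "inj_on \<kappa> (insert x (set u))" "x \<notin> set u"
  shows "word_sign \<kappa> (t @ x # u @ v) = (-1) ^ length u * word_sign \<kappa> (t @ u @ x # v)"
  using assms
proof (induction u arbitrary: t rule: list.induct)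
  case (Cons y u)
  have "\<kappa> x \<noteq> \<kappa> y" using Cons.prems by (auto dest: inj_onD)
  then have "word_sign \<kappa> (t @ x # (y # u) @ v) = - word_sign \<kappa> ((t @ [y]) @ x # u @ v)"
    using word_sign_swap[of \<kappa> x y t "u @ v"] by simp
  also have "word_sign \<kappa> ((t @ [y]) @ x # u @ v) = (-1) ^ length u * word_sign \<kappa> ((t @ [y]) @ u @ x # v)"
    by (rule Cons.IH) (use Cons.prems in \<open>auto intro: inj_on_subset\<close>)
  finally show ?case by simp
qed simp

lemma word_sign_normal_form:
  assumes "distinct w" "distinct w'" "set w = set w'" "w \<in> lists X" "inj_on \<kappa> (set w)"
  shows "[word_sign \<kappa> w] \<cdot>\<^bsub>Skew X\<^esub> skew_mon X w = [word_sign \<kappa> w'] \<cdot>\<^bsub>Skew X\<^esub> skew_mon X w'"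
  using assms
proof (induction w arbitrary: w')
  case (Cons x w)
  obtain a b where ab: "w' = a @ x # b" using Cons.prems(3) by (metis list.set_intros(1) split_list)
  have [simp]: "w' \<in> lists X" using Cons.prems(3,4) by (simp add: in_lists_conv_set)
  then have X: "a \<in> lists X" "b \<in> lists X" "w \<in> lists X" "x \<in> X" using Cons.prems ab by auto
  have set: "set w = set (a @ b)" "x \<notin> set w" "distinct (a @ b)" using Cons.prems ab by auto
  have inj: "inj_on \<kappa> (insert x (set a))" by (rule inj_on_subset[OF Cons.prems(5)]) (use set in auto)
  have "[word_sign \<kappa> (x # w)] \<cdot>\<^bsub>Skew X\<^esub> skew_mon X (x # w) =
      [((-1::int) ^ card {y \<in> set w. \<kappa> y < \<kappa> x})] \<cdot>\<^bsub>Skew X\<^esub> (skew_mon X [x] \<otimes>\<^bsub>Skew X\<^esub> ([word_sign \<kappa> w] \<cdot>\<^bsub>Skew X\<^esub> skew_mon X w))"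
    using X set skew_mon_Cons[of x X w] by (simp add: Sk.add_pow_rdistr_int)
  also have "[word_sign \<kappa> w] \<cdot>\<^bsub>Skew X\<^esub> skew_mon X w = [word_sign \<kappa> (a @ b)] \<cdot>\<^bsub>Skew X\<^esub> skew_mon X (a @ b)"
    by (rule Cons.IH) (use Cons.prems set X in \<open>auto intro: inj_on_subset\<close>)
  also have "[((-1::int) ^ card {y \<in> set w. \<kappa> y < \<kappa> x})] \<cdot>\<^bsub>Skew X\<^esub> (skew_mon X [x] \<otimes>\<^bsub>Skew X\<^esub> \<dots>) =
      [word_sign \<kappa> (x # a @ b)] \<cdot>\<^bsub>Skew X\<^esub> skew_mon X (x # a @ b)"
    using X set skew_mon_Cons[of x X "a @ b"] by (simp add: Sk.add_pow_rdistr_int)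
  also have "\<dots> = [word_sign \<kappa> w'] \<cdot>\<^bsub>Skew X\<^esub> skew_mon X w'"
    using skew_mon_move[of x X a b "[]"] word_sign_move[of \<kappa> x a "[]" b] inj X set ab
    by (simp add: mult.assoc mult.commute[of "word_sign _ _"])
  finally show ?case .
qed simp

text \<open>
  Coordinates with respect to the basis of sorted square-free words, indexed by their sets of
  letters. Words with letters outside \<open>Y\<close>, where \<open>\<kappa>\<close> may fail to be injective, are discarded.
\<close>

definition normal_form :: "('x \<Rightarrow> nat) \<Rightarrow> 'x set \<Rightarrow> ('x list \<Rightarrow>\<^sub>0 int) \<Rightarrow> ('x set \<Rightarrow>\<^sub>0 int)" where
  "normal_form \<kappa> Y =
     frag_extend (\<lambda>w. if set w \<subseteq> Y then frag_cmul (word_sign \<kappa> w) (frag_of (set w)) else 0)"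

text \<open>
  On a defining relation multiplied by words from both sides the coordinates vanish, because an
  exchange of adjacent letters reverses the sign and keeps the set of letters.
\<close>

lemma normal_form_skew_ideal:
  assumes "inj_on \<kappa> Y" "f \<in> skew_ideal X"
  shows "normal_form \<kappa> Y f = 0"
proof (rule FA.vanish_Idl[OF skew_gens_subset _ _ assms(2)[unfolded skew_ideal_def]])
  show "normal_form \<kappa> Y (f \<oplus>\<^bsub>free_algebra X\<^esub> g) = normal_form \<kappa> Y f + normal_form \<kappa> Y g" for f g
    by (simp add: FA.add_A normal_form_def frag_extend_add)
  fix u v :: "'a list" and g
  assume "g \<in> {frag_of [x, y] + frag_of [y, x] |x y. x \<in> X \<and> y \<in> X} \<union> {frag_of [x, x] |x. x \<in> X}"
  then consider (a) x y where "g = frag_of [x, y] + frag_of [y, x]" | (b) x where "g = frag_of [x, x]" by blast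
  then show "normal_form \<kappa> Y (frag_of u \<otimes>\<^bsub>free_algebra X\<^esub> g \<otimes>\<^bsub>free_algebra X\<^esub> frag_of v) = 0"
  proof cases
    case a
    have "frag_cmul (word_sign \<kappa> (u @ x # y # v)) (frag_of (set (u @ x # y # v))) +
        frag_cmul (word_sign \<kappa> (u @ y # x # v)) (frag_of (set (u @ y # x # v))) = 0"
      if "insert x (insert y (set u \<union> set v)) \<subseteq> Y"
    proof (cases "x = y")
      case True
      then show ?thesis by (simp add: word_sign_double)
    next
      case False
      then have "\<kappa> x \<noteq> \<kappa> y" using that assms(1) by (auto dest: inj_onD)
      then show ?thesis
        using word_sign_swap[of \<kappa> x y u v] by (simp add: insert_commute flip: frag_cmul_distrib)
    qed
    then show ?thesis using a
      by (auto simp: FA.mult_A twisted_mult_add_left twisted_mult_add_right normal_form_def frag_extend_add)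
  next
    case b
    then show ?thesis by (simp add: FA.mult_A normal_form_def word_sign_double)
  qed
qed

text \<open>
  An element is recovered from its coordinates, and these lie in a free module. The generating
  set may be uncountable, but only the finitely many letters of one representative matter, and
  they can be numbered.
\<close>

lemma skew_torsion_free:
  assumes a: "a \<in> carrier (Skew X)" and k: "k \<noteq> (0::int)" and ka: "[k] \<cdot>\<^bsub>Skew X\<^esub> a = \<zero>\<^bsub>Skew X\<^esub>"
  shows "a = \<zero>\<^bsub>Skew X\<^esub>"
proof -
  obtain f where f: "f \<in> carrier (free_algebra X)" "a = skew_ideal X +>\<^bsub>free_algebra X\<^esub> f"
    using a by (auto simp: Skew_def ideal.quot_carrier[OF ideal_skew_ideal])
  define Y where "Y = (\<Union>w\<in>Poly_Mapping.keys f. set w)"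
  have "finite Y" by (auto simp: Y_def)
  obtain \<kappa> :: "'a \<Rightarrow> nat" where \<kappa>: "inj_on \<kappa> Y" using \<open>finite Y\<close> finite_imp_inj_to_nat_seg by blast
  have fY: "Poly_Mapping.keys f \<subseteq> lists X \<inter> lists Y" using f(1) by (auto simp: Y_def FA.carrier_A)
  have "frag_cmul k f \<in> skew_ideal X"
    using ka f ideal.rcos_int[OF ideal_skew_ideal, of f X k] ideal.coset_zero_iff[OF ideal_skew_ideal, of "frag_cmul k f" X] FA.A.int_mult_closed[of f X k]
    by (simp add: Skew_def FA.int_A)
  from normal_form_skew_ideal[OF \<kappa> this] have "frag_cmul k (normal_form \<kappa> Y f) = 0"
    by (simp add: normal_form_def frag_extend_cmul)
  then have nf: "normal_form \<kappa> Y f = 0" using k by simp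
  \<comment> \<open>Any arrangement of a set will do: multiplied by its sign, it does not depend on the choice.\<close>
  define r where "r U = (SOME w. distinct w \<and> set w = U)" for U :: "'a set"
  have r: "distinct (r U)" "set (r U) = U" if "finite U" for U
    using someI_ex[of "\<lambda>w. distinct w \<and> set w = U"] finite_distinct_list[OF that]
    unfolding r_def by blast+
  define B where "B = {U. finite U \<and> U \<subseteq> X}"
  let ?M = "\<lambda>U. [word_sign \<kappa> (r U)] \<cdot>\<^bsub>Skew X\<^esub> skew_mon X (r U)"
  have r_lists: "r U \<in> lists X" if "U \<in> B" for U
    using that r[of U] by (auto simp: B_def)
  then have M: "?M \<in> B \<rightarrow> carrier (Skew X)" by auto
  let ?L = "lin_ext (Skew X) ?M"
  have L_diff: "?L (g - h) = ?L g \<ominus>\<^bsub>Skew X\<^esub> ?L h"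
    if "Poly_Mapping.keys g \<subseteq> B" "Poly_Mapping.keys h \<subseteq> B" for g h
  proof -
    have gh: "Poly_Mapping.keys (g - h) \<subseteq> B" using keys_diff[of g h] that by blast
    have "?L g = ?L (g - h) \<oplus>\<^bsub>Skew X\<^esub> ?L h"
      using Sk.lin_ext_add[OF M gh that(2)] by simp
    then show ?thesis
      using Sk.lin_ext_closed[OF M gh] Sk.lin_ext_closed[OF M that(2)]
      by (simp add: a_minus_def Sk.a_assoc Sk.r_neg)
  qed
  have "Poly_Mapping.keys (normal_form \<kappa> Y f) \<subseteq> B \<and> f \<in> carrier (free_algebra X) \<and>
      ?L (normal_form \<kappa> Y f) = skew_ideal X +>\<^bsub>free_algebra X\<^esub> f"
    using fY
  proof (induction f rule: frag_induction)
    case zero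
    then show ?case
      by (simp add: normal_form_def lin_ext_def skew_coset_zero FA.carrier_A)
  next
    case (one w)
    then have rw: "r (set w) \<in> lists X" by (intro r_lists) (auto simp: B_def)
    have "?L (frag_cmul (word_sign \<kappa> w) (frag_of (set w))) = skew_mon X w"
    proof (cases "distinct w")
      case True
      have "?L (frag_cmul (word_sign \<kappa> w) (frag_of (set w))) = [word_sign \<kappa> w] \<cdot>\<^bsub>Skew X\<^esub> ?M (set w)"
        using True word_sign_eq_0_iff[of \<kappa> w] rw
        by (simp add: lin_ext_def frag_cmul_single)
      also have "?M (set w) = [word_sign \<kappa> w] \<cdot>\<^bsub>Skew X\<^esub> skew_mon X w"
        by (rule word_sign_normal_form[symmetric]) (use True r[of "set w"] one \<kappa> in \<open>auto intro: inj_on_subset\<close>)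
      finally show ?thesis using one word_sign_square[OF True] by simp
    next
      case False
      then obtain u x v y where w: "w = u @ [x] @ v @ [x] @ y" using not_distinct_decomp by blast
      then have X: "u \<in> lists X" "x \<in> X" "v \<in> lists X" "y \<in> lists X" using one by auto
      have "skew_mon X w = [((-1::int) ^ length v)] \<cdot>\<^bsub>Skew X\<^esub> skew_mon X (u @ v @ [x, x] @ y)"
        using skew_mon_move[of x X v "x # y" u] X w by simp
      also have "skew_mon X (u @ v @ [x, x] @ y) = \<zero>\<^bsub>Skew X\<^esub>"
        using X by (simp only: skew_mon_append append_in_lists_conv lists.intros) (simp add: skew_mon_square)
      finally show ?thesis using False by (simp add: word_sign_eq_0_iff[THEN iffD2] lin_ext_def)
    qed
    then show ?case using one by (auto simp: normal_form_def B_def skew_mon_def)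
  next
    case (diff g h)
    let ?I = "skew_ideal X" and ?A = "free_algebra X"
    have nf_diff: "normal_form \<kappa> Y (g - h) = normal_form \<kappa> Y g - normal_form \<kappa> Y h"
      by (simp add: normal_form_def frag_extend_diff)
    have carr: "g \<in> carrier ?A" "h \<in> carrier ?A" using diff by auto
    have "?I +>\<^bsub>?A\<^esub> (g - h) = (?I +>\<^bsub>?A\<^esub> g) \<ominus>\<^bsub>Skew X\<^esub> (?I +>\<^bsub>?A\<^esub> h)"
      using ideal.quot_add[OF ideal_skew_ideal carr(1) FA.A.a_inv_closed[OF carr(2)]]
        ideal.rcos_neg[OF ideal_skew_ideal carr(2)]
      by (simp add: Skew_def a_minus_def FA.add_A FA.neg_A[OF carr(2)])
    moreover have "g - h \<in> carrier ?A"
      using FA.A.minus_closed[OF carr] by (simp add: FA.minus_A[OF carr])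
    moreover have "Poly_Mapping.keys (normal_form \<kappa> Y g - normal_form \<kappa> Y h) \<subseteq> B"
      using keys_diff[of "normal_form \<kappa> Y g" "normal_form \<kappa> Y h"] diff by blast
    ultimately show ?case using diff by (simp add: nf_diff L_diff)
  qed
  then show ?thesis using nf f(2) by (simp add: lin_ext_def)
qed

section \<open>Higher derivations of skew-symmetric algebras\<close>

text \<open>
  The component of degree one; integer multiples are obtained from addition and negation.
\<close>

inductive_set skew_linear :: "'x set \<Rightarrow> 'x skew_elem set" for X :: "'x set" where
  letter: "x \<in> X \<Longrightarrow> skew_mon X [x] \<in> skew_linear X"
| zero: "\<zero>\<^bsub>Skew X\<^esub> \<in> skew_linear X"
| neg: "a \<in> skew_linear X \<Longrightarrow> \<ominus>\<^bsub>Skew X\<^esub> a \<in> skew_linear X"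
| add: "a \<in> skew_linear X \<Longrightarrow> b \<in> skew_linear X \<Longrightarrow> a \<oplus>\<^bsub>Skew X\<^esub> b \<in> skew_linear X"

lemma skew_linear_closed [simp]: "a \<in> skew_linear X \<Longrightarrow> a \<in> carrier (Skew X)"
  by (induction rule: skew_linear.induct) auto

lemma skew_linear_int: "a \<in> skew_linear X \<Longrightarrow> [(k::int)] \<cdot>\<^bsub>Skew X\<^esub> a \<in> skew_linear X"
proof (induction k rule: int_induct[where k = 0])
  case base
  show ?case by (simp add: skew_linear.zero)
next
  case (step1 i)
  then show ?case
    using skew_linear.add[of "[i] \<cdot>\<^bsub>Skew X\<^esub> a" X a] skew_linear_closed[of a X]
    by (simp add: Sk.int_mult_add_left)
next
  case (step2 i)
  then show ?case
    using skew_linear.add[of "[i] \<cdot>\<^bsub>Skew X\<^esub> a" X "\<ominus>\<^bsub>Skew X\<^esub> a"] skew_linear_closed[of a X]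
      Sk.int_mult_add_left[of a X i "-1"]
    by (simp add: Sk.int_mult_neg skew_linear.neg)
qed

lemma skew_linear_finsum:
  "(\<And>i. i \<in> I \<Longrightarrow> f i \<in> skew_linear X) \<Longrightarrow> (\<Oplus>\<^bsub>Skew X\<^esub>i\<in>I. f i) \<in> skew_linear X"
proof (induction I rule: infinite_finite_induct)
  case (insert i I)
  then have "f \<in> insert i I \<rightarrow> carrier (Skew X)" using skew_linear_closed by blast
  then show ?case using insert by (simp add: skew_linear.add)
qed (simp_all add: skew_linear.zero)

lemma skew_linear_anti:
  assumes "a \<in> skew_linear X" "b \<in> skew_linear X"
  shows "a \<otimes>\<^bsub>Skew X\<^esub> b = \<ominus>\<^bsub>Skew X\<^esub> (b \<otimes>\<^bsub>Skew X\<^esub> a)"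
  using assms(1)
proof (induction rule: skew_linear.induct)
  case (letter x)
  show ?case using assms(2)
  proof (induction rule: skew_linear.induct)
    case (letter y)
    then show ?case using \<open>x \<in> X\<close> skew_mon_anti[of x X y]
        skew_mon_append[of "[x]" X "[y]"] skew_mon_append[of "[y]" X "[x]"] by simp
  qed (use \<open>x \<in> X\<close> in \<open>simp_all add: Sk.l_distr Sk.r_distr Sk.l_minus Sk.r_minus Sk.minus_add\<close>)
qed (use assms(2) in \<open>simp_all add: Sk.l_distr Sk.r_distr Sk.l_minus Sk.r_minus Sk.minus_add\<close>)

lemma skew_self_neg_zero:
  assumes "a \<in> carrier (Skew X)" "a = \<ominus>\<^bsub>Skew X\<^esub> a" shows "a = \<zero>\<^bsub>Skew X\<^esub>"
proof -
  have "[(1 + 1::int)] \<cdot>\<^bsub>Skew X\<^esub> a = a \<oplus>\<^bsub>Skew X\<^esub> a"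
    using assms(1) by (simp only: Sk.int_mult_add_left Sk.int_mult_1)
  also have "\<dots> = \<zero>\<^bsub>Skew X\<^esub>" using Sk.r_neg[OF assms(1)] by (simp only: assms(2)[symmetric])
  finally show ?thesis using skew_torsion_free[OF assms(1), of "1 + 1"] by simp
qed

lemma UP_skew: "UP_ring (Skew X)"
  by (simp add: UP_ring_def Sk.ring_axioms)

text \<open>
  The homomorphism sends a letter \<open>x\<close> to \<open>x + t \<delta>(x)\<close>. The coefficients of these polynomials
  have degree one, so the polynomials anticommute; as there is no \<open>2\<close>-torsion, their squares
  vanish, and the universal property applies.
\<close>

lemma higher_derivation_exists:
  assumes \<delta>: "\<delta> \<in> X \<rightarrow> skew_linear X"
  shows "\<exists>E\<in>Ring.ring_hom (Skew X) (UP (Skew X)). \<forall>x\<in>X. \<forall>n.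
    coeff (UP (Skew X)) (E (skew_mon X [x])) n =
      (if n = 0 then skew_mon X [x] else if n = 1 then \<delta> x else \<zero>\<^bsub>Skew X\<^esub>)"
proof -
  define P where "P = UP (Skew X)"
  interpret P: UP_ring "Skew X" P unfolding P_def by (rule UP_skew)
  interpret PR: ring P by (rule P.UP_ring)
  define c where "c x n = (if n = 0 then skew_mon X [x] else if n = 1 then \<delta> x else \<zero>\<^bsub>Skew X\<^esub>)"
    for x and n :: nat
  have c: "c x n \<in> skew_linear X" if "x \<in> X" for x n
    using that \<delta> by (auto simp: c_def skew_linear.letter skew_linear.zero)
  note cc = skew_linear_closed[OF c]
  define y where "y x = monom P (skew_mon X [x]) 0 \<oplus>\<^bsub>P\<^esub> monom P (\<delta> x) 1" for x
  have \<delta>c: "\<delta> x \<in> carrier (Skew X)" if "x \<in> X" for x using that \<delta> skew_linear_closed by blast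
  have yc: "y x \<in> carrier P" if "x \<in> X" for x using that \<delta>c by (simp add: y_def)
  have coeff_y: "coeff P (y x) n = c x n" if "x \<in> X" for x n using that \<delta>c by (simp add: y_def c_def)
  have anti: "y x \<otimes>\<^bsub>P\<^esub> y x' = \<ominus>\<^bsub>P\<^esub> (y x' \<otimes>\<^bsub>P\<^esub> y x)" if x: "x \<in> X" "x' \<in> X" for x x'
  proof (rule P.up_eqI)
    fix n
    have "coeff P (y x \<otimes>\<^bsub>P\<^esub> y x') n = (\<Oplus>\<^bsub>Skew X\<^esub>i\<in>{..n}. c x i \<otimes>\<^bsub>Skew X\<^esub> c x' (n - i))"
      using x yc by (simp add: coeff_y)
    also have "\<dots> = (\<Oplus>\<^bsub>Skew X\<^esub>i\<in>{..n}. \<ominus>\<^bsub>Skew X\<^esub> (c x' (n - i) \<otimes>\<^bsub>Skew X\<^esub> c x i))"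
      by (intro Sk.finsum_cong' skew_linear_anti c refl) (use x cc in auto)
    also have "\<dots> = (\<Oplus>\<^bsub>Skew X\<^esub>i\<in>{..n}. (\<lambda>i. \<ominus>\<^bsub>Skew X\<^esub> (c x' i \<otimes>\<^bsub>Skew X\<^esub> c x (n - i))) (n - i))"
      using x cc by (intro Sk.finsum_cong') auto
    also have "\<dots> = (\<Oplus>\<^bsub>Skew X\<^esub>i\<in>(\<lambda>i. n - i) ` {..n}. \<ominus>\<^bsub>Skew X\<^esub> (c x' i \<otimes>\<^bsub>Skew X\<^esub> c x (n - i)))"
      using x cc by (intro Sk.finsum_reindex[symmetric]) (auto intro: inj_onI)
    also have "(\<lambda>i. n - i) ` {..n} = {..n}"
    proof safe
      show "i \<in> (\<lambda>i. n - i) ` {..n}" if "i \<le> n" for i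
        using that by (intro image_eqI[of _ _ "n - i"]) auto
    qed auto
    also have "(\<Oplus>\<^bsub>Skew X\<^esub>i\<in>{..n}. \<ominus>\<^bsub>Skew X\<^esub> (c x' i \<otimes>\<^bsub>Skew X\<^esub> c x (n - i))) =
        \<ominus>\<^bsub>Skew X\<^esub> (\<Oplus>\<^bsub>Skew X\<^esub>i\<in>{..n}. c x' i \<otimes>\<^bsub>Skew X\<^esub> c x (n - i))"
      using x cc
      by (intro add_hom_finsum[OF Sk.ring_axioms Sk.ring_axioms, symmetric] add_homI) (auto simp: Sk.minus_add)
    also have "\<dots> = coeff P (\<ominus>\<^bsub>P\<^esub> (y x' \<otimes>\<^bsub>P\<^esub> y x)) n" using x yc by (simp add: coeff_y)
    finally show "coeff P (y x \<otimes>\<^bsub>P\<^esub> y x') n = coeff P (\<ominus>\<^bsub>P\<^esub> (y x' \<otimes>\<^bsub>P\<^esub> y x)) n" .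
  qed (use x yc in auto)
  have sq: "y x \<otimes>\<^bsub>P\<^esub> y x = \<zero>\<^bsub>P\<^esub>" if "x \<in> X" for x
  proof (rule P.up_eqI)
    fix n
    have "coeff P (y x \<otimes>\<^bsub>P\<^esub> y x) n = \<ominus>\<^bsub>Skew X\<^esub> (coeff P (y x \<otimes>\<^bsub>P\<^esub> y x) n)"
      using arg_cong[OF anti[OF that that], of "\<lambda>p. coeff P p n"] yc[OF that] by simp
    then show "coeff P (y x \<otimes>\<^bsub>P\<^esub> y x) n = coeff P \<zero>\<^bsub>P\<^esub> n"
      using skew_self_neg_zero[of "coeff P (y x \<otimes>\<^bsub>P\<^esub> y x) n" X] yc[OF that] by (simp del: P.coeff_mult)
  qed (use that yc in auto)
  obtain E where "E \<in> Ring.ring_hom (Skew X) P"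
    "\<And>w. w \<in> lists X \<Longrightarrow> E (skew_mon X w) = ring_list_prod P (map y w)"
    using skew_lift[OF P.UP_ring, of y X] yc anti sq by blast
  moreover from this(2)[of "[x]" for x] have "E (skew_mon X [x]) = y x" if "x \<in> X" for x
    using that yc by simp
  ultimately show ?thesis
    unfolding P_def[symmetric] using coeff_y by (intro bexI[of _ E]) (auto simp: c_def)
qed

text \<open>
  The coefficients of a homomorphism into the polynomial ring form a Hasse-Schmidt derivation.
  Its members play the role of \<open>D\<^sup>h / h!\<close> without any division.
\<close>

definition higher_deriv :: "'x set \<Rightarrow> ('x \<Rightarrow> 'x skew_elem) \<Rightarrow> nat \<Rightarrow> 'x skew_elem \<Rightarrow> 'x skew_elem" where
  "higher_deriv X \<delta> h a = coeff (UP (Skew X))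
     ((SOME E. E \<in> Ring.ring_hom (Skew X) (UP (Skew X)) \<and> (\<forall>x\<in>X. \<forall>n.
        coeff (UP (Skew X)) (E (skew_mon X [x])) n =
          (if n = 0 then skew_mon X [x] else if n = 1 then \<delta> x else \<zero>\<^bsub>Skew X\<^esub>))) a) h"

locale skew_direction =
  fixes X :: "'x set" and \<delta> :: "'x \<Rightarrow> 'x skew_elem"
  assumes direction: "\<delta> \<in> X \<rightarrow> skew_linear X"
begin

abbreviation "D \<equiv> higher_deriv X \<delta>"

lemma direction_closed [simp]: "x \<in> X \<Longrightarrow> \<delta> x \<in> carrier (Skew X)"
  using direction skew_linear_closed by blast

context
  fixes P and E assumes P_eq: "P = UP (Skew X)" and E_eq: "E = (SOME E. E \<in> Ring.ring_hom (Skew X) P \<and> (\<forall>x\<in>X. \<forall>n.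
        coeff P (E (skew_mon X [x])) n =
          (if n = 0 then skew_mon X [x] else if n = 1 then \<delta> x else \<zero>\<^bsub>Skew X\<^esub>)))"
begin

interpretation P: UP_ring "Skew X" P unfolding P_eq by (rule UP_skew)

lemma E: "E \<in> Ring.ring_hom (Skew X) P"
    "x \<in> X \<Longrightarrow> coeff P (E (skew_mon X [x])) n =
          (if n = 0 then skew_mon X [x] else if n = 1 then \<delta> x else \<zero>\<^bsub>Skew X\<^esub>)"
  and D_E: "D h a = coeff P (E a) h"
  using someI_ex[OF higher_derivation_exists[OF direction, unfolded Bex_def]]
  unfolding higher_deriv_def E_eq P_eq by auto

lemma E_closed: "a \<in> carrier (Skew X) \<Longrightarrow> E a \<in> carrier P"
  by (rule ring_hom_closed[OF E(1)])

lemma D_add_hom': "add_hom (Skew X) (Skew X) (D h)"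
  by (rule add_homI) (simp_all add: D_E E_closed ring_hom_add[OF E(1)])

lemma D_mult': "a \<in> carrier (Skew X) \<Longrightarrow> b \<in> carrier (Skew X) \<Longrightarrow>
    D h (a \<otimes>\<^bsub>Skew X\<^esub> b) = (\<Oplus>\<^bsub>Skew X\<^esub>i\<in>{..h}. D i a \<otimes>\<^bsub>Skew X\<^esub> D (h - i) b)"
  by (simp add: D_E E_closed ring_hom_mult[OF E(1)])

lemma D_one': "D h \<one>\<^bsub>Skew X\<^esub> = (if h = 0 then \<one>\<^bsub>Skew X\<^esub> else \<zero>\<^bsub>Skew X\<^esub>)"
  by (simp add: D_E ring_hom_one[OF E(1)])

lemma D_letter': "x \<in> X \<Longrightarrow>
    D h (skew_mon X [x]) = (if h = 0 then skew_mon X [x] else if h = 1 then \<delta> x else \<zero>\<^bsub>Skew X\<^esub>)"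
  by (simp add: D_E E(2))

end

lemmas D_add_hom = D_add_hom'[OF refl refl]
lemmas D_mult = D_mult'[OF refl refl]
lemmas D_one = D_one'[OF refl refl]
lemmas D_letter = D_letter'[OF refl refl]
lemmas D_closed [simp] = add_hom_closed[OF D_add_hom]
lemmas D_add = add_hom_add[OF D_add_hom]
lemmas D_zero = add_hom_zero[OF Sk.ring_axioms Sk.ring_axioms D_add_hom]
lemmas D_neg = add_hom_neg[OF Sk.ring_axioms Sk.ring_axioms D_add_hom]
lemmas D_int = add_hom_int[OF Sk.ring_axioms Sk.ring_axioms D_add_hom]
lemmas D_finsum = add_hom_finsum[OF Sk.ring_axioms Sk.ring_axioms D_add_hom]

lemma D_0: "a \<in> carrier (Skew X) \<Longrightarrow> D 0 a = a"
proof (rule skew_ring_hom_eqI[of "Skew X" "D 0" X "\<lambda>a. a"])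
  show "D 0 \<in> Ring.ring_hom (Skew X) (Skew X)"
    by (rule ring_hom_memI) (simp_all add: D_add D_mult D_one)
qed (auto simp: Sk.ring_axioms D_letter Ring.ring_hom_def)

lemma D_1_mult:
  assumes "a \<in> carrier (Skew X)" "b \<in> carrier (Skew X)"
  shows "D 1 (a \<otimes>\<^bsub>Skew X\<^esub> b) = (D 1 a \<otimes>\<^bsub>Skew X\<^esub> b) \<oplus>\<^bsub>Skew X\<^esub> (a \<otimes>\<^bsub>Skew X\<^esub> D 1 b)"
proof -
  have "{..1::nat} = {0, 1}" by auto
  then show ?thesis using assms by (simp add: D_mult D_0 Sk.a_comm)
qed

lemma D_letter_mult:
  assumes x: "x \<in> X" and a: "a \<in> carrier (Skew X)"
  shows "D (Suc h) (skew_mon X [x] \<otimes>\<^bsub>Skew X\<^esub> a) =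
    (skew_mon X [x] \<otimes>\<^bsub>Skew X\<^esub> D (Suc h) a) \<oplus>\<^bsub>Skew X\<^esub> (\<delta> x \<otimes>\<^bsub>Skew X\<^esub> D h a)"
proof -
  have "D (Suc h) (skew_mon X [x] \<otimes>\<^bsub>Skew X\<^esub> a) =
      (\<Oplus>\<^bsub>Skew X\<^esub>i\<in>{..Suc h}. D i (skew_mon X [x]) \<otimes>\<^bsub>Skew X\<^esub> D (Suc h - i) a)"
    using x a by (simp add: D_mult del: Sk.finsum_Suc)
  also have "\<dots> = (\<Oplus>\<^bsub>Skew X\<^esub>i\<in>{0, 1}. D i (skew_mon X [x]) \<otimes>\<^bsub>Skew X\<^esub> D (Suc h - i) a)"
    using x a by (intro Sk.add.finprod_mono_neutral_cong_right) (auto simp: D_letter)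
  finally show ?thesis using x a by (simp add: D_letter)
qed

text \<open>
  The polynomial assigned to such an element is constant, so the element behaves like a scalar
  for every \<open>D h\<close>.
\<close>

definition parameter_free :: "'x skew_elem \<Rightarrow> bool" where
  "parameter_free a \<longleftrightarrow> a \<in> carrier (Skew X) \<and> (\<forall>h>0. D h a = \<zero>\<^bsub>Skew X\<^esub>)"

lemma D_mult_const_left:
  assumes "parameter_free a" "b \<in> carrier (Skew X)"
  shows "D h (a \<otimes>\<^bsub>Skew X\<^esub> b) = a \<otimes>\<^bsub>Skew X\<^esub> D h b"
proof -
  have a: "a \<in> carrier (Skew X)" "\<And>h. h > 0 \<Longrightarrow> D h a = \<zero>\<^bsub>Skew X\<^esub>"
    using assms(1) by (auto simp: parameter_free_def)
  have "D h (a \<otimes>\<^bsub>Skew X\<^esub> b) = (\<Oplus>\<^bsub>Skew X\<^esub>i\<in>{..h}. D i a \<otimes>\<^bsub>Skew X\<^esub> D (h - i) b)"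
    using a assms(2) by (simp add: D_mult)
  also have "\<dots> = (\<Oplus>\<^bsub>Skew X\<^esub>i\<in>{0}. D i a \<otimes>\<^bsub>Skew X\<^esub> D (h - i) b)"
    using a assms(2) by (intro Sk.add.finprod_mono_neutral_cong_right) auto
  finally show ?thesis using a assms(2) by (simp add: D_0)
qed

lemma D_mult_const_right:
  assumes "a \<in> carrier (Skew X)" "parameter_free b"
  shows "D h (a \<otimes>\<^bsub>Skew X\<^esub> b) = D h a \<otimes>\<^bsub>Skew X\<^esub> b"
proof -
  have b: "b \<in> carrier (Skew X)" "\<And>h. h > 0 \<Longrightarrow> D h b = \<zero>\<^bsub>Skew X\<^esub>"
    using assms(2) by (auto simp: parameter_free_def)
  have "D h (a \<otimes>\<^bsub>Skew X\<^esub> b) = (\<Oplus>\<^bsub>Skew X\<^esub>i\<in>{..h}. D i a \<otimes>\<^bsub>Skew X\<^esub> D (h - i) b)"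
    using b assms(1) by (simp add: D_mult)
  also have "\<dots> = (\<Oplus>\<^bsub>Skew X\<^esub>i\<in>{h}. D i a \<otimes>\<^bsub>Skew X\<^esub> D (h - i) b)"
    using b assms(1) by (intro Sk.add.finprod_mono_neutral_cong_right) auto
  finally show ?thesis using b assms(1) by (simp add: D_0)
qed

lemma parameter_free_word:
  assumes "w \<in> lists X" "\<And>x. x \<in> set w \<Longrightarrow> \<delta> x = \<zero>\<^bsub>Skew X\<^esub>"
  shows "parameter_free (skew_mon X w)"
  using assms
proof (induction w)
  case Nil
  show ?case by (simp add: parameter_free_def skew_mon_Nil D_one)
next
  case (Cons x w)
  have "D h (skew_mon X (x # w)) = \<zero>\<^bsub>Skew X\<^esub>" if h: "h > 0" for h
  proof -
    obtain k where "h = Suc k" using gr0_implies_Suc[OF h] by blast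
    then show ?thesis using Cons h skew_mon_Cons[of x X w]
      by (simp add: D_letter_mult parameter_free_def)
  qed
  then show ?case using Cons by (simp add: parameter_free_def)
qed

text \<open>
  The composition law of the divided powers of a derivation whose second iterate kills the letters.
  Neither side is a derivation, so agreement on letters is not enough; the proof is an induction
  along words, and the two occurrences of \<open>D h\<close> after \<open>\<delta> x\<close> add up to the coefficient \<open>h + 1\<close>.
\<close>

lemma D_1_D:
  assumes vanish: "\<And>x. x \<in> X \<Longrightarrow> D 1 (\<delta> x) = \<zero>\<^bsub>Skew X\<^esub>" and a: "a \<in> carrier (Skew X)"
  shows "D 1 (D h a) = [int (Suc h)] \<cdot>\<^bsub>Skew X\<^esub> D (Suc h) a"
proof (rule skew_add_hom_eqI[OF Sk.ring_axioms _ _ _ a])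
  show "add_hom (Skew X) (Skew X) (\<lambda>a. D 1 (D h a))" by (rule add_hom_compose[OF D_add_hom D_add_hom])
  show "add_hom (Skew X) (Skew X) (\<lambda>a. [int (Suc h)] \<cdot>\<^bsub>Skew X\<^esub> D (Suc h) a)"
    by (rule add_hom_compose[OF D_add_hom Sk.int_mult_add_hom])
  fix w assume "w \<in> lists X"
  then show "D 1 (D h (skew_mon X w)) = [int (Suc h)] \<cdot>\<^bsub>Skew X\<^esub> D (Suc h) (skew_mon X w)"
  proof (induction w arbitrary: h rule: list.induct)
    case Nil
    then show ?case by (simp add: skew_mon_Nil D_one D_zero)
  next
    case (Cons x w)
    let ?x = "skew_mon X [x]" and ?w = "skew_mon X w"
    have x: "x \<in> X" and w: "w \<in> lists X" using Cons.prems by auto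
    have IH: "D 1 (D h ?w) = [int (Suc h)] \<cdot>\<^bsub>Skew X\<^esub> D (Suc h) ?w" for h by (rule Cons.IH[OF w])
    show ?case
    proof (cases h)
      case 0
      then show ?thesis using x w by (simp add: D_0)
    next
      case (Suc k)
      have "D 1 (D h (?x \<otimes>\<^bsub>Skew X\<^esub> ?w)) =
          D 1 ((?x \<otimes>\<^bsub>Skew X\<^esub> D h ?w) \<oplus>\<^bsub>Skew X\<^esub> (\<delta> x \<otimes>\<^bsub>Skew X\<^esub> D k ?w))"
        using x w by (simp add: Suc D_letter_mult)
      also have "\<dots> = ((\<delta> x \<otimes>\<^bsub>Skew X\<^esub> D h ?w) \<oplus>\<^bsub>Skew X\<^esub> (?x \<otimes>\<^bsub>Skew X\<^esub> D 1 (D h ?w))) \<oplus>\<^bsub>Skew X\<^esub>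
          ((D 1 (\<delta> x) \<otimes>\<^bsub>Skew X\<^esub> D k ?w) \<oplus>\<^bsub>Skew X\<^esub> (\<delta> x \<otimes>\<^bsub>Skew X\<^esub> D 1 (D k ?w)))"
        using x w D_letter[of x 1] by (simp only: D_add D_1_mult D_closed direction_closed skew_mon_closed
            Sk.m_closed Cons_in_lists_iff lists.Nil simp_thms) simp
      also have "\<dots> = (\<delta> x \<otimes>\<^bsub>Skew X\<^esub> D h ?w) \<oplus>\<^bsub>Skew X\<^esub> ([int (Suc h)] \<cdot>\<^bsub>Skew X\<^esub> (?x \<otimes>\<^bsub>Skew X\<^esub> D (Suc h) ?w)) \<oplus>\<^bsub>Skew X\<^esub>
          ([int h] \<cdot>\<^bsub>Skew X\<^esub> (\<delta> x \<otimes>\<^bsub>Skew X\<^esub> D h ?w))"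
        unfolding IH vanish[OF x] Suc[symmetric] using x w by (simp add: Sk.add_pow_rdistr_int)
      also have "\<dots> = [int (Suc h)] \<cdot>\<^bsub>Skew X\<^esub> (?x \<otimes>\<^bsub>Skew X\<^esub> D (Suc h) ?w) \<oplus>\<^bsub>Skew X\<^esub>
          [(1 + int h)] \<cdot>\<^bsub>Skew X\<^esub> (\<delta> x \<otimes>\<^bsub>Skew X\<^esub> D h ?w)"
        using x w by (simp add: Sk.int_mult_add_left[of _ _ 1 "int h"] Sk.a_ac del: of_nat_Suc)
      also have "\<dots> = [int (Suc h)] \<cdot>\<^bsub>Skew X\<^esub> D (Suc h) (?x \<otimes>\<^bsub>Skew X\<^esub> ?w)"
        using x w by (simp add: D_letter_mult Sk.int_mult_add_right)
      finally show ?thesis using x w skew_mon_Cons[of x X w] by simp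
    qed
  qed
qed

lemma D_1_funpow:
  assumes "\<And>x. x \<in> X \<Longrightarrow> D 1 (\<delta> x) = \<zero>\<^bsub>Skew X\<^esub>" and a: "a \<in> carrier (Skew X)"
  shows "(D 1 ^^ h) a = [(fact h :: int)] \<cdot>\<^bsub>Skew X\<^esub> D h a"
proof (induction h)
  case 0
  then show ?case using a by (simp add: D_0)
next
  case (Suc h)
  have "(D 1 ^^ Suc h) a = [(fact h :: int)] \<cdot>\<^bsub>Skew X\<^esub> D 1 (D h a)"
    using Suc a D_int[where a = "D h a" and k = "fact h"] by simp
  also have "\<dots> = [(fact (Suc h) :: int)] \<cdot>\<^bsub>Skew X\<^esub> D (Suc h) a"
    by (subst D_1_D[OF assms]) (use a in \<open>simp_all add: algebra_simps\<close>)
  finally show ?case .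
qed

end

lemma skew_derivation_eqI:
  assumes "add_hom (Skew X) (Skew X) d" "add_hom (Skew X) (Skew X) d'"
    and "\<And>a b. a \<in> carrier (Skew X) \<Longrightarrow> b \<in> carrier (Skew X) \<Longrightarrow>
      d (a \<otimes>\<^bsub>Skew X\<^esub> b) = (d a \<otimes>\<^bsub>Skew X\<^esub> b) \<oplus>\<^bsub>Skew X\<^esub> (a \<otimes>\<^bsub>Skew X\<^esub> d b)"
    and "\<And>a b. a \<in> carrier (Skew X) \<Longrightarrow> b \<in> carrier (Skew X) \<Longrightarrow>
      d' (a \<otimes>\<^bsub>Skew X\<^esub> b) = (d' a \<otimes>\<^bsub>Skew X\<^esub> b) \<oplus>\<^bsub>Skew X\<^esub> (a \<otimes>\<^bsub>Skew X\<^esub> d' b)"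
    and "\<And>x. x \<in> X \<Longrightarrow> d (skew_mon X [x]) = d' (skew_mon X [x])" and a: "a \<in> carrier (Skew X)"
  shows "d a = d' a"
proof (rule skew_add_hom_eqI[OF Sk.ring_axioms assms(1,2) _ a])
  fix w assume "w \<in> lists X"
  then show "d (skew_mon X w) = d' (skew_mon X w)"
  proof (induction w rule: list.induct)
    case Nil
    have "e \<one>\<^bsub>Skew X\<^esub> = \<zero>\<^bsub>Skew X\<^esub>" if "add_hom (Skew X) (Skew X) e"
      "e (\<one>\<^bsub>Skew X\<^esub> \<otimes>\<^bsub>Skew X\<^esub> \<one>\<^bsub>Skew X\<^esub>) = (e \<one>\<^bsub>Skew X\<^esub> \<otimes>\<^bsub>Skew X\<^esub> \<one>\<^bsub>Skew X\<^esub>) \<oplus>\<^bsub>Skew X\<^esub> (\<one>\<^bsub>Skew X\<^esub> \<otimes>\<^bsub>Skew X\<^esub> e \<one>\<^bsub>Skew X\<^esub>)" for e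
      using that(2) add_hom_closed[OF that(1) Sk.one_closed] by simp
    from this[OF assms(1,3)] this[OF assms(2,4)] show ?case by (simp add: skew_mon_Nil)
  next
    case (Cons x w)
    then show ?case using skew_mon_Cons[of x X w] assms(3-5) by simp
  qed
qed

section \<open>The parity grading\<close>

lemma skew_part_induct [consumes 1, case_names zero mon neg add]:
  assumes "a \<in> skew_part X e" "P \<zero>\<^bsub>Skew X\<^esub>" "\<And>w. w \<in> lists X \<Longrightarrow> odd (length w) = e \<Longrightarrow> P (skew_mon X w)"
    "\<And>a. a \<in> skew_part X e \<Longrightarrow> P a \<Longrightarrow> P (\<ominus>\<^bsub>Skew X\<^esub> a)"
    "\<And>a b. a \<in> skew_part X e \<Longrightarrow> b \<in> skew_part X e \<Longrightarrow> P a \<Longrightarrow> P b \<Longrightarrow> P (a \<oplus>\<^bsub>Skew X\<^esub> b)"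
  shows "P a"
proof -
  let ?I = "skew_ideal X" and ?A = "free_algebra X"
  let ?B = "{w \<in> lists X. odd (length w) = e}"
  have carr: "f \<in> carrier ?A" and part: "?I +>\<^bsub>?A\<^esub> f \<in> skew_part X e"
    if "Poly_Mapping.keys f \<subseteq> ?B" for f
    using that unfolding skew_part_def FA.carrier_A by blast+
  obtain f where f: "Poly_Mapping.keys f \<subseteq> ?B" "a = ?I +>\<^bsub>?A\<^esub> f"
    using assms(1) by (auto simp: skew_part_def FA.carrier_A)
  have "Poly_Mapping.keys f \<subseteq> ?B \<and> P (?I +>\<^bsub>?A\<^esub> f)"
    using f(1)
  proof (induction f rule: frag_induction)
    case zero
    then show ?case using assms(2) by (simp add: skew_coset_zero)
  next
    case (one w)
    then show ?case using assms(3) by (auto simp: skew_mon_def)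
  next
    case (diff f g)
    then have f: "Poly_Mapping.keys f \<subseteq> ?B" and g: "Poly_Mapping.keys g \<subseteq> ?B"
      and ng: "Poly_Mapping.keys (- g) \<subseteq> ?B" by auto
    have neg: "?I +>\<^bsub>?A\<^esub> (- g) = \<ominus>\<^bsub>Skew X\<^esub> (?I +>\<^bsub>?A\<^esub> g)"
      using ideal.rcos_neg[OF ideal_skew_ideal carr[OF g]] by (simp add: Skew_def FA.neg_A[OF carr[OF g]])
    have "?I +>\<^bsub>?A\<^esub> (f - g) = (?I +>\<^bsub>?A\<^esub> f) \<oplus>\<^bsub>Skew X\<^esub> (?I +>\<^bsub>?A\<^esub> (- g))"
      using ideal.quot_add[OF ideal_skew_ideal carr[OF f] carr[OF ng]] by (simp add: Skew_def FA.add_A)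
    moreover have "P (?I +>\<^bsub>?A\<^esub> (- g))" unfolding neg using assms(4) part[OF g] diff by blast
    moreover have "Poly_Mapping.keys (f - g) \<subseteq> ?B" using keys_diff[of f g] f g by blast
    ultimately show ?case
      using assms(5)[OF part[OF f] part[OF ng]] diff by simp
  qed
  then show ?thesis using f(2) by simp
qed

lemma skew_part_closed: "a \<in> skew_part X e \<Longrightarrow> a \<in> carrier (Skew X)"
  by (induction rule: skew_part_induct) auto

lemma skew_part_add:
  assumes "a \<in> skew_part X e" "b \<in> skew_part X e" shows "a \<oplus>\<^bsub>Skew X\<^esub> b \<in> skew_part X e"
proof -
  obtain f g where f: "f \<in> carrier (free_algebra X)" "\<forall>w\<in>Poly_Mapping.keys f. odd (length w) = e"
      "a = skew_ideal X +>\<^bsub>free_algebra X\<^esub> f"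
    and g: "g \<in> carrier (free_algebra X)" "\<forall>w\<in>Poly_Mapping.keys g. odd (length w) = e"
      "b = skew_ideal X +>\<^bsub>free_algebra X\<^esub> g"
    using assms unfolding skew_part_def by blast
  have "a \<oplus>\<^bsub>Skew X\<^esub> b = skew_ideal X +>\<^bsub>free_algebra X\<^esub> (f + g)"
    using ideal.quot_add[OF ideal_skew_ideal f(1) g(1)] by (simp add: Skew_def FA.add_A f(3) g(3))
  moreover have "f + g \<in> carrier (free_algebra X)"
    using FA.A.a_closed[OF f(1) g(1)] by (simp add: FA.add_A)
  moreover have "\<forall>w\<in>Poly_Mapping.keys (f + g). odd (length w) = e"
    using f(2) g(2) keys_add[of f g] by blast
  ultimately show ?thesis unfolding skew_part_def by blast
qed

lemma skew_part_mon: "w \<in> lists X \<Longrightarrow> odd (length w) = e \<Longrightarrow> skew_mon X w \<in> skew_part X e"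
  unfolding skew_part_def skew_mon_def by (rule CollectI, rule exI[of _ "frag_of w"]) simp

lemma skew_part_zero: "\<zero>\<^bsub>Skew X\<^esub> \<in> skew_part X e"
  unfolding skew_part_def using skew_coset_zero[of X] FA.A.zero_closed[of X]
  by (auto intro!: exI[of _ 0] simp: FA.zero_A)

lemma skew_part_neg: assumes "a \<in> skew_part X e" shows "\<ominus>\<^bsub>Skew X\<^esub> a \<in> skew_part X e"
proof -
  obtain f where f: "f \<in> carrier (free_algebra X)" "\<forall>w\<in>Poly_Mapping.keys f. odd (length w) = e"
      "a = skew_ideal X +>\<^bsub>free_algebra X\<^esub> f"
    using assms unfolding skew_part_def by blast
  have "\<ominus>\<^bsub>Skew X\<^esub> a = skew_ideal X +>\<^bsub>free_algebra X\<^esub> (- f)"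
    using ideal.rcos_neg[OF ideal_skew_ideal f(1)] by (simp add: Skew_def FA.neg_A[OF f(1)] f(3))
  moreover have "- f \<in> carrier (free_algebra X)"
    using FA.A.a_inv_closed[OF f(1)] by (simp add: FA.neg_A[OF f(1)])
  ultimately show ?thesis using f(2) unfolding skew_part_def by auto
qed

lemma skew_part_mult:
  assumes "a \<in> skew_part X e" "b \<in> skew_part X e'" "e'' = (e \<noteq> e')"
  shows "a \<otimes>\<^bsub>Skew X\<^esub> b \<in> skew_part X e''"
  using assms(1)
proof (induction a rule: skew_part_induct)
  case (mon u)
  show ?case using assms(2)
  proof (induction b rule: skew_part_induct)
    case (mon v)
    then show ?case using \<open>u \<in> lists X\<close> \<open>odd (length u) = e\<close> assms(3)
      by (simp flip: skew_mon_append) (intro skew_part_mon, auto)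
  qed (use mon in \<open>simp_all add: Sk.r_distr Sk.r_minus skew_part_zero skew_part_neg skew_part_add skew_part_closed\<close>)
qed (use assms(2) in \<open>simp_all add: Sk.l_distr Sk.l_minus skew_part_zero skew_part_neg skew_part_add skew_part_closed\<close>)

lemma skew_part_one: "\<one>\<^bsub>Skew X\<^esub> \<in> skew_part X False"
  using skew_part_mon[of "[]" X False] by (simp add: skew_mon_Nil)

section \<open>Tensor powers\<close>

text \<open>
  In this form the sign is visibly multiplicative in both arguments, hence a cocycle.
\<close>

lemma koszul_sign_prod:
  "koszul_sign m s t =
    (\<Prod>k\<in>{1..m}. \<Prod>l\<in>{1..m}. if l < k \<and> snd (s k) \<and> snd (t l) then -1 else 1)"
proof -
  have "(\<Prod>k\<in>{1..m}. \<Prod>l\<in>{1..m}. if l < k \<and> snd (s k) \<and> snd (t l) then -1 else (1::int)) =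
      (\<Prod>p\<in>{1..m} \<times> {1..m}. if (case p of (k, l) \<Rightarrow> l < k \<and> snd (s k) \<and> snd (t l)) then -1 else 1)"
    by (simp add: prod.cartesian_product split_def)
  also have "\<dots> = (-1) ^ card {p \<in> {1..m} \<times> {1..m}. case p of (k, l) \<Rightarrow> l < k \<and> snd (s k) \<and> snd (t l)}"
    by (subst prod.inter_filter[symmetric]) simp_all
  also have "{p \<in> {1..m} \<times> {1..m}. case p of (k, l) \<Rightarrow> l < k \<and> snd (s k) \<and> snd (t l)} =
      {(k, l). k \<in> {1..m} \<and> l \<in> {1..m} \<and> l < k \<and> snd (s k) \<and> snd (t l)}" by auto
  finally show ?thesis by (simp add: koszul_sign_def)
qed

lemma koszul_sign_cong:
  "(\<And>k. k \<in> {1..m} \<Longrightarrow> snd (s k) = snd (s' k)) \<Longrightarrow> (\<And>k. k \<in> {1..m} \<Longrightarrow> snd (t k) = snd (t' k)) \<Longrightarrow>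
    koszul_sign m s t = koszul_sign m s' t'"
  unfolding koszul_sign_prod by (intro prod.cong refl) auto

lemma koszul_sign_mult_left:
  assumes "\<And>k. k \<in> {1..m} \<Longrightarrow> snd (u k) = (snd (s k) \<noteq> snd (s' k))"
  shows "koszul_sign m u t = koszul_sign m s t * koszul_sign m s' t"
  unfolding koszul_sign_prod prod.distrib[symmetric]
  by (intro prod.cong refl) (use assms in auto)

lemma koszul_sign_mult_right:
  assumes "\<And>k. k \<in> {1..m} \<Longrightarrow> snd (u k) = (snd (t k) \<noteq> snd (t' k))"
  shows "koszul_sign m s u = koszul_sign m s t * koszul_sign m s t'"
  unfolding koszul_sign_prod prod.distrib[symmetric]
  by (intro prod.cong refl) (use assms in auto)

lemma koszul_sign_Suc:
  "koszul_sign (Suc n) s t =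
    koszul_sign n s t * (\<Prod>l\<in>{1..n}. if snd (s (Suc n)) \<and> snd (t l) then -1 else 1)"
proof -
  have "koszul_sign (Suc n) s t = (\<Prod>k\<in>{1..n}. \<Prod>l\<in>{1..Suc n}. if l < k \<and> snd (s k) \<and> snd (t l) then -1 else 1) *
      (\<Prod>l\<in>{1..Suc n}. if l < Suc n \<and> snd (s (Suc n)) \<and> snd (t l) then -1 else 1)"
    unfolding koszul_sign_prod by (subst prod.nat_ivl_Suc') (auto simp: mult.commute)
  also have "(\<Prod>l\<in>{1..Suc n}. if l < Suc n \<and> snd (s (Suc n)) \<and> snd (t l) then -1 else (1::int)) =
      (\<Prod>l\<in>{1..n}. if snd (s (Suc n)) \<and> snd (t l) then -1 else 1)"
    by (subst prod.nat_ivl_Suc') (auto intro!: prod.cong)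
  also have "(\<Prod>k\<in>{1..n}. \<Prod>l\<in>{1..Suc n}. if l < k \<and> snd (s k) \<and> snd (t l) then -1 else (1::int)) =
      koszul_sign n s t"
    unfolding koszul_sign_prod
  proof (rule prod.cong[OF refl])
    fix k assume "k \<in> {1..n}"
    then show "(\<Prod>l\<in>{1..Suc n}. if l < k \<and> snd (s k) \<and> snd (t l) then -1 else (1::int)) =
        (\<Prod>l\<in>{1..n}. if l < k \<and> snd (s k) \<and> snd (t l) then -1 else 1)"
      by (subst prod.nat_ivl_Suc') auto
  qed
  finally show ?thesis .
qed

definition tuple_mult :: "'a set \<Rightarrow> nat \<Rightarrow> (nat \<Rightarrow> 'a skew_elem \<times> bool) \<Rightarrow> (nat \<Rightarrow> 'a skew_elem \<times> bool) \<Rightarrow>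
    nat \<Rightarrow> 'a skew_elem \<times> bool" where
  "tuple_mult S m s t = (\<lambda>k\<in>{1..m}. (fst (s k) \<otimes>\<^bsub>Skew S\<^esub> fst (t k), snd (s k) \<noteq> snd (t k)))"

abbreviation "tuples S m \<equiv> hom_tuples (skew_part S) m"
abbreviation "tuple_algebra S m \<equiv> graded_tuple_algebra (Skew S) (skew_part S) m"
abbreviation "tuple_ideal S m \<equiv> multilinear_ideal (Skew S) (skew_part S) m"

lemma tuples_iff: "t \<in> tuples S m \<longleftrightarrow> t \<in> extensional {1..m} \<and> (\<forall>k\<in>{1..m}. fst (t k) \<in> skew_part S (snd (t k)))"
  by (auto simp: hom_tuples_def PiE_iff split_def)

lemma tuples_extensionalityI:
  "s \<in> tuples S m \<Longrightarrow> t \<in> tuples S m \<Longrightarrow> (\<And>k. k \<in> {1..m} \<Longrightarrow> s k = t k) \<Longrightarrow> s = t"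
  unfolding hom_tuples_def by (rule PiE_ext)

lemma tuple_mult_closed: "s \<in> tuples S m \<Longrightarrow> t \<in> tuples S m \<Longrightarrow> tuple_mult S m s t \<in> tuples S m"
  by (auto simp: tuples_iff tuple_mult_def intro: skew_part_mult)

lemma tuple_one_closed: "(\<lambda>k\<in>{1..m}. (\<one>\<^bsub>Skew S\<^esub>, False)) \<in> tuples S m"
  by (auto simp: tuples_iff skew_part_one)

interpretation TA: twisted_monoid "tuples S m" "koszul_sign m" "tuple_mult S m" "\<lambda>k\<in>{1..m}. (\<one>\<^bsub>Skew S\<^esub>, False)"
  rewrites "twisted_monoid_algebra (tuples S m) (koszul_sign m) (tuple_mult S m)
      (\<lambda>k\<in>{1..m}. (\<one>\<^bsub>Skew S\<^esub>, False)) = tuple_algebra S m"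
  for S :: "'a set" and m
proof -
  let ?e = "\<lambda>k\<in>{1..m}. (\<one>\<^bsub>Skew S\<^esub>, False)"
  have pc: "fst (s k) \<in> carrier (Skew S)" if "s \<in> tuples S m" "k \<in> {1..m}" for s k
    using that by (intro skew_part_closed[of _ S "snd (s k)"]) (simp add: tuples_iff)
  have snd_mult: "snd (tuple_mult S m s t k) = (snd (s k) \<noteq> snd (t k))" if "k \<in> {1..m}" for s t k
    using that by (simp add: tuple_mult_def)
  show "twisted_monoid (tuples S m) (koszul_sign m) (tuple_mult S m) ?e"
  proof
    fix s t u assume s: "s \<in> tuples S m" and t: "t \<in> tuples S m" and u: "u \<in> tuples S m"
    show "tuple_mult S m (tuple_mult S m s t) u = tuple_mult S m s (tuple_mult S m t u)"
    proof (rule tuples_extensionalityI)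
      show "tuple_mult S m (tuple_mult S m s t) u k = tuple_mult S m s (tuple_mult S m t u) k"
        if "k \<in> {1..m}" for k
        using that pc[OF s that] pc[OF t that] pc[OF u that] by (auto simp: tuple_mult_def Sk.m_assoc)
    qed (use s t u in \<open>auto intro: tuple_mult_closed\<close>)
    show "koszul_sign m s t * koszul_sign m (tuple_mult S m s t) u =
        koszul_sign m t u * koszul_sign m s (tuple_mult S m t u)"
      using koszul_sign_mult_left[of m "tuple_mult S m s t" s t u] koszul_sign_mult_right[of m "tuple_mult S m t u" t u s]
      by (simp add: snd_mult)
  next
    fix s assume s: "s \<in> tuples S m"
    show "tuple_mult S m ?e s = s"
      by (rule tuples_extensionalityI[OF tuple_mult_closed[OF tuple_one_closed s] s])
        (use pc[OF s] in \<open>simp add: tuple_mult_def\<close>)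
    show "tuple_mult S m s ?e = s"
      by (rule tuples_extensionalityI[OF tuple_mult_closed[OF s tuple_one_closed] s])
        (use pc[OF s] in \<open>simp add: tuple_mult_def\<close>)
    show "koszul_sign m ?e s = 1" "koszul_sign m s ?e = 1"
      by (auto simp: koszul_sign_prod intro!: prod.neutral)
  qed (use tuple_mult_closed tuple_one_closed in auto)
  show "twisted_monoid_algebra (tuples S m) (koszul_sign m) (tuple_mult S m) ?e = tuple_algebra S m"
    by (simp add: graded_tuple_algebra_def tuple_mult_def[abs_def])
qed

lemma tuple_upd_closed: "t \<in> tuples S m \<Longrightarrow> k \<in> {1..m} \<Longrightarrow> a \<in> skew_part S e \<Longrightarrow> t(k := (a, e)) \<in> tuples S m"
  by (auto simp: tuples_iff extensional_def)

lemma tuple_gens_subset: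
  "{frag_of (t(k := (a \<oplus>\<^bsub>Skew S\<^esub> b, e))) - frag_of (t(k := (a, e))) - frag_of (t(k := (b, e)))
        | t k a b e. t \<in> tuples S m \<and> k \<in> {1..m} \<and> a \<in> skew_part S e \<and> b \<in> skew_part S e}
    \<subseteq> carrier (tuple_algebra S m)"
proof safe
  fix t k a b e assume *: "t \<in> tuples S m" "k \<in> {1..m}" "a \<in> skew_part S e" "b \<in> skew_part S e"
  let ?x = "frag_of (t(k := (a, e)))" and ?y = "frag_of (t(k := (b, e)))"
    and ?z = "frag_of (t(k := (a \<oplus>\<^bsub>Skew S\<^esub> b, e)))"
  have x: "?x \<in> carrier (tuple_algebra S m)" and y: "?y \<in> carrier (tuple_algebra S m)"
    and z: "?z \<in> carrier (tuple_algebra S m)"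
    using tuple_upd_closed[OF *(1,2)] *(3,4) skew_part_add[OF *(3,4)] by simp_all
  have zx: "?z - ?x \<in> carrier (tuple_algebra S m)"
    using TA.A.minus_closed[OF z x] by (simp only: TA.minus_A[OF z x])
  show "?z - ?x - ?y \<in> carrier (tuple_algebra S m)"
    using TA.A.minus_closed[OF zx y] by (simp only: TA.minus_A[OF zx y])
qed

lemma ideal_tuple_ideal: "ideal (tuple_ideal S m) (tuple_algebra S m)"
  unfolding multilinear_ideal_def by (rule TA.A.genideal_ideal[OF tuple_gens_subset])

interpretation Te: ring "SkewT S m" for S :: "'a set" and m
  unfolding SkewT_def graded_tensor_power_def by (rule ideal.quotient_is_ring[OF ideal_tuple_ideal])

text \<open>
  Unlike in \<open>tuples\<close>, values outside the places are arbitrary, so that no restrictions appear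
  when single entries are replaced.
\<close>

definition family :: "'a set \<Rightarrow> nat \<Rightarrow> (nat \<Rightarrow> 'a skew_elem \<times> bool) \<Rightarrow> bool" where
  "family S m t \<longleftrightarrow> (\<forall>k\<in>{1..m}. fst (t k) \<in> skew_part S (snd (t k)))"

definition pure :: "'a set \<Rightarrow> nat \<Rightarrow> (nat \<Rightarrow> 'a skew_elem \<times> bool) \<Rightarrow> 'a tensor_elem" where
  "pure S m t = pure_tensor (Skew S) (skew_part S) m t"

lemma family_restrict: "family S m t \<Longrightarrow> restrict t {1..m} \<in> tuples S m"
  by (auto simp: family_def tuples_iff)

lemma pure_eq: "pure S m t = tuple_ideal S m +>\<^bsub>tuple_algebra S m\<^esub> frag_of (restrict t {1..m})"
  by (simp add: pure_def pure_tensor_def)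

lemma pure_closed: "family S m t \<Longrightarrow> pure S m t \<in> carrier (SkewT S m)"
  unfolding pure_eq SkewT_def graded_tensor_power_def
  by (intro ideal.quot_closed[OF ideal_tuple_ideal] TA.frag_of_A family_restrict)

lemma pure_cong: "(\<And>k. k \<in> {1..m} \<Longrightarrow> s k = t k) \<Longrightarrow> pure S m s = pure S m t"
  unfolding pure_eq by (metis restrict_ext)

lemma pure_mult:
  assumes "family S m s" "family S m t"
  shows "pure S m s \<otimes>\<^bsub>SkewT S m\<^esub> pure S m t =
    [koszul_sign m s t] \<cdot>\<^bsub>SkewT S m\<^esub> pure S m (\<lambda>k. (fst (s k) \<otimes>\<^bsub>Skew S\<^esub> fst (t k), snd (s k) \<noteq> snd (t k)))"
proof -
  let ?s = "restrict s {1..m}" and ?t = "restrict t {1..m}"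
  note cl = family_restrict[OF assms(1)] family_restrict[OF assms(2)]
  have mult: "tuple_mult S m ?s ?t \<in> tuples S m" using cl by (rule tuple_mult_closed)
  have "frag_of ?s \<otimes>\<^bsub>tuple_algebra S m\<^esub> frag_of ?t =
      [koszul_sign m ?s ?t] \<cdot>\<^bsub>tuple_algebra S m\<^esub> frag_of (tuple_mult S m ?s ?t)"
    using mult by (simp add: TA.mult_A TA.int_A)
  moreover have "koszul_sign m ?s ?t = koszul_sign m s t" by (rule koszul_sign_cong) auto
  moreover have "tuple_mult S m ?s ?t =
      restrict (\<lambda>k. (fst (s k) \<otimes>\<^bsub>Skew S\<^esub> fst (t k), snd (s k) \<noteq> snd (t k))) {1..m}"
    by (auto simp: tuple_mult_def)
  ultimately show ?thesis
    using cl mult unfolding pure_eq SkewT_def graded_tensor_power_def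
    by (simp add: ideal.quot_mult[OF ideal_tuple_ideal] ideal.rcos_int[OF ideal_tuple_ideal, symmetric])
qed

lemma pure_one: "pure S m (\<lambda>k. (\<one>\<^bsub>Skew S\<^esub>, False)) = \<one>\<^bsub>SkewT S m\<^esub>"
  by (simp add: pure_eq SkewT_def graded_tensor_power_def TA.one_A)

lemma family_upd: "family S m t \<Longrightarrow> a \<in> skew_part S e \<Longrightarrow> family S m (t(k := (a, e)))"
  by (auto simp: family_def)

lemma pure_add:
  assumes t: "family S m t" and k: "k \<in> {1..m}" and ab: "a \<in> skew_part S e" "b \<in> skew_part S e"
  shows "pure S m (t(k := (a \<oplus>\<^bsub>Skew S\<^esub> b, e))) =
    pure S m (t(k := (a, e))) \<oplus>\<^bsub>SkewT S m\<^esub> pure S m (t(k := (b, e)))"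
proof -
  let ?A = "tuple_algebra S m" and ?I = "tuple_ideal S m"
  let ?t = "restrict t {1..m}"
  have r: "restrict (t(k := x)) {1..m} = ?t(k := x)" for x using k by auto
  note cl = tuple_upd_closed[OF family_restrict[OF t] k]
  let ?x = "frag_of (?t(k := (a, e)))" and ?y = "frag_of (?t(k := (b, e)))"
    and ?z = "frag_of (?t(k := (a \<oplus>\<^bsub>Skew S\<^esub> b, e)))"
  have xyz: "?x \<in> carrier ?A" "?y \<in> carrier ?A" "?z \<in> carrier ?A"
    using cl ab skew_part_add[OF ab] by auto
  have "?z - ?x - ?y \<in> ?I"
    unfolding multilinear_ideal_def
    by (rule subsetD[OF TA.A.genideal_self[OF tuple_gens_subset]])
      (use ab k family_restrict[OF t] in blast)
  then have "?z \<ominus>\<^bsub>?A\<^esub> (?x \<oplus>\<^bsub>?A\<^esub> ?y) \<in> ?I"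
    using xyz TA.A.a_closed[OF xyz(1,2)] by (simp add: TA.minus_A TA.add_A diff_diff_eq)
  then have "?I +>\<^bsub>?A\<^esub> ?z = ?I +>\<^bsub>?A\<^esub> (?x \<oplus>\<^bsub>?A\<^esub> ?y)"
    using xyz by (intro ideal.coset_eqI[OF ideal_tuple_ideal]) auto
  then show ?thesis
    unfolding pure_eq r SkewT_def graded_tensor_power_def using xyz
    by (simp add: ideal.quot_add[OF ideal_tuple_ideal])
qed

lemma pure_zero:
  assumes "family S m t" "k \<in> {1..m}"
  shows "pure S m (t(k := (\<zero>\<^bsub>Skew S\<^esub>, e))) = \<zero>\<^bsub>SkewT S m\<^esub>"
proof -
  let ?p = "pure S m (t(k := (\<zero>\<^bsub>Skew S\<^esub>, e)))"
  have "?p = ?p \<oplus>\<^bsub>SkewT S m\<^esub> ?p"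
    using pure_add[OF assms skew_part_zero skew_part_zero, of e] by simp
  moreover have "?p \<in> carrier (SkewT S m)"
    by (intro pure_closed family_upd assms skew_part_zero)
  ultimately show ?thesis using Te.add.l_cancel_one[of ?p S m ?p] by simp
qed

lemma pure_neg:
  assumes "family S m t" "k \<in> {1..m}" "a \<in> skew_part S e"
  shows "pure S m (t(k := (\<ominus>\<^bsub>Skew S\<^esub> a, e))) = \<ominus>\<^bsub>SkewT S m\<^esub> pure S m (t(k := (a, e)))"
proof (rule Te.minus_equality[symmetric])
  show "pure S m (t(k := (\<ominus>\<^bsub>Skew S\<^esub> a, e))) \<oplus>\<^bsub>SkewT S m\<^esub> pure S m (t(k := (a, e))) = \<zero>\<^bsub>SkewT S m\<^esub>"
    using pure_add[OF assms(1,2) skew_part_neg[OF assms(3)] assms(3)] pure_zero[OF assms(1,2), of e]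
      skew_part_closed[OF assms(3)] by (simp add: Sk.l_neg)
qed (intro pure_closed family_upd assms skew_part_neg)+

definition mon_tuple :: "'a set \<Rightarrow> (nat \<Rightarrow> 'a list) \<Rightarrow> nat \<Rightarrow> 'a skew_elem \<times> bool" where
  "mon_tuple S A k = (skew_mon S (A k), odd (length (A k)))"

lemma tensor_mon_pure: "tensor_mon S m A = pure S m (mon_tuple S A)"
  by (simp add: tensor_mon_def pure_def mon_tuple_def[abs_def])

lemma family_mon: "A \<in> {1..m} \<rightarrow> lists S \<Longrightarrow> family S m (mon_tuple S A)"
  by (auto simp: family_def mon_tuple_def intro!: skew_part_mon)

lemma tensor_mon_closed [simp]: "A \<in> {1..m} \<rightarrow> lists S \<Longrightarrow> tensor_mon S m A \<in> carrier (SkewT S m)"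
  unfolding tensor_mon_pure by (intro pure_closed family_mon)

lemma tensor_mon_cong: "(\<And>k. k \<in> {1..m} \<Longrightarrow> A k = B k) \<Longrightarrow> tensor_mon S m A = tensor_mon S m B"
  unfolding tensor_mon_pure by (rule pure_cong) (simp add: mon_tuple_def)

lemma tensor_mon_Nil: "tensor_mon S m (\<lambda>_. []) = \<one>\<^bsub>SkewT S m\<^esub>"
  using pure_one by (simp add: tensor_mon_pure mon_tuple_def[abs_def] skew_mon_Nil)

lemma tensor_mon_mult:
  assumes "A \<in> {1..m} \<rightarrow> lists S" "B \<in> {1..m} \<rightarrow> lists S"
  shows "tensor_mon S m A \<otimes>\<^bsub>SkewT S m\<^esub> tensor_mon S m B =
    [koszul_sign m (mon_tuple S A) (mon_tuple S B)] \<cdot>\<^bsub>SkewT S m\<^esub> tensor_mon S m (\<lambda>k. A k @ B k)"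
proof -
  have "pure S m (\<lambda>k. (fst (mon_tuple S A k) \<otimes>\<^bsub>Skew S\<^esub> fst (mon_tuple S B k),
      snd (mon_tuple S A k) \<noteq> snd (mon_tuple S B k))) = pure S m (mon_tuple S (\<lambda>k. A k @ B k))"
    by (rule pure_cong) (use assms in \<open>auto simp: mon_tuple_def skew_mon_append Pi_iff\<close>)
  then show ?thesis
    unfolding tensor_mon_pure pure_mult[OF family_mon[OF assms(1)] family_mon[OF assms(2)]] by simp
qed

text \<open>
  By multilinearity the entries of a pure tensor are replaced by words, one place at a time.
\<close>

lemma tensor_induct [consumes 1, case_names zero mon neg add]:
  assumes c: "c \<in> carrier (SkewT S m)" and zero: "P \<zero>\<^bsub>SkewT S m\<^esub>"
    and mon: "\<And>A. A \<in> {1..m} \<rightarrow> lists S \<Longrightarrow> P (tensor_mon S m A)"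
    and neg: "\<And>a. a \<in> carrier (SkewT S m) \<Longrightarrow> P a \<Longrightarrow> P (\<ominus>\<^bsub>SkewT S m\<^esub> a)"
    and add: "\<And>a b. a \<in> carrier (SkewT S m) \<Longrightarrow> b \<in> carrier (SkewT S m) \<Longrightarrow> P a \<Longrightarrow> P b \<Longrightarrow>
      P (a \<oplus>\<^bsub>SkewT S m\<^esub> b)"
  shows "P c"
proof -
  let ?A = "tuple_algebra S m" and ?I = "tuple_ideal S m"
  \<comment> \<open>The induction is on the number of initial places whose entries are not yet known to be words.\<close>
  have pure: "P (pure S m t)" if "family S m t"
    "\<And>k. k \<in> {1..m} \<Longrightarrow> n < k \<Longrightarrow> \<exists>w\<in>lists S. t k = (skew_mon S w, odd (length w))" for n t
    using that
  proof (induction n arbitrary: t)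
    case 0
    have "\<exists>w. w \<in> lists S \<and> t k = (skew_mon S w, odd (length w))" if "k \<in> {1..m}" for k
    proof -
      have "0 < k" using that by simp
      then show ?thesis using "0.prems"(2)[OF that] by blast
    qed
    then have "\<forall>k\<in>{1..m}. \<exists>w. w \<in> lists S \<and> t k = (skew_mon S w, odd (length w))" by blast
    from bchoice[OF this] obtain A
      where A: "\<forall>k\<in>{1..m}. A k \<in> lists S \<and> t k = (skew_mon S (A k), odd (length (A k)))" ..
    have "pure S m t = tensor_mon S m A"
      unfolding tensor_mon_pure by (rule pure_cong) (use A in \<open>simp add: mon_tuple_def\<close>)
    then show ?case using mon[of A] A by auto
  next
    case (Suc n)
    show ?case
    proof (cases "Suc n \<in> {1..m}")
      case False
      then show ?thesis using Suc.IH[OF Suc.prems(1)] Suc.prems(2) by (metis Suc_lessI)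
    next
      case True
      obtain a e where ae: "t (Suc n) = (a, e)" by (cases "t (Suc n)")
      have "a \<in> skew_part S e" using Suc.prems(1) True ae by (force simp: family_def)
      then have "P (pure S m (t(Suc n := (a, e))))"
      proof (induction a rule: skew_part_induct)
        case zero
        show ?case unfolding pure_zero[OF Suc.prems(1) True] by (rule assms(2))
      next
        case (mon w)
        show ?case
        proof (rule Suc.IH)
          show "family S m (t(Suc n := (skew_mon S w, e)))"
            using Suc.prems(1) mon by (intro family_upd skew_part_mon)
          show "\<exists>w'\<in>lists S. (t(Suc n := (skew_mon S w, e))) k = (skew_mon S w', odd (length w'))"
            if "k \<in> {1..m}" "n < k" for k
            using that mon Suc.prems(2)[of k] by (cases "k = Suc n") auto
        qed
      next
        case (neg a)
        then show ?case using pure_neg[OF Suc.prems(1) True] assms(4) pure_closed family_upd Suc.prems(1)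
          by metis
      next
        case (add a b)
        then show ?case using pure_add[OF Suc.prems(1) True] assms(5) pure_closed family_upd Suc.prems(1)
          by metis
      qed
      then show ?thesis using ae by (metis fun_upd_triv)
    qed
  qed
  obtain f where f: "f \<in> carrier ?A" "c = ?I +>\<^bsub>?A\<^esub> f"
    using c by (auto simp: SkewT_def graded_tensor_power_def ideal.quot_carrier[OF ideal_tuple_ideal])
  note SkT = SkewT_def graded_tensor_power_def
  have "P (?I +>\<^bsub>?A\<^esub> f)" using f(1)
  proof (induction f rule: TA.add_subgroup_induct)
    case zero
    then show ?case
      using \<open>P \<zero>\<^bsub>SkewT S m\<^esub>\<close> ideal.rcos_const[OF ideal_tuple_ideal additive_subgroup.zero_closed[OF
          ideal.axioms(1)[OF ideal_tuple_ideal[of S m]]]] by (simp add: SkT)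
  next
    case (one t)
    have "restrict t {1..m} = t" using one by (auto simp: tuples_iff extensional_restrict)
    then have "?I +>\<^bsub>?A\<^esub> frag_of t = pure S m t" by (simp add: pure_eq)
    then show ?case using pure[of t m] one by (auto simp: family_def tuples_iff)
  next
    case (neg f)
    then show ?case
      using assms(4)[of "?I +>\<^bsub>?A\<^esub> f"] ideal.rcos_neg[OF ideal_tuple_ideal neg(1)]
        ideal.quot_closed[OF ideal_tuple_ideal neg(1)] by (simp add: SkT)
  next
    case (add f g)
    then show ?case
      using assms(5)[of "?I +>\<^bsub>?A\<^esub> f" "?I +>\<^bsub>?A\<^esub> g"] ideal.quot_closed[OF ideal_tuple_ideal add(1)]
        ideal.quot_closed[OF ideal_tuple_ideal add(2)] ideal.quot_add[OF ideal_tuple_ideal add(1,2)]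
      by (simp add: SkT)
  qed
  then show ?thesis using f(2) by simp
qed

lemma tensor_add_hom_eqI:
  assumes "ring R" "add_hom (SkewT S m) R f" "add_hom (SkewT S m) R g"
    and "\<And>A. A \<in> {1..m} \<rightarrow> lists S \<Longrightarrow> f (tensor_mon S m A) = g (tensor_mon S m A)" and "a \<in> carrier (SkewT S m)"
  shows "f a = g a"
  using assms(5)
  by (induction a rule: tensor_induct)
    (simp_all add: assms(4) add_hom_zero[OF Te.ring_axioms assms(1)] add_hom_neg[OF Te.ring_axioms assms(1)]
      add_hom_add[OF assms(2)] add_hom_add[OF assms(3)] assms(2,3))

section \<open>The letterplace algebra is the tensor power\<close>

text \<open>
  Places are counted from \<open>1\<close>, which therefore has to survive simplification.
\<close>

declare One_nat_def [simp del] upt_Suc [simp del] in_listsI [rule del] in_listsD [rule del]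

definition at_place :: "nat \<Rightarrow> 'a list \<Rightarrow> nat \<Rightarrow> 'a list" where
  "at_place k w = (\<lambda>_. [])(k := w)"

definition place_word :: "nat \<Rightarrow> 'a list \<Rightarrow> ('a \<times> nat) list" where
  "place_word k w = map (\<lambda>x. (x, k)) w"

definition places_word :: "nat \<Rightarrow> (nat \<Rightarrow> 'a list) \<Rightarrow> ('a \<times> nat) list" where
  "places_word m A = concat (map (\<lambda>k. place_word k (A k)) [1..<Suc m])"

lemma place_word_simps [simp]:
  "place_word k [] = []" "place_word k (x # w) = (x, k) # place_word k w"
  "place_word k (u @ v) = place_word k u @ place_word k v" "length (place_word k w) = length w"
  by (simp_all add: place_word_def)

lemma place_word_lists [simp]: "w \<in> lists S \<Longrightarrow> k \<in> {1..m} \<Longrightarrow> place_word k w \<in> lists (S \<times> {1..m})"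
  by (auto simp: place_word_def in_lists_conv_set)

lemma concat_lists: "(\<And>u. u \<in> set us \<Longrightarrow> u \<in> lists X) \<Longrightarrow> concat us \<in> lists X"
  by (induction us) auto

lemma places_word_lists: "A \<in> {1..m} \<rightarrow> lists S \<Longrightarrow> places_word m A \<in> lists (S \<times> {1..m})"
  unfolding places_word_def by (rule concat_lists) (auto simp: Pi_iff intro!: place_word_lists)

lemma at_place_lists: "w \<in> lists S \<Longrightarrow> at_place k w \<in> K \<rightarrow> lists S"
  by (simp add: at_place_def)

lemma koszul_sign_at_place:
  "i \<in> {1..m} \<Longrightarrow> j \<in> {1..m} \<Longrightarrow>
    koszul_sign m (mon_tuple S (at_place i u)) (mon_tuple S (at_place j v)) =
      (if j < i \<and> odd (length u) \<and> odd (length v) then -1 else 1)"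
proof -
  assume ij: "i \<in> {1..m}" "j \<in> {1..m}"
  have "{(k, l). k \<in> {1..m} \<and> l \<in> {1..m} \<and> l < k \<and> snd (mon_tuple S (at_place i u) k) \<and> snd (mon_tuple S (at_place j v) l)} =
    (if j < i \<and> odd (length u) \<and> odd (length v) then {(i, j)} else {})"
    using ij by (auto simp: mon_tuple_def at_place_def split: if_splits)
  then show ?thesis by (simp add: koszul_sign_def)
qed

lemma at_place_cong: "at_place i u k @ at_place i v k = at_place i (u @ v) k"
  by (simp add: at_place_def)

text \<open>
  In different places the sign comes from the product of the tensor power, in the same place from
  the factor itself.
\<close>

lemma tensor_letter_anti:
  assumes "x \<in> S" "y \<in> S" "i \<in> {1..m}" "j \<in> {1..m}"
  shows "tensor_mon S m (at_place i [x]) \<otimes>\<^bsub>SkewT S m\<^esub> tensor_mon S m (at_place j [y]) =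
    \<ominus>\<^bsub>SkewT S m\<^esub> (tensor_mon S m (at_place j [y]) \<otimes>\<^bsub>SkewT S m\<^esub> tensor_mon S m (at_place i [x]))"
proof -
  have fam: "at_place k [z] \<in> {1..m} \<rightarrow> lists S" if "z \<in> S" for k z using that by (simp add: at_place_lists)
  have mult: "tensor_mon S m (at_place i [x]) \<otimes>\<^bsub>SkewT S m\<^esub> tensor_mon S m (at_place j [y]) =
      [(if j < i then -1 else 1::int)] \<cdot>\<^bsub>SkewT S m\<^esub> tensor_mon S m (\<lambda>k. at_place i [x] k @ at_place j [y] k)"
    if "x \<in> S" "y \<in> S" "i \<in> {1..m}" "j \<in> {1..m}" for x y i j
    using that by (simp add: tensor_mon_mult fam koszul_sign_at_place)
  show ?thesis
  proof (cases "i = j")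
    case False
    have "tensor_mon S m (\<lambda>k. at_place i [x] k @ at_place j [y] k) =
        tensor_mon S m (\<lambda>k. at_place j [y] k @ at_place i [x] k)"
      using False by (intro tensor_mon_cong) (simp add: at_place_def)
    moreover have "tensor_mon S m (\<lambda>k. at_place j [y] k @ at_place i [x] k) \<in> carrier (SkewT S m)"
      using assms by (intro tensor_mon_closed) (auto simp: at_place_def)
    ultimately show ?thesis using False assms by (auto simp: mult Te.int_mult_neg)
  next
    case True
    have fam0: "family S m (mon_tuple S (\<lambda>_. []))" by (rule family_mon) simp
    have upd: "tensor_mon S m (at_place j [z, z']) = pure S m ((mon_tuple S (\<lambda>_. []))(j := (skew_mon S [z, z'], False)))"
      for z z' unfolding tensor_mon_pure by (rule pure_cong) (simp add: mon_tuple_def at_place_def)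
    have "tensor_mon S m (at_place j [x, y]) = \<ominus>\<^bsub>SkewT S m\<^esub> tensor_mon S m (at_place j [y, x])"
      unfolding upd skew_mon_anti[OF assms(1,2)]
      using assms by (intro pure_neg fam0 assms skew_part_mon) auto
    then show ?thesis using True assms by (simp add: mult at_place_cong at_place_lists)
  qed
qed

lemma tensor_letter_square:
  assumes "x \<in> S" "i \<in> {1..m}"
  shows "tensor_mon S m (at_place i [x]) \<otimes>\<^bsub>SkewT S m\<^esub> tensor_mon S m (at_place i [x]) = \<zero>\<^bsub>SkewT S m\<^esub>"
proof -
  have fam0: "family S m (mon_tuple S (\<lambda>_. []))" by (rule family_mon) simp
  have fam: "at_place i [x] \<in> {1..m} \<rightarrow> lists S" using assms by (simp add: at_place_lists)
  have "tensor_mon S m (at_place i [x, x]) = pure S m ((mon_tuple S (\<lambda>_. []))(i := (skew_mon S [x, x], False)))"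
    unfolding tensor_mon_pure by (rule pure_cong) (simp add: mon_tuple_def at_place_def)
  also have "\<dots> = \<zero>\<^bsub>SkewT S m\<^esub>"
    unfolding skew_mon_square[OF assms(1)] by (rule pure_zero[OF fam0 assms(2)])
  finally show ?thesis
    using assms by (simp add: tensor_mon_mult fam koszul_sign_at_place at_place_cong)
qed

lemma tensor_hom_place_word:
  assumes \<phi>: "\<phi> \<in> Ring.ring_hom (letterplace S m) (SkewT S m)"
    and letters: "\<And>x i. x \<in> S \<Longrightarrow> i \<in> {1..m} \<Longrightarrow> \<phi> (lp_gen S m x i) = tensor_mon S m (at_place i [x])"
    and k: "k \<in> {1..m}" and w: "w \<in> lists S"
  shows "\<phi> (skew_mon (S \<times> {1..m}) (place_word k w)) = tensor_mon S m (at_place k w)"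
  using w
proof (induction w rule: list.induct)
  case Nil
  have "at_place k [] = (\<lambda>_. [] :: 'a list)" by (auto simp: at_place_def)
  then show ?case using ring_hom_one[OF \<phi>] by (simp add: skew_mon_Nil tensor_mon_Nil letterplace_def)
next
  case (Cons x w)
  let ?L = "S \<times> {1..m}"
  have x: "x \<in> S" and w: "w \<in> lists S" using Cons.prems by auto
  have xk: "(x, k) \<in> ?L" using x k by simp
  have "\<phi> (skew_mon ?L ((x, k) # place_word k w)) = \<phi> (skew_mon ?L [(x, k)] \<otimes>\<^bsub>Skew ?L\<^esub> skew_mon ?L (place_word k w))"
    using xk w k by (subst skew_mon_Cons) auto
  also have "\<dots> = \<phi> (skew_mon ?L [(x, k)]) \<otimes>\<^bsub>SkewT S m\<^esub> \<phi> (skew_mon ?L (place_word k w))"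
    using xk w k by (intro ring_hom_mult[OF \<phi>[unfolded letterplace_def]]) auto
  also have "\<dots> = tensor_mon S m (at_place k [x]) \<otimes>\<^bsub>SkewT S m\<^esub> tensor_mon S m (at_place k w)"
    using letters[OF x k] Cons.IH[OF w] by (simp add: lp_gen_def)
  also have "\<dots> = tensor_mon S m (at_place k (x # w))"
    using k x w by (simp add: tensor_mon_mult at_place_lists koszul_sign_at_place at_place_cong)
  finally show ?case by simp
qed

text \<open>
  No sign appears: a word sorted by places is multiplied out in the order of the tensor factors.
\<close>

lemma tensor_hom_places_word:
  assumes \<phi>: "\<phi> \<in> Ring.ring_hom (letterplace S m) (SkewT S m)"
    and letters: "\<And>x i. x \<in> S \<Longrightarrow> i \<in> {1..m} \<Longrightarrow> \<phi> (lp_gen S m x i) = tensor_mon S m (at_place i [x])"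
    and A: "A \<in> {1..m} \<rightarrow> lists S"
  shows "\<phi> (skew_mon (S \<times> {1..m}) (places_word m A)) = tensor_mon S m A"
proof -
  let ?L = "S \<times> {1..m}"
  have "\<phi> (skew_mon ?L (places_word n A)) = tensor_mon S m (\<lambda>k. if k \<le> n then A k else [])"
    if "n \<le> m" for n
    using that
  proof (induction n)
    case 0
    have "tensor_mon S m (\<lambda>k. if k \<le> 0 then A k else []) = tensor_mon S m (\<lambda>_. [])"
      by (rule tensor_mon_cong) simp
    then show ?case using ring_hom_one[OF \<phi>]
      by (simp add: places_word_def skew_mon_Nil tensor_mon_Nil letterplace_def)
  next
    case (Suc n)
    let ?A = "\<lambda>k. if k \<le> n then A k else []" and ?B = "at_place (Suc n) (A (Suc n))"
    have n: "Suc n \<in> {1..m}" using Suc.prems by simp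
    then have An: "A (Suc n) \<in> lists S" using A by auto
    have pn: "places_word n A \<in> lists ?L"
      unfolding places_word_def using A Suc.prems
      by (intro concat_lists) (auto simp: Pi_iff intro!: place_word_lists)
    have fam: "?A \<in> {1..m} \<rightarrow> lists S" using A by (auto simp: Pi_iff)
    have "places_word (Suc n) A = places_word n A @ place_word (Suc n) (A (Suc n))"
      by (simp add: places_word_def upt_Suc)
    then have "\<phi> (skew_mon ?L (places_word (Suc n) A)) =
        \<phi> (skew_mon ?L (places_word n A)) \<otimes>\<^bsub>SkewT S m\<^esub> \<phi> (skew_mon ?L (place_word (Suc n) (A (Suc n))))"
      using pn place_word_lists[OF An n] ring_hom_mult[OF \<phi>[unfolded letterplace_def]]
      by (simp add: skew_mon_append)
    also have "\<dots> = tensor_mon S m ?A \<otimes>\<^bsub>SkewT S m\<^esub> tensor_mon S m ?B"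
      using Suc tensor_hom_place_word[OF \<phi> letters n An] by simp
    also have "\<dots> = [koszul_sign m (mon_tuple S ?A) (mon_tuple S ?B)] \<cdot>\<^bsub>SkewT S m\<^esub> tensor_mon S m (\<lambda>k. ?A k @ ?B k)"
      by (rule tensor_mon_mult[OF fam at_place_lists[OF An]])
    also have "koszul_sign m (mon_tuple S ?A) (mon_tuple S ?B) = 1"
      unfolding koszul_sign_prod by (intro prod.neutral ballI) (auto simp: mon_tuple_def at_place_def)
    also have "tensor_mon S m (\<lambda>k. ?A k @ ?B k) = tensor_mon S m (\<lambda>k. if k \<le> Suc n then A k else [])"
      by (rule tensor_mon_cong) (auto simp: at_place_def le_Suc_eq)
    also have "[(1::int)] \<cdot>\<^bsub>SkewT S m\<^esub> \<dots> = \<dots>"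
      using A by (intro Te.int_mult_1 tensor_mon_closed) (auto simp: Pi_iff)
    finally show ?case .
  qed
  from this[of m] have "\<phi> (skew_mon ?L (places_word m A)) = tensor_mon S m (\<lambda>k. if k \<le> m then A k else [])" by simp
  also have "\<dots> = tensor_mon S m A" by (rule tensor_mon_cong) simp
  finally show ?thesis .
qed

lemma letterplace_to_tensor:
  obtains \<phi> where "\<phi> \<in> Ring.ring_hom (letterplace S m) (SkewT S m)"
    "\<And>x i. x \<in> S \<Longrightarrow> i \<in> {1..m} \<Longrightarrow> \<phi> (lp_gen S m x i) = tensor_mon S m (at_place i [x])"
proof -
  let ?y = "\<lambda>(x, i). tensor_mon S m (at_place i [x])"
  have fam: "at_place k [z] \<in> {1..m} \<rightarrow> lists S" if "z \<in> S" for k z using that by (simp add: at_place_lists)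
  obtain \<phi> where \<phi>: "\<phi> \<in> Ring.ring_hom (Skew (S \<times> {1..m})) (SkewT S m)"
    "\<And>w. w \<in> lists (S \<times> {1..m}) \<Longrightarrow> \<phi> (skew_mon (S \<times> {1..m}) w) = ring_list_prod (SkewT S m) (map ?y w)"
  proof (rule skew_lift[OF Te.ring_axioms])
    show "?y \<in> S \<times> {1..m} \<rightarrow> carrier (SkewT S m)" using fam by auto
    show "?y p \<otimes>\<^bsub>SkewT S m\<^esub> ?y q = \<ominus>\<^bsub>SkewT S m\<^esub> (?y q \<otimes>\<^bsub>SkewT S m\<^esub> ?y p)"
      if "p \<in> S \<times> {1..m}" "q \<in> S \<times> {1..m}" for p q
      using that tensor_letter_anti[of "fst p" S "fst q" "snd p" m "snd q"] by (cases p, cases q) simp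
    show "?y p \<otimes>\<^bsub>SkewT S m\<^esub> ?y p = \<zero>\<^bsub>SkewT S m\<^esub>" if "p \<in> S \<times> {1..m}" for p
      using that tensor_letter_square[of "fst p" S "snd p" m] by (cases p) simp
  qed blast
  show thesis
  proof (rule that[of \<phi>])
    show "\<phi> (lp_gen S m x i) = tensor_mon S m (at_place i [x])" if "x \<in> S" "i \<in> {1..m}" for x i
      using that \<phi>(2)[of "[(x, i)]"] fam[OF that(1)] by (simp add: lp_gen_def)
  qed (use \<phi>(1) in \<open>simp add: letterplace_def\<close>)
qed

lemma place_embeddings:
  obtains \<iota> where "\<And>k. k \<in> {1..m} \<Longrightarrow> \<iota> k \<in> Ring.ring_hom (Skew S) (letterplace S m)"
    "\<And>k w. k \<in> {1..m} \<Longrightarrow> w \<in> lists S \<Longrightarrow> \<iota> k (skew_mon S w) = skew_mon (S \<times> {1..m}) (place_word k w)"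
proof -
  let ?L = "S \<times> {1..m}"
  have "\<exists>\<iota>. \<iota> \<in> Ring.ring_hom (Skew S) (Skew ?L) \<and>
      (\<forall>w\<in>lists S. \<iota> (skew_mon S w) = skew_mon ?L (place_word k w))" if k: "k \<in> {1..m}" for k
  proof -
    let ?y = "\<lambda>x. skew_mon ?L [(x, k)]"
    have xk: "(x, k) \<in> ?L" if "x \<in> S" for x using that k by simp
    obtain \<iota> where \<iota>: "\<iota> \<in> Ring.ring_hom (Skew S) (Skew ?L)"
      "\<And>w. w \<in> lists S \<Longrightarrow> \<iota> (skew_mon S w) = ring_list_prod (Skew ?L) (map ?y w)"
    proof (rule skew_lift[OF Sk.ring_axioms])
      show "?y \<in> S \<rightarrow> carrier (Skew ?L)" using xk by auto
      show "?y x \<otimes>\<^bsub>Skew ?L\<^esub> ?y x' = \<ominus>\<^bsub>Skew ?L\<^esub> (?y x' \<otimes>\<^bsub>Skew ?L\<^esub> ?y x)" if "x \<in> S" "x' \<in> S" for x x'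
        using xk[OF that(1)] xk[OF that(2)] by (intro skew_linear_anti skew_linear.letter)
      show "?y x \<otimes>\<^bsub>Skew ?L\<^esub> ?y x = \<zero>\<^bsub>Skew ?L\<^esub>" if "x \<in> S" for x
        using xk[OF that] skew_mon_square[of "(x, k)" ?L] by (simp flip: skew_mon_append)
    qed blast
    have "\<iota> (skew_mon S w) = skew_mon ?L (place_word k w)" if "w \<in> lists S" for w
      using \<iota>(2)[OF that] skew_mon_list_prod[OF place_word_lists[OF that k]]
      by (simp add: place_word_def comp_def)
    then show ?thesis using \<iota>(1) by blast
  qed
  then have "\<forall>k\<in>{1..m}. \<exists>\<iota>. \<iota> \<in> Ring.ring_hom (Skew S) (Skew ?L) \<and>
      (\<forall>w\<in>lists S. \<iota> (skew_mon S w) = skew_mon ?L (place_word k w))" by blast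
  from bchoice[OF this] obtain \<iota> where "\<forall>k\<in>{1..m}. \<iota> k \<in> Ring.ring_hom (Skew S) (Skew ?L) \<and>
      (\<forall>w\<in>lists S. \<iota> k (skew_mon S w) = skew_mon ?L (place_word k w))" ..
  then show thesis by (intro that[of \<iota>]) (auto simp: letterplace_def)
qed

lemma list_prod_place_words:
  assumes "set ks \<subseteq> {1..m}" "A \<in> {1..m} \<rightarrow> lists S"
  shows "ring_list_prod (Skew (S \<times> {1..m})) (map (\<lambda>k. skew_mon (S \<times> {1..m}) (place_word k (A k))) ks) =
    skew_mon (S \<times> {1..m}) (concat (map (\<lambda>k. place_word k (A k)) ks))"
  using assms(1)
proof (induction ks)
  case (Cons k ks)
  have "concat (map (\<lambda>k. place_word k (A k)) ks) \<in> lists (S \<times> {1..m})"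
    using Cons.prems assms(2) by (intro concat_lists) (auto simp: Pi_iff subset_iff intro!: place_word_lists)
  moreover have "place_word k (A k) \<in> lists (S \<times> {1..m})"
    using Cons.prems assms(2) by (intro place_word_lists) auto
  ultimately show ?case using Cons by (simp add: skew_mon_append)
qed (simp add: skew_mon_Nil)

text \<open>
  The inverse map multiplies the images of the tensor factors in the order of the places. Images
  of homogeneous elements from different places commute up to the sign given by their parities,
  which is the sign in the product of the tensor power, so the map is multiplicative; it respects
  multilinearity because each place embedding is additive.
\<close>

lemma tensor_to_letterplace:
  obtains \<psi> where "\<psi> \<in> Ring.ring_hom (SkewT S m) (letterplace S m)"
    "\<And>A. A \<in> {1..m} \<rightarrow> lists S \<Longrightarrow> \<psi> (tensor_mon S m A) = skew_mon (S \<times> {1..m}) (places_word m A)"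
proof -
  define L where "L = Skew (S \<times> {1..m})"
  interpret L: ring L unfolding L_def by (rule Sk.ring_axioms)
  obtain \<iota> where \<iota>: "\<And>k. k \<in> {1..m} \<Longrightarrow> \<iota> k \<in> Ring.ring_hom (Skew S) L"
    "\<And>k w. k \<in> {1..m} \<Longrightarrow> w \<in> lists S \<Longrightarrow> \<iota> k (skew_mon S w) = skew_mon (S \<times> {1..m}) (place_word k w)"
    using place_embeddings[of m S] unfolding letterplace_def L_def by blast
  note \<iota>_add = ring_hom_add_hom[OF \<iota>(1)]
  have \<iota>_cl: "\<iota> k a \<in> carrier L" if "a \<in> skew_part S e" "k \<in> {1..m}" for a e k
    using ring_hom_closed[OF \<iota>(1)[OF that(2)] skew_part_closed[OF that(1)]] .
  note \<iota>_simps = add_hom_zero[OF Sk.ring_axioms L.ring_axioms \<iota>_add]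
    add_hom_neg[OF Sk.ring_axioms L.ring_axioms \<iota>_add] add_hom_add[OF \<iota>_add]
  have commute: "\<iota> k a \<otimes>\<^bsub>L\<^esub> \<iota> l b = [(if e \<and> e' then -1 else 1::int)] \<cdot>\<^bsub>L\<^esub> (\<iota> l b \<otimes>\<^bsub>L\<^esub> \<iota> k a)"
    if k: "k \<in> {1..m}" and l: "l \<in> {1..m}" and a: "a \<in> skew_part S e" and b: "b \<in> skew_part S e'" for k l a b e e'
    using a
  proof (induction a rule: skew_part_induct)
    case (mon u)
    show ?case using b
    proof (induction b rule: skew_part_induct)
      case (mon v)
      have "skew_mon (S \<times> {1..m}) (place_word k u @ place_word l v) =
          [((-1::int) ^ (length u * length v))] \<cdot>\<^bsub>L\<^esub> skew_mon (S \<times> {1..m}) (place_word l v @ place_word k u)"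
        using skew_mon_commute[of "place_word k u" "S \<times> {1..m}" "place_word l v" "[]" "[]"]
          \<open>u \<in> lists S\<close> mon k l by (simp add: L_def)
      moreover have "(-1::int) ^ (length u * length v) = (if e \<and> e' then -1 else 1)"
        using mon \<open>odd (length u) = e\<close> by auto
      ultimately show ?case
        using \<open>u \<in> lists S\<close> mon k l by (simp add: \<iota>(2) L_def skew_mon_append)
    qed (use \<iota>_cl[OF skew_part_mon[OF mon] k] in \<open>simp_all add: \<iota>_simps[OF l] L.l_distr L.r_distr L.l_minus L.r_minus
          \<iota>_cl[OF _ l] skew_part_closed L.int_mult_add_right L.int_mult_minus_right\<close>)
  qed (use \<iota>_cl[OF b l] in \<open>simp_all add: \<iota>_simps[OF k] L.l_distr L.r_distr L.l_minus L.r_minus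
          \<iota>_cl[OF _ k] skew_part_closed L.int_mult_add_right L.int_mult_minus_right\<close>)
  \<comment> \<open>Products over the first \<open>n\<close> places, for an induction that adds one place at a time.\<close>
  define G where "G n t = ring_list_prod L (map (\<lambda>k. \<iota> k (fst (t k))) [1..<Suc n])"
    for n and t :: "nat \<Rightarrow> 'a skew_elem \<times> bool"
  have part: "fst (t k) \<in> skew_part S (snd (t k))" if "t \<in> tuples S m" "k \<in> {1..m}" for t k
    using that by (simp add: tuples_iff)
  have factor: "\<iota> k (fst (t k)) \<in> carrier L" if "t \<in> tuples S m" "k \<in> {1..m}" for t k
    using \<iota>_cl[OF part[OF that] that(2)] .
  have factors: "set (map (\<lambda>k. \<iota> k (fst (t k))) ks) \<subseteq> carrier L"
    if "t \<in> tuples S m" "set ks \<subseteq> {1..m}" for t ks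
    using factor[OF that(1)] that(2) by auto
  have G_cl: "G n t \<in> carrier L" if "t \<in> tuples S m" "n \<le> m" for n t
    unfolding G_def using that by (intro L.list_prod_closed factors) auto
  have G_Suc: "G (Suc n) t = G n t \<otimes>\<^bsub>L\<^esub> \<iota> (Suc n) (fst (t (Suc n)))" if "t \<in> tuples S m" "Suc n \<le> m" for n t
  proof -
    have "Suc n \<in> {1..m}" "set [1..<Suc n] \<subseteq> {1..m}" using that by auto
    moreover have "[1..<Suc (Suc n)] = [1..<Suc n] @ [Suc n]" by (simp add: upt_Suc)
    ultimately show ?thesis
      unfolding G_def using factors[OF that(1), of "[1..<Suc n]"] factor[OF that(1), of "Suc n"]
      by (simp)
  qed
  have G_commute: "\<iota> k a \<otimes>\<^bsub>L\<^esub> G n t =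
      [(\<Prod>l\<in>{1..n}. if e \<and> snd (t l) then -1 else 1::int)] \<cdot>\<^bsub>L\<^esub> (G n t \<otimes>\<^bsub>L\<^esub> \<iota> k a)"
    if t: "t \<in> tuples S m" and k: "k \<in> {1..m}" and a: "a \<in> skew_part S e" and "n \<le> m" for n t k a e
    using \<open>n \<le> m\<close>
  proof (induction n)
    case 0
    then show ?case using \<iota>_cl[OF a k] by (simp add: G_def)
  next
    case (Suc n)
    have n: "Suc n \<in> {1..m}" using Suc.prems by simp
    let ?c = "\<Prod>l\<in>{1..n}. if e \<and> snd (t l) then -1 else (1::int)" and ?d = "if e \<and> snd (t (Suc n)) then -1 else (1::int)"
    let ?s = "\<iota> (Suc n) (fst (t (Suc n)))"
    note cl = \<iota>_cl[OF a k] G_cl[OF t, of n] factor[OF t n]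
    have "\<iota> k a \<otimes>\<^bsub>L\<^esub> G (Suc n) t = (\<iota> k a \<otimes>\<^bsub>L\<^esub> G n t) \<otimes>\<^bsub>L\<^esub> ?s"
      using cl Suc.prems by (simp add: G_Suc[OF t] L.m_assoc)
    also have "\<dots> = [?c] \<cdot>\<^bsub>L\<^esub> (G n t \<otimes>\<^bsub>L\<^esub> (\<iota> k a \<otimes>\<^bsub>L\<^esub> ?s))"
      using cl Suc by (simp add: L.add_pow_ldistr_int L.m_assoc)
    also have "\<iota> k a \<otimes>\<^bsub>L\<^esub> ?s = [?d] \<cdot>\<^bsub>L\<^esub> (?s \<otimes>\<^bsub>L\<^esub> \<iota> k a)" by (rule commute[OF k n a part[OF t n]])
    also have "[?c] \<cdot>\<^bsub>L\<^esub> (G n t \<otimes>\<^bsub>L\<^esub> ([?d] \<cdot>\<^bsub>L\<^esub> (?s \<otimes>\<^bsub>L\<^esub> \<iota> k a))) = [(?c * ?d)] \<cdot>\<^bsub>L\<^esub> (G (Suc n) t \<otimes>\<^bsub>L\<^esub> \<iota> k a)"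
      using cl Suc.prems by (simp only: G_Suc[OF t] L.add_pow_rdistr_int L.m_assoc L.m_closed L.int_mult_int_mult Suc_leD)
    also have "?c * ?d = (\<Prod>l\<in>{1..Suc n}. if e \<and> snd (t l) then -1 else 1::int)"
      by (subst prod.nat_ivl_Suc') (auto simp: mult.commute)
    finally show ?case .
  qed
  have G_mult: "G n s \<otimes>\<^bsub>L\<^esub> G n t = [koszul_sign n s t] \<cdot>\<^bsub>L\<^esub> G n (tuple_mult S m s t)"
    if s: "s \<in> tuples S m" and t: "t \<in> tuples S m" and "n \<le> m" for n s t
    using \<open>n \<le> m\<close>
  proof (induction n)
    case 0
    then show ?case by (simp add: G_def koszul_sign_prod)
  next
    case (Suc n)
    have n: "Suc n \<in> {1..m}" "n \<le> m" using Suc.prems by simp_all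
    let ?st = "tuple_mult S m s t"
    have st: "?st \<in> tuples S m" by (rule tuple_mult_closed[OF s t])
    let ?s = "\<iota> (Suc n) (fst (s (Suc n)))" and ?t = "\<iota> (Suc n) (fst (t (Suc n)))"
    let ?c = "\<Prod>l\<in>{1..n}. if snd (s (Suc n)) \<and> snd (t l) then -1 else (1::int)"
    note cl = G_cl[OF s n(2)] G_cl[OF t n(2)] G_cl[OF st n(2)] factor[OF s n(1)] factor[OF t n(1)]
    have "G (Suc n) s \<otimes>\<^bsub>L\<^esub> G (Suc n) t = G n s \<otimes>\<^bsub>L\<^esub> ((?s \<otimes>\<^bsub>L\<^esub> G n t) \<otimes>\<^bsub>L\<^esub> ?t)"
      using cl Suc.prems by (simp add: G_Suc s t L.m_assoc)
    also have "?s \<otimes>\<^bsub>L\<^esub> G n t = [?c] \<cdot>\<^bsub>L\<^esub> (G n t \<otimes>\<^bsub>L\<^esub> ?s)"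
      by (rule G_commute[OF t n(1) part[OF s n(1)] n(2)])
    also have "G n s \<otimes>\<^bsub>L\<^esub> ([?c] \<cdot>\<^bsub>L\<^esub> (G n t \<otimes>\<^bsub>L\<^esub> ?s) \<otimes>\<^bsub>L\<^esub> ?t) =
        [?c] \<cdot>\<^bsub>L\<^esub> ((G n s \<otimes>\<^bsub>L\<^esub> G n t) \<otimes>\<^bsub>L\<^esub> (?s \<otimes>\<^bsub>L\<^esub> ?t))"
      using cl by (simp add: L.add_pow_ldistr_int L.add_pow_rdistr_int L.m_assoc)
    also have "?s \<otimes>\<^bsub>L\<^esub> ?t = \<iota> (Suc n) (fst (?st (Suc n)))"
      using n part[OF s n(1)] part[OF t n(1)] skew_part_closed
      by (subst ring_hom_mult[OF \<iota>(1)[OF n(1)], symmetric]) (auto simp: tuple_mult_def)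
    also have "G n s \<otimes>\<^bsub>L\<^esub> G n t = [koszul_sign n s t] \<cdot>\<^bsub>L\<^esub> G n ?st" by (rule Suc.IH[OF n(2)])
    also have "[?c] \<cdot>\<^bsub>L\<^esub> ([koszul_sign n s t] \<cdot>\<^bsub>L\<^esub> G n ?st \<otimes>\<^bsub>L\<^esub> \<iota> (Suc n) (fst (?st (Suc n)))) =
        [koszul_sign (Suc n) s t] \<cdot>\<^bsub>L\<^esub> G (Suc n) ?st"
      unfolding koszul_sign_Suc using cl factor[OF st n(1)] Suc.prems
      by (simp add: G_Suc[OF st] L.add_pow_ldistr_int mult.commute)
    finally show ?case .
  qed
  have hom: "lin_ext L (G m) \<in> Ring.ring_hom (tuple_algebra S m) L"
  proof (rule TA.lin_ext_ring_hom[OF L.ring_axioms])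
    show "G m \<in> tuples S m \<rightarrow> carrier L" using G_cl by blast
    have "set ks \<subseteq> {1..m} \<Longrightarrow> ring_list_prod L (map (\<lambda>k. \<iota> k (fst ((\<lambda>k\<in>{1..m}. (\<one>\<^bsub>Skew S\<^esub>, False)) k))) ks) = \<one>\<^bsub>L\<^esub>" for ks
      by (induction ks) (simp_all add: ring_hom_one[OF \<iota>(1)])
    from this[of "[1..<Suc m]"]
    show "G m (\<lambda>k\<in>{1..m}. (\<one>\<^bsub>Skew S\<^esub>, False)) = \<one>\<^bsub>L\<^esub>"
      unfolding G_def by (simp add: atLeastLessThanSuc_atLeastAtMost)
  qed (use G_mult in simp)
  have val: "lin_ext L (G m) (frag_of t) = G m t" if "t \<in> tuples S m" for t
    by (rule L.lin_ext_frag_of) (rule G_cl[OF that order_refl])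
  have van: "lin_ext L (G m) x = \<zero>\<^bsub>L\<^esub>" if "x \<in> tuple_ideal S m" for x
  proof (rule ring_hom_vanish_Idl[OF TA.ring_A L.ring_axioms hom tuple_gens_subset _ that[unfolded multilinear_ideal_def]])
    fix x assume "x \<in> {frag_of (t(k := (a \<oplus>\<^bsub>Skew S\<^esub> b, e))) - frag_of (t(k := (a, e))) - frag_of (t(k := (b, e)))
        | t k a b e. t \<in> tuples S m \<and> k \<in> {1..m} \<and> a \<in> skew_part S e \<and> b \<in> skew_part S e}"
    then obtain t k a b e where x: "x = frag_of (t(k := (a \<oplus>\<^bsub>Skew S\<^esub> b, e))) - frag_of (t(k := (a, e))) - frag_of (t(k := (b, e)))"
      and t: "t \<in> tuples S m" and k: "k \<in> {1..m}" and a: "a \<in> skew_part S e" and b: "b \<in> skew_part S e" by blast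
    note ab = skew_part_add[OF a b]
    note cl = tuple_upd_closed[OF t k]
    let ?t = "\<lambda>a. t(k := (a, e))"
    have split: "[1..<Suc m] = [1..<k] @ k # [Suc k..<Suc m]"
      using k upt_add_eq_append[of 1 k "Suc m - k"] upt_conv_Cons[of k "Suc m"] by simp
    let ?u = "ring_list_prod L (map (\<lambda>k. \<iota> k (fst (t k))) [1..<k])"
    let ?v = "ring_list_prod L (map (\<lambda>k. \<iota> k (fst (t k))) [Suc k..<Suc m])"
    have uv: "?u \<in> carrier L" "?v \<in> carrier L" using k by (auto intro!: L.list_prod_closed factors[OF t])
    have G_upd: "G m (?t a) = ?u \<otimes>\<^bsub>L\<^esub> (\<iota> k a \<otimes>\<^bsub>L\<^esub> ?v)" if a: "a \<in> skew_part S e" for a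
    proof -
      have 1: "map (\<lambda>j. \<iota> j (fst (?t a j))) [1..<k] = map (\<lambda>k. \<iota> k (fst (t k))) [1..<k]"
        "map (\<lambda>j. \<iota> j (fst (?t a j))) [Suc k..<Suc m] = map (\<lambda>k. \<iota> k (fst (t k))) [Suc k..<Suc m]"
        by auto
      have "set (map (\<lambda>k. \<iota> k (fst (t k))) [1..<k]) \<subseteq> carrier L"
        "set (map (\<lambda>k. \<iota> k (fst (t k))) [Suc k..<Suc m]) \<subseteq> carrier L"
        using k by (auto intro!: factor[OF t])
      then show ?thesis unfolding G_def split map_append list.map 1
        using \<iota>_cl[OF a k] by (subst L.list_prod_append) auto
    qed
    have "G m (?t (a \<oplus>\<^bsub>Skew S\<^esub> b)) = G m (?t a) \<oplus>\<^bsub>L\<^esub> G m (?t b)"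
      using uv \<iota>_cl[OF a k] \<iota>_cl[OF b k] a b
      by (simp add: G_upd ab \<iota>_simps[OF k] skew_part_closed L.l_distr L.r_distr)
    moreover have "x = (frag_of (?t (a \<oplus>\<^bsub>Skew S\<^esub> b)) \<ominus>\<^bsub>tuple_algebra S m\<^esub> frag_of (?t a)) \<ominus>\<^bsub>tuple_algebra S m\<^esub> frag_of (?t b)"
      using cl[OF a] cl[OF b] cl[OF ab] TA.A.minus_closed[of "frag_of (?t (a \<oplus>\<^bsub>Skew S\<^esub> b))" S m "frag_of (?t a)"]
      unfolding x by (simp add: TA.minus_A)
    moreover have "(G m (?t a) \<oplus>\<^bsub>L\<^esub> G m (?t b)) \<oplus>\<^bsub>L\<^esub> \<ominus>\<^bsub>L\<^esub> G m (?t a) \<oplus>\<^bsub>L\<^esub> \<ominus>\<^bsub>L\<^esub> G m (?t b) = \<zero>\<^bsub>L\<^esub>"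
      using G_cl[OF cl[OF a] order_refl] G_cl[OF cl[OF b] order_refl] by algebra
    ultimately show "lin_ext L (G m) x = \<zero>\<^bsub>L\<^esub>"
      using cl[OF a] cl[OF b] cl[OF ab]
      by (simp add: a_minus_def ring_hom_add[OF hom] val
          add_hom_neg[OF TA.ring_A L.ring_axioms ring_hom_add_hom[OF hom]])
  qed
  obtain \<psi> where \<psi>: "\<psi> \<in> Ring.ring_hom (SkewT S m) L"
    "\<And>x. x \<in> carrier (tuple_algebra S m) \<Longrightarrow> \<psi> (tuple_ideal S m +>\<^bsub>tuple_algebra S m\<^esub> x) = lin_ext L (G m) x"
    using quot_lift_ring_hom[OF ideal_tuple_ideal L.ring_axioms hom van] unfolding SkewT_def graded_tensor_power_def by blast
  show thesis
  proof (rule that[of \<psi>])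
    fix A assume A: "A \<in> {1..m} \<rightarrow> lists S"
    let ?t = "restrict (mon_tuple S A) {1..m}"
    have t: "?t \<in> tuples S m" by (rule family_restrict[OF family_mon[OF A]])
    have "\<psi> (tensor_mon S m A) = G m ?t"
      unfolding tensor_mon_pure pure_eq by (simp add: \<psi>(2) val t)
    also have "\<dots> = ring_list_prod L (map (\<lambda>k. skew_mon (S \<times> {1..m}) (place_word k (A k))) [1..<Suc m])"
      unfolding G_def using A by (intro arg_cong[where f = "ring_list_prod L"] map_cong refl)
        (auto simp: mon_tuple_def \<iota>(2) Pi_iff)
    also have "\<dots> = skew_mon (S \<times> {1..m}) (places_word m A)"
      using list_prod_place_words[of "[1..<Suc m]" m A S] A
      by (simp add: L_def places_word_def atLeastLessThanSuc_atLeastAtMost)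
    finally show "\<psi> (tensor_mon S m A) = skew_mon (S \<times> {1..m}) (places_word m A)" .
  qed (use \<psi>(1) in \<open>simp add: letterplace_def L_def\<close>)
qed

section \<open>Slices as sums over placements\<close>

context ring
begin

lemma list_prod_move:
  assumes c: "c \<in> carrier R" and vs: "set vs \<subseteq> carrier R" and anti: "\<And>v. v \<in> set vs \<Longrightarrow> c \<otimes> v = \<ominus> (v \<otimes> c)"
  shows "c \<otimes> ring_list_prod R vs = [((-1::int) ^ length vs)] \<cdot> (ring_list_prod R vs \<otimes> c)"
  using vs anti
proof (induction vs)
  case (Cons v vs)
  let ?p = "ring_list_prod R vs"
  have cl: "v \<in> carrier R" "?p \<in> carrier R" using Cons.prems by auto
  have "c \<otimes> (v \<otimes> ?p) = (c \<otimes> v) \<otimes> ?p" using c cl by (simp add: m_assoc)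
  also have "\<dots> = \<ominus> (v \<otimes> (c \<otimes> ?p))" using c cl Cons.prems(2)[of v] by (simp add: l_minus m_assoc)
  also have "\<dots> = \<ominus> (v \<otimes> [((-1::int) ^ length vs)] \<cdot> (?p \<otimes> c))" using Cons by simp
  also have "\<dots> = [((-1::int) ^ length (v # vs))] \<cdot> ((v \<otimes> ?p) \<otimes> c)"
    using c cl by (simp add: add_pow_rdistr_int int_mult_neg m_assoc)
  finally show ?case by simp
qed (use c in simp)

text \<open>
  Both \<open>a\<close> and \<open>b\<close> pass the block \<open>vs\<close>, so these two signs cancel and only the exchange of
  \<open>a\<close> with \<open>b\<close> counts.
\<close>

lemma list_prod_swap:
  assumes "set (us @ a # vs @ b # ws) \<subseteq> carrier R"
    and anti: "\<And>c d. c \<in> set (a # b # vs) \<Longrightarrow> d \<in> set (a # b # vs) \<Longrightarrow> c \<otimes> d = \<ominus> (d \<otimes> c)"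
  shows "ring_list_prod R (us @ b # vs @ a # ws) = \<ominus> ring_list_prod R (us @ a # vs @ b # ws)"
proof -
  let ?u = "ring_list_prod R us" and ?v = "ring_list_prod R vs" and ?w = "ring_list_prod R ws"
  let ?s = "(-1::int) ^ length vs"
  have cl: "?u \<in> carrier R" "?v \<in> carrier R" "?w \<in> carrier R" "a \<in> carrier R" "b \<in> carrier R"
    using assms(1) by auto
  have move: "c \<otimes> ?v = [?s] \<cdot> (?v \<otimes> c)" if "c \<in> {a, b}" for c
    by (rule list_prod_move) (use that assms in auto)
  have shift: "c \<otimes> (?v \<otimes> (d \<otimes> ?w)) = [?s] \<cdot> (?v \<otimes> ((c \<otimes> d) \<otimes> ?w))"
    if "c \<in> {a, b}" "d \<in> {a, b}" for c d
  proof -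
    have cd: "c \<in> carrier R" "d \<in> carrier R" using that cl by auto
    have "c \<otimes> (?v \<otimes> (d \<otimes> ?w)) = (c \<otimes> ?v) \<otimes> (d \<otimes> ?w)" using cd cl by (simp add: m_assoc)
    also have "\<dots> = [?s] \<cdot> (?v \<otimes> ((c \<otimes> d) \<otimes> ?w))"
      unfolding move[OF that(1)] using cd cl by (simp add: add_pow_ldistr_int m_assoc)
    finally show ?thesis .
  qed
  have "b \<otimes> (?v \<otimes> (a \<otimes> ?w)) = [?s] \<cdot> (?v \<otimes> ((\<ominus> (a \<otimes> b)) \<otimes> ?w))"
    using shift[of b a] anti[of b a] by simp
  also have "\<dots> = \<ominus> (a \<otimes> (?v \<otimes> (b \<otimes> ?w)))"
    using shift[of a b] cl by (simp add: l_minus r_minus int_mult_minus_right)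
  finally show ?thesis using assms(1) cl by (simp add: r_minus)
qed

lemma list_prod_transpose:
  assumes z: "\<And>s. s < p \<Longrightarrow> z s \<in> carrier R" and anti: "\<And>s t. s < p \<Longrightarrow> t < p \<Longrightarrow> z s \<otimes> z t = \<ominus> (z t \<otimes> z s)"
    and ab: "a < p" "b < p" "a \<noteq> b"
  shows "ring_list_prod R (map (z \<circ> transpose a b) [0..<p]) = \<ominus> ring_list_prod R (map z [0..<p])"
proof -
  have *: "ring_list_prod R (map (z \<circ> transpose a b) [0..<p]) = \<ominus> ring_list_prod R (map z [0..<p])"
    if ab: "a < b" "b < p" for a b
  proof -
    have split: "[0..<p] = [0..<a] @ a # [Suc a..<b] @ b # [Suc b..<p]"
      using that upt_add_eq_append[of 0 a "p - a"] upt_conv_Cons[of a p] upt_add_eq_append[of "Suc a" b "p - b"]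
        upt_conv_Cons[of b p] by simp
    have 1: "map (z \<circ> transpose a b) [0..<p] = map z [0..<a] @ z b # map z [Suc a..<b] @ z a # map z [Suc b..<p]"
      unfolding split using ab by (auto simp: transpose_def)
    have 2: "map z [0..<p] = map z [0..<a] @ z a # map z [Suc a..<b] @ z b # map z [Suc b..<p]"
      unfolding split by simp
    have img: "set (map z [0..<p]) = z ` {..<p}" by auto
    show ?thesis unfolding 1 2
    proof (rule list_prod_swap)
      show "set (map z [0..<a] @ z a # map z [Suc a..<b] @ z b # map z [Suc b..<p]) \<subseteq> carrier R"
        unfolding 2[symmetric] using z by auto
      fix c d assume "c \<in> set (z a # z b # map z [Suc a..<b])" "d \<in> set (z a # z b # map z [Suc a..<b])"
      then have "c \<in> set (map z [0..<p])" "d \<in> set (map z [0..<p])" unfolding 2 by auto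
      then obtain s t where "s < p" "c = z s" "t < p" "d = z t" unfolding img by blast
      then show "c \<otimes> d = \<ominus> (d \<otimes> c)" using anti by blast
    qed
  qed
  show ?thesis
  proof (cases "a < b")
    case True
    then show ?thesis using * ab by blast
  next
    case False
    then show ?thesis using *[of b a] ab by (simp add: transpose_commute)
  qed
qed

lemma list_prod_permute:
  assumes "\<pi> permutes {..<p}" and "\<And>s. s < p \<Longrightarrow> z s \<in> carrier R"
    and "\<And>s t. s < p \<Longrightarrow> t < p \<Longrightarrow> z s \<otimes> z t = \<ominus> (z t \<otimes> z s)"
  shows "ring_list_prod R (map (z \<circ> \<pi>) [0..<p]) = [sign \<pi>] \<cdot> ring_list_prod R (map z [0..<p])"
  using assms(1) finite_lessThan[of p] assms(2,3)
proof (induction \<pi> arbitrary: z rule: permutes_induct)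
  case id
  have "set (map z [0..<p]) \<subseteq> carrier R" using id by auto
  then show ?case by simp
next
  case (swap a b \<pi>)
  have \<tau>: "transpose a b permutes {..<p}" using swap.hyps by (intro permutes_swap_id) auto
  have in_p: "transpose a b s < p" if "s < p" for s using permutes_in_image[OF \<tau>, of s] that by simp
  have cl: "set (map z [0..<p]) \<subseteq> carrier R" using swap.prems by auto
  have "ring_list_prod R (map ((z \<circ> transpose a b) \<circ> \<pi>) [0..<p]) =
      [sign \<pi>] \<cdot> ring_list_prod R (map (z \<circ> transpose a b) [0..<p])"
  proof (rule swap.IH)
    show "(z \<circ> transpose a b) s \<in> carrier R" if "s < p" for s
      unfolding comp_def by (rule swap.prems(1)[OF in_p[OF that]])
    show "(z \<circ> transpose a b) s \<otimes> (z \<circ> transpose a b) t = \<ominus> ((z \<circ> transpose a b) t \<otimes> (z \<circ> transpose a b) s)"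
      if "s < p" "t < p" for s t
      unfolding comp_def by (rule swap.prems(2)[OF in_p[OF that(1)] in_p[OF that(2)]])
  qed
  also have "ring_list_prod R (map (z \<circ> transpose a b) [0..<p]) = \<ominus> ring_list_prod R (map z [0..<p])"
    using swap.hyps by (intro list_prod_transpose swap.prems) auto
  finally have "ring_list_prod R (map (z \<circ> (transpose a b \<circ> \<pi>)) [0..<p]) = [(- sign \<pi>)] \<cdot> ring_list_prod R (map z [0..<p])"
    using cl by (simp only: int_mult_minus_right int_mult_neg comp_assoc list_prod_closed)
  moreover have "sign (transpose a b \<circ> \<pi>) = - sign \<pi>"
    using sign_compose[OF permutes_imp_permutation[OF _ \<tau>] permutes_imp_permutation[OF _ \<open>\<pi> permutes {..<p}\<close>]]
      swap.hyps by (simp add: sign_swap_id)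
  ultimately show ?case by (simp only:)
qed

end

lemma nths_eq_map_sorted_list:
  assumes "A \<subseteq> {..<length w}"
  shows "nths w A = map ((!) w) (sorted_list_of_set A)"
proof -
  have upt: "nths [0..<n] A = filter (\<lambda>i. i \<in> A) [0..<n]" for n
    by (induction n) (simp_all add: nths_append upt_Suc)
  have "sorted_list_of_set A = nths [0..<length w] A"
    unfolding upt using assms finite_subset[OF assms]
    by (intro sorted_distinct_set_unique) (auto simp: sorted_wrt_filter)
  then show ?thesis using nths_map[of "(!) w" "[0..<length w]" A] by (simp add: map_nth)
qed

text \<open>
  An ordered partition of the positions of a word, recorded as the list of places assigned to the
  positions. In this form partitions can be built along the word.
\<close>

definition placements :: "nat \<Rightarrow> (nat \<Rightarrow> nat) \<Rightarrow> nat \<Rightarrow> nat list set" where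
  "placements m P p = {ks. length ks = p \<and> set ks \<subseteq> {1..m} \<and> (\<forall>k\<in>{1..m}. count_list ks k = P k)}"

lemma
  assumes "ks \<in> placements m P p"
  shows placements_length: "length ks = p"
    and placements_nth: "s < p \<Longrightarrow> ks ! s \<in> {1..m}"
    and placements_count: "k \<in> {1..m} \<Longrightarrow> count_list ks k = P k"
proof -
  show len: "length ks = p" using assms by (simp add: placements_def)
  show "ks ! s \<in> {1..m}" if "s < p"
  proof -
    have "ks ! s \<in> set ks" using that len by simp
    moreover have "set ks \<subseteq> {1..m}" using assms by (simp add: placements_def)
    ultimately show ?thesis by blast
  qed
  show "count_list ks k = P k" if "k \<in> {1..m}" using assms that by (simp add: placements_def)
qed

definition blocks :: "nat \<Rightarrow> nat list \<Rightarrow> nat \<Rightarrow> nat set" where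
  "blocks m ks = (\<lambda>k\<in>{1..m}. {s. s < length ks \<and> ks ! s = k})"

lemma finite_placements: "finite (placements m P p)"
  by (rule finite_subset[OF _ finite_lists_length_eq[of "{1..m}" p]]) (auto simp: placements_def)

lemma blocks_bij: "bij_betw (blocks m) (placements m P p) (ordered_partitions m P p)"
proof (rule bij_betwI')
  fix ks ks' assume ks: "ks \<in> placements m P p" and ks': "ks' \<in> placements m P p"
  show "blocks m ks = blocks m ks' \<longleftrightarrow> ks = ks'"
  proof
    assume eq: "blocks m ks = blocks m ks'"
    show "ks = ks'"
    proof (rule nth_equalityI)
      fix s assume s: "s < length ks"
      then have k: "ks ! s \<in> {1..m}" using placements_nth[OF ks] placements_length[OF ks] s by simp
      then have "s \<in> blocks m ks (ks ! s)" using s by (simp add: blocks_def)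
      then show "ks ! s = ks' ! s" using k unfolding eq by (simp add: blocks_def)
    qed (use ks ks' in \<open>auto simp: placements_def\<close>)
  qed simp
next
  fix ks assume ks: "ks \<in> placements m P p"
  have len: "length ks = p" using ks by (simp add: placements_def)
  have "ks ! s \<in> {1..m}" if "s < p" for s by (rule placements_nth[OF ks that])
  moreover from this have "s \<in> blocks m ks (ks ! s)" if "s < p" for s
    using that len by (simp add: blocks_def)
  moreover have "card (blocks m ks k) = P k" if "k \<in> {1..m}" for k
  proof -
    have "{s. s < length ks \<and> ks ! s = k} = {s. s < length ks \<and> k = ks ! s}" by auto
    then have "card (blocks m ks k) = count_list ks k"
      using that by (simp add: blocks_def count_list_eq_length_filter length_filter_conv_card)
    then show ?thesis using placements_count[OF ks that] by simp
  qed
  moreover have "blocks m ks k \<subseteq> {..<p}" if "k \<in> {1..m}" for k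
    using that ks by (auto simp: placements_def blocks_def)
  moreover have "disjoint_family_on (blocks m ks) {1..m}" by (auto simp: disjoint_family_on_def blocks_def)
  moreover have "blocks m ks \<in> extensional {1..m}" by (auto simp: blocks_def)
  ultimately show "blocks m ks \<in> ordered_partitions m P p"
    unfolding ordered_partitions_def PiE_def by blast
next
  fix I assume I: "I \<in> ordered_partitions m P p"
  have disj: "k = l" if "s \<in> I k" "s \<in> I l" "k \<in> {1..m}" "l \<in> {1..m}" for s k l
    using that I unfolding ordered_partitions_def disjoint_family_on_def by blast
  have sub: "I k \<subseteq> {..<p}" if "k \<in> {1..m}" for k using that I by (auto simp: ordered_partitions_def)
  have "\<exists>k. k \<in> {1..m} \<and> s \<in> I k" if "s < p" for s
    using that I unfolding ordered_partitions_def by blast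
  then have "\<forall>s\<in>{..<p}. \<exists>k. k \<in> {1..m} \<and> s \<in> I k" by blast
  from bchoice[OF this] obtain \<kappa> where \<kappa>: "\<forall>s\<in>{..<p}. \<kappa> s \<in> {1..m} \<and> s \<in> I (\<kappa> s)" ..
  let ?ks = "map \<kappa> [0..<p]"
  have eq: "I k = {s. s < p \<and> \<kappa> s = k}" if k: "k \<in> {1..m}" for k
  proof safe
    fix s assume s: "s \<in> I k"
    then show "s < p" using sub[OF k] by auto
    then show "\<kappa> s = k" using disj[OF _ s _ k, of "\<kappa> s"] \<kappa> by auto
  qed (use \<kappa> in auto)
  have ext: "I \<in> extensional {1..m}" and card: "\<And>k. k \<in> {1..m} \<Longrightarrow> card (I k) = P k"
    using I by (auto simp: ordered_partitions_def PiE_def)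
  have "count_list ?ks k = P k" if "k \<in> {1..m}" for k
  proof -
    have "{i. i < p \<and> k = ?ks ! i} = {s. s < p \<and> \<kappa> s = k}" by auto
    then have "{i. i < p \<and> k = ?ks ! i} = I k" by (simp only: eq[OF that])
    then show ?thesis using card[OF that] by (simp add: count_list_eq_length_filter length_filter_conv_card)
  qed
  moreover have "set ?ks \<subseteq> {1..m}" using \<kappa> by (simp add: image_subset_iff)
  ultimately have "?ks \<in> placements m P p" by (simp add: placements_def)
  moreover have "I = blocks m ?ks"
  proof (rule extensionalityI[OF ext])
    show "I k = blocks m ?ks k" if "k \<in> {1..m}" for k
    proof -
      have "blocks m ?ks k = {s. s < p \<and> ?ks ! s = k}" using that by (simp add: blocks_def)
      also have "\<dots> = {s. s < p \<and> \<kappa> s = k}" by auto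
      finally show ?thesis by (simp only: eq[OF that])
    qed
  qed (simp add: blocks_def)
  ultimately show "\<exists>ks\<in>placements m P p. I = blocks m ks" by (rule rev_bexI)
qed

definition placed_prod :: "('r, 'c) ring_scheme \<Rightarrow> ('b \<Rightarrow> nat \<Rightarrow> 'r) \<Rightarrow> 'b list \<Rightarrow> nat list \<Rightarrow> 'r" where
  "placed_prod R g w ks = ring_list_prod R (map (\<lambda>s. g (w ! s) (ks ! s)) [0..<length w])"

text \<open>
  The sum of \<open>placed_prod\<close> over all placements, arranged as a recursion: the first letter takes
  one of the places that are still available.
\<close>

primrec placement_sum :: "('r, 'c) ring_scheme \<Rightarrow> ('b \<Rightarrow> nat \<Rightarrow> 'r) \<Rightarrow> nat \<Rightarrow> (nat \<Rightarrow> nat) \<Rightarrow> 'b list \<Rightarrow> 'r" where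
  "placement_sum R g m P [] = (if \<forall>k\<in>{1..m}. P k = 0 then \<one>\<^bsub>R\<^esub> else \<zero>\<^bsub>R\<^esub>)"
| "placement_sum R g m P (x # w) =
    (\<Oplus>\<^bsub>R\<^esub>k\<in>{1..m}. if P k = 0 then \<zero>\<^bsub>R\<^esub> else g x k \<otimes>\<^bsub>R\<^esub> placement_sum R g m (P(k := P k - 1)) w)"

context ring
begin

text \<open>Sorting the factors of a placed word by places costs exactly the sign of the slice.\<close>

lemma sign_slice:
  assumes g: "\<And>x k. x \<in> set w \<Longrightarrow> k \<in> {1..m} \<Longrightarrow> g x k \<in> carrier R"
    and anti: "\<And>x y k l. x \<in> set w \<Longrightarrow> y \<in> set w \<Longrightarrow> k \<in> {1..m} \<Longrightarrow> l \<in> {1..m} \<Longrightarrow>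
      g x k \<otimes> g y l = \<ominus> (g y l \<otimes> g x k)"
    and ks: "ks \<in> placements m P (length w)"
  shows "[sign (partition_perm m (length w) (blocks m ks))] \<cdot>
      ring_list_prod R (map (\<lambda>k. ring_list_prod R (map (\<lambda>y. g y k) (nths w (blocks m ks k)))) [1..<Suc m]) =
    placed_prod R g w ks"
proof -
  let ?p = "length w" and ?I = "blocks m ks"
  define z where "z s = g (w ! s) (ks ! s)" for s
  define L where "L = concat (map (\<lambda>k. sorted_list_of_set (?I k)) [1..<Suc m])"
  let ?\<pi> = "partition_perm m ?p ?I"
  have len: "length ks = ?p" using ks by (simp add: placements_def)
  have in_m: "ks ! s \<in> {1..m}" if "s < ?p" for s by (rule placements_nth[OF ks that])
  have z: "z s \<in> carrier R" if "s < ?p" for s unfolding z_def using that in_m by (intro g) auto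
  have z_anti: "z s \<otimes> z t = \<ominus> (z t \<otimes> z s)" if "s < ?p" "t < ?p" for s t
    unfolding z_def using that in_m by (intro anti) auto
  have fin: "finite (?I k)" if "k \<in> {1..m}" for k using that by (simp add: blocks_def)
  have set_I: "set (sorted_list_of_set (?I k)) = ?I k" if "k \<in> {1..m}" for k using fin[OF that] by simp
  have set_L: "set L = {..<?p}"
  proof -
    have "set L = (\<Union>k\<in>{1..m}. ?I k)"
      by (auto simp: L_def set_I atLeastLessThanSuc_atLeastAtMost)
    also have "\<dots> = {..<?p}" using in_m len by (auto simp: blocks_def)
    finally show ?thesis .
  qed
  have "distinct (concat (map (\<lambda>k. sorted_list_of_set (?I k)) js))" if "distinct js" "set js \<subseteq> {1..m}" for js
    using that by (induction js) (auto simp: set_I blocks_def)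
  from this[of "[1..<Suc m]"] have dist: "distinct L"
    unfolding L_def by (simp add: atLeastLessThanSuc_atLeastAtMost)
  have len_L: "length L = ?p" using distinct_card[OF dist] set_L by simp
  have \<pi>: "?\<pi> s = (if s < ?p then L ! s else s)" for s by (simp add: partition_perm_def L_def)
  have perm: "?\<pi> permutes {..<?p}"
  proof (rule bij_imp_permutes)
    have "bij_betw ((!) L) {..<?p} {..<?p}" using bij_betw_nth[OF dist] len_L set_L by simp
    then show "bij_betw ?\<pi> {..<?p} {..<?p}" by (rule bij_betw_cong[THEN iffD1, rotated]) (simp add: \<pi>)
  qed (simp add: \<pi>)
  have "map (\<lambda>k. ring_list_prod R (map (\<lambda>y. g y k) (nths w (?I k)))) [1..<Suc m] =
      map (ring_list_prod R) (map (\<lambda>k. map z (sorted_list_of_set (?I k))) [1..<Suc m])"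
  proof -
    have 1: "map (\<lambda>y. g y k) (nths w (?I k)) = map z (sorted_list_of_set (?I k))" if "k \<in> {1..m}" for k
    proof -
      have "?I k \<subseteq> {..<?p}" using that len by (auto simp: blocks_def)
      then show ?thesis using that set_I[OF that]
        by (auto simp: nths_eq_map_sorted_list z_def blocks_def)
    qed
    then show ?thesis by (auto intro!: map_cong arg_cong[where f = "ring_list_prod R"])
  qed
  moreover have "ring_list_prod R (map (ring_list_prod R) (map (\<lambda>k. map z (sorted_list_of_set (?I k))) [1..<Suc m])) =
      ring_list_prod R (concat (map (\<lambda>k. map z (sorted_list_of_set (?I k))) [1..<Suc m]))"
  proof (rule list_prod_concat)
    fix xs assume "xs \<in> set (map (\<lambda>k. map z (sorted_list_of_set (?I k))) [1..<Suc m])"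
    then obtain k where "k \<in> {1..m}" "xs = map z (sorted_list_of_set (?I k))"
      by (auto simp: atLeastLessThanSuc_atLeastAtMost)
    then show "set xs \<subseteq> carrier R" using z len set_I[of k] by (auto simp: blocks_def)
  qed
  ultimately have "ring_list_prod R (map (\<lambda>k. ring_list_prod R (map (\<lambda>y. g y k) (nths w (?I k)))) [1..<Suc m]) =
      ring_list_prod R (concat (map (\<lambda>k. map z (sorted_list_of_set (?I k))) [1..<Suc m]))"
    by (simp only:)
  also have "concat (map (\<lambda>k. map z (sorted_list_of_set (?I k))) [1..<Suc m]) = map z L"
    by (simp add: L_def map_concat comp_def)
  also have "map z L = map (z \<circ> ?\<pi>) [0..<?p]"
    using len_L by (auto simp: \<pi> intro!: nth_equalityI)
  also have "ring_list_prod R \<dots> = [sign ?\<pi>] \<cdot> ring_list_prod R (map z [0..<?p])"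
    by (rule list_prod_permute[OF perm z z_anti])
  moreover have "set (map z [0..<?p]) \<subseteq> carrier R" using z by auto
  moreover have "z = (\<lambda>s. g (w ! s) (ks ! s))" by (rule ext) (simp add: z_def)
  ultimately show ?thesis by (simp add: placed_prod_def)
qed

lemma placed_prod_closed:
  assumes "\<And>x k. x \<in> set w \<Longrightarrow> k \<in> {1..m} \<Longrightarrow> g x k \<in> carrier R" "ks \<in> placements m P (length w)"
  shows "placed_prod R g w ks \<in> carrier R"
  unfolding placed_prod_def using assms(2) nth_mem[of _ ks]
  by (intro list_prod_closed) (auto simp: placements_def intro!: assms(1))

lemma slice_sum_placements:
  assumes g: "\<And>x k. x \<in> set w \<Longrightarrow> k \<in> {1..m} \<Longrightarrow> g x k \<in> carrier R"
    and anti: "\<And>x y k l. x \<in> set w \<Longrightarrow> y \<in> set w \<Longrightarrow> k \<in> {1..m} \<Longrightarrow> l \<in> {1..m} \<Longrightarrow>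
      g x k \<otimes> g y l = \<ominus> (g y l \<otimes> g x k)"
  shows "slice_sum R m P w (\<lambda>V. ring_list_prod R (map (\<lambda>k. ring_list_prod R (map (\<lambda>y. g y k) (V k))) [1..<Suc m])) =
    (\<Oplus>ks\<in>placements m P (length w). placed_prod R g w ks)"
proof -
  let ?F = "\<lambda>I. [sign (partition_perm m (length w) I)] \<cdot>
      ring_list_prod R (map (\<lambda>k. ring_list_prod R (map (\<lambda>y. g y k) (nths w (I k)))) [1..<Suc m])"
  note bij = blocks_bij[of m P "length w"]
  have F: "?F (blocks m ks) = placed_prod R g w ks" if "ks \<in> placements m P (length w)" for ks
    by (rule sign_slice[OF g anti that])
  have cl: "placed_prod R g w ks \<in> carrier R" if "ks \<in> placements m P (length w)" for ks
    by (rule placed_prod_closed[OF g that])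
  have "(\<Oplus>I\<in>blocks m ` placements m P (length w). ?F I) = (\<Oplus>ks\<in>placements m P (length w). ?F (blocks m ks))"
  proof (rule finsum_reindex)
    show "?F \<in> blocks m ` placements m P (length w) \<rightarrow> carrier R"
    proof
      fix I assume "I \<in> blocks m ` placements m P (length w)"
      then obtain ks where "ks \<in> placements m P (length w)" "I = blocks m ks" by blast
      then show "?F I \<in> carrier R" using F[of ks] cl[of ks] by (simp only:)
    qed
  qed (use bij in \<open>simp add: bij_betw_def\<close>)
  also have "\<dots> = (\<Oplus>ks\<in>placements m P (length w). placed_prod R g w ks)"
    by (rule finsum_cong'[OF refl _ F]) (use cl in auto)
  finally show ?thesis using bij by (simp add: slice_sum_def bij_betw_def)
qed

lemma placement_sum_closed:
  "(\<And>x k. x \<in> set w \<Longrightarrow> k \<in> {1..m} \<Longrightarrow> g x k \<in> carrier R) \<Longrightarrow> placement_sum R g m P w \<in> carrier R"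
  by (induction w arbitrary: P) (auto intro!: finsum_closed)

lemma placements_Cons:
  "placements m P (Suc p) = (\<Union>k\<in>{k\<in>{1..m}. P k \<noteq> 0}. (#) k ` placements m (P(k := P k - 1)) p)"
proof (intro equalityI subsetI)
  fix ks assume ks: "ks \<in> placements m P (Suc p)"
  then obtain k ks' where k: "ks = k # ks'" by (cases ks) (auto simp: placements_def)
  have "k \<in> {1..m}" using ks k by (auto simp: placements_def)
  moreover have "count_list ks k = P k" by (rule placements_count[OF ks \<open>k \<in> {1..m}\<close>])
  moreover have "ks' \<in> placements m (P(k := P k - 1)) p"
    using ks k by (auto simp: placements_def)
  ultimately show "ks \<in> (\<Union>k\<in>{k\<in>{1..m}. P k \<noteq> 0}. (#) k ` placements m (P(k := P k - 1)) p)"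
    using k by auto
next
  fix ks assume "ks \<in> (\<Union>k\<in>{k\<in>{1..m}. P k \<noteq> 0}. (#) k ` placements m (P(k := P k - 1)) p)"
  then obtain k ks' where "k \<in> {1..m}" "P k \<noteq> 0" "ks' \<in> placements m (P(k := P k - 1)) p" "ks = k # ks'"
    by blast
  then show "ks \<in> placements m P (Suc p)" by (auto simp: placements_def split: if_splits)
qed

lemma finsum_placements:
  assumes "\<And>x k. x \<in> set w \<Longrightarrow> k \<in> {1..m} \<Longrightarrow> g x k \<in> carrier R"
  shows "(\<Oplus>ks\<in>placements m P (length w). placed_prod R g w ks) = placement_sum R g m P w"
  using assms
proof (induction w arbitrary: P)
  case Nil
  have "placements m P 0 = (if \<forall>k\<in>{1..m}. P k = 0 then {[]} else {})" by (auto simp: placements_def)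
  then show ?case by (simp add: placed_prod_def)
next
  case (Cons x w)
  let ?K = "{k\<in>{1..m}. P k \<noteq> 0}"
  let ?P = "\<lambda>k. P(k := P k - 1)"
  have gw: "g y k \<in> carrier R" if "y \<in> set w" "k \<in> {1..m}" for y k using Cons.prems that by simp
  have gx: "g x k \<in> carrier R" if "k \<in> {1..m}" for k using Cons.prems that by simp
  have cl: "placed_prod R g w ks \<in> carrier R" if "ks \<in> placements m Q (length w)" for ks Q
    by (rule placed_prod_closed[OF gw that])
  have prod_Cons: "placed_prod R g (x # w) (k # ks) = g x k \<otimes> placed_prod R g w ks" for k ks
    by (simp add: placed_prod_def map_upt_Suc comp_def del: upt_Suc)
  have "(\<Oplus>ks\<in>placements m P (length (x # w)). placed_prod R g (x # w) ks) =
      (\<Oplus>k\<in>?K. \<Oplus>ks\<in>(#) k ` placements m (?P k) (length w). placed_prod R g (x # w) ks)"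
    unfolding list.size(4) add_0_right add_Suc_right placements_Cons
    by (rule add.finprod_UN_disjoint)
      (auto simp: pairwise_def disjnt_def finite_placements prod_Cons intro!: m_closed gx cl)
  also have "\<dots> = (\<Oplus>k\<in>?K. g x k \<otimes> placement_sum R g m (?P k) w)"
  proof (rule finsum_cong'[OF refl])
    fix k assume k: "k \<in> ?K"
    have "(\<Oplus>ks\<in>(#) k ` placements m (?P k) (length w). placed_prod R g (x # w) ks) =
        (\<Oplus>ks\<in>placements m (?P k) (length w). placed_prod R g (x # w) (k # ks))"
      using k by (intro finsum_reindex) (auto simp: prod_Cons intro!: m_closed gx cl)
    also have "\<dots> = (\<Oplus>ks\<in>placements m (?P k) (length w). g x k \<otimes> placed_prod R g w ks)" by (simp add: prod_Cons)
    also have "\<dots> = g x k \<otimes> (\<Oplus>ks\<in>placements m (?P k) (length w). placed_prod R g w ks)"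
      using k by (intro finsum_rdistr[symmetric]) (auto simp: finite_placements intro!: gx cl)
    also have "\<dots> = g x k \<otimes> placement_sum R g m (?P k) w" using Cons.IH[OF gw] by simp
    finally show "(\<Oplus>ks\<in>(#) k ` placements m (?P k) (length w). placed_prod R g (x # w) ks) =
        g x k \<otimes> placement_sum R g m (?P k) w" .
  qed (auto intro!: m_closed gx placement_sum_closed[OF gw])
  also have "\<dots> = (\<Oplus>k\<in>{1..m}. if P k = 0 then \<zero> else g x k \<otimes> placement_sum R g m (?P k) w)"
    by (rule add.finprod_mono_neutral_cong_left) (auto intro!: m_closed gx placement_sum_closed[OF gw])
  finally show ?case by simp
qed

lemmas slice_sum_placement_sum = trans[OF slice_sum_placements finsum_placements]

end

section \<open>The isomorphism and the two ideals\<close>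

lemma upt_split: "i \<in> {1..m} \<Longrightarrow> [1..<Suc m] = [1..<i] @ i # [Suc i..<Suc m]"
  using upt_add_eq_append[of 1 i "Suc m - i"] upt_conv_Cons[of i "Suc m"] by simp

lemma places_word_split:
  "i \<in> {1..m} \<Longrightarrow> places_word m A =
    concat (map (\<lambda>k. place_word k (A k)) [1..<i]) @ place_word i (A i) @
    concat (map (\<lambda>k. place_word k (A k)) [Suc i..<Suc m])"
  unfolding places_word_def by (subst upt_split[of i]) simp_all

lemma places_word_at_place:
  assumes "i \<in> {1..m}" shows "places_word m (at_place i w) = place_word i w"
proof -
  have nil: "concat (map (\<lambda>k. place_word k (at_place i w k)) ks) = []" if "i \<notin> set ks" for ks
    using that by (auto simp: at_place_def)
  have "at_place i w i = w" by (simp add: at_place_def)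
  moreover have "concat (map (\<lambda>k. place_word k (at_place i w k)) [1..<i]) = []"
    and "concat (map (\<lambda>k. place_word k (at_place i w k)) [Suc i..<Suc m]) = []"
    by (rule nil, simp)+
  ultimately show ?thesis by (simp only: places_word_split[OF assms] append_Nil append_Nil2)
qed

lemma letterplace_ring: "ring (letterplace S m)"
  by (simp add: letterplace_def Sk.ring_axioms)

text \<open>
  The two homomorphisms between the letterplace algebra and the tensor power are inverse to each
  other, since both composites fix the generators. A homomorphism is determined by the letters, so
  the definite description in \<open>Phi\<close> denotes.
\<close>

lemma Phi_spec:
  "Phi S m \<in> ring_iso (letterplace S m) (SkewT S m) \<and>
    Phi S m \<in> extensional (carrier (letterplace S m)) \<and>
    (\<forall>x\<in>S. \<forall>i\<in>{1..m}. Phi S m (lp_gen S m x i) = tensor_mon S m (at_place i [x]))"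
proof -
  let ?L = "letterplace S m" and ?T = "SkewT S m" and ?X = "S \<times> {1..m}"
  let ?spec = "\<lambda>\<phi>. \<phi> \<in> ring_iso ?L ?T \<and> \<phi> \<in> extensional (carrier ?L) \<and>
    (\<forall>x\<in>S. \<forall>i\<in>{1..m}. \<phi> (lp_gen S m x i) = tensor_mon S m (at_place i [x]))"
  have X: "carrier ?L = carrier (Skew ?X)" by (simp add: letterplace_def)
  obtain \<phi> where \<phi>: "\<phi> \<in> Ring.ring_hom ?L ?T"
    "\<And>x i. x \<in> S \<Longrightarrow> i \<in> {1..m} \<Longrightarrow> \<phi> (lp_gen S m x i) = tensor_mon S m (at_place i [x])"
    using letterplace_to_tensor[of S m] by blast
  obtain \<psi> where \<psi>: "\<psi> \<in> Ring.ring_hom ?T ?L"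
    "\<And>A. A \<in> {1..m} \<rightarrow> lists S \<Longrightarrow> \<psi> (tensor_mon S m A) = skew_mon ?X (places_word m A)"
    using tensor_to_letterplace[of S m] by blast
  have \<psi>\<phi>: "\<psi> (\<phi> a) = a" if "a \<in> carrier ?L" for a
  proof (rule skew_ring_hom_eqI[of "Skew ?X" "\<lambda>a. \<psi> (\<phi> a)" ?X "\<lambda>a. a"])
    show "(\<lambda>a. \<psi> (\<phi> a)) \<in> Ring.ring_hom (Skew ?X) (Skew ?X)"
      using ring_hom_trans[OF \<phi>(1) \<psi>(1)] by (simp add: letterplace_def comp_def)
    show "\<psi> (\<phi> (skew_mon ?X [p])) = skew_mon ?X [p]" if "p \<in> ?X" for p
    proof -
      obtain x i where "p = (x, i)" by (cases p)
      then have p: "p = (x, i)" "x \<in> S" "i \<in> {1..m}" using that by simp_all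
      have fam: "at_place i [x] \<in> {1..m} \<rightarrow> lists S" using p by (simp add: at_place_lists)
      show ?thesis using \<phi>(2)[OF p(2,3)] \<psi>(2)[OF fam]
        by (simp add: lp_gen_def p(1) places_word_at_place[OF p(3)])
    qed
    show "(\<lambda>a. a) \<in> Ring.ring_hom (Skew ?X) (Skew ?X)" by (rule ring_hom_memI) auto
  qed (use that X Sk.ring_axioms in simp_all)
  have \<phi>\<psi>: "\<phi> (\<psi> t) = t" if "t \<in> carrier ?T" for t
  proof (rule tensor_add_hom_eqI[OF Te.ring_axioms _ _ _ that])
    show "add_hom ?T ?T (\<lambda>t. \<phi> (\<psi> t))"
      by (rule add_hom_compose[OF ring_hom_add_hom[OF \<psi>(1)] ring_hom_add_hom[OF \<phi>(1)]])
    show "add_hom ?T ?T (\<lambda>t. t)" by (rule add_homI) simp_all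
    show "\<phi> (\<psi> (tensor_mon S m A)) = tensor_mon S m A" if "A \<in> {1..m} \<rightarrow> lists S" for A
      using tensor_hom_places_word[OF \<phi> that] by (simp add: \<psi>(2)[OF that])
  qed
  let ?\<phi> = "restrict \<phi> (carrier ?L)"
  have bij: "bij_betw ?\<phi> (carrier ?L) (carrier ?T)"
    by (rule bij_betw_byWitness[of _ \<psi>])
      (use \<psi>\<phi> \<phi>\<psi> ring_hom_closed[OF \<phi>(1)] ring_hom_closed[OF \<psi>(1)] in auto)
  interpret L: ring ?L by (rule letterplace_ring)
  have hom: "?\<phi> \<in> Ring.ring_hom ?L ?T"
    by (rule ring_hom_memI)
      (simp_all add: ring_hom_closed[OF \<phi>(1)] ring_hom_mult[OF \<phi>(1)] ring_hom_add[OF \<phi>(1)] ring_hom_one[OF \<phi>(1)])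
  have gen: "lp_gen S m x i \<in> carrier ?L" if "x \<in> S" "i \<in> {1..m}" for x i
    using that by (simp add: lp_gen_def letterplace_def)
  have "?spec ?\<phi>" using bij hom \<phi>(2) gen by (auto simp: ring_iso_def)
  moreover have "\<phi>' = ?\<phi>" if "?spec \<phi>'" for \<phi>'
  proof (rule extensionalityI[of _ "carrier ?L"])
    fix a assume a: "a \<in> carrier ?L"
    have "\<phi>' a = \<phi> a"
    proof (rule skew_ring_hom_eqI[of "?T" \<phi>' ?X \<phi>])
      show "\<phi>' (skew_mon ?X [p]) = \<phi> (skew_mon ?X [p])" if "p \<in> ?X" for p
      proof -
        obtain x i where "p = (x, i)" by (cases p)
        then have p: "p = (x, i)" "x \<in> S" "i \<in> {1..m}" using that by simp_all
        then have "\<phi>' (lp_gen S m x i) = \<phi> (lp_gen S m x i)" using \<open>?spec \<phi>'\<close> \<phi>(2)[OF p(2,3)] by simp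
        then show ?thesis by (simp add: lp_gen_def p(1))
      qed
    qed (use that \<phi>(1) a Te.ring_axioms in \<open>simp_all add: letterplace_def ring_iso_def\<close>)
    then show "\<phi>' a = ?\<phi> a" using a by simp
  qed (use that in auto)
  ultimately have "\<exists>!\<phi>. ?spec \<phi>" by (rule ex1I)
  from theI'[OF this] show ?thesis unfolding Phi_def at_place_def[symmetric] .
qed

lemma Phi_iso: "Phi S m \<in> ring_iso (letterplace S m) (SkewT S m)"
  using Phi_spec[of S m] by blast

lemma Phi_hom: "Phi S m \<in> Ring.ring_hom (letterplace S m) (SkewT S m)"
  using Phi_iso[of S m] by (simp add: ring_iso_def)

lemma Phi_add_hom: "add_hom (letterplace S m) (SkewT S m) (Phi S m)"
  by (rule ring_hom_add_hom[OF Phi_hom])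

lemma Phi_bij: "bij_betw (Phi S m) (carrier (letterplace S m)) (carrier (SkewT S m))"
  using Phi_iso[of S m] by (simp add: ring_iso_def)

lemma Phi_mon:
  "A \<in> {1..m} \<rightarrow> lists S \<Longrightarrow> Phi S m (skew_mon (S \<times> {1..m}) (places_word m A)) = tensor_mon S m A"
  by (rule tensor_hom_places_word[OF Phi_hom]) (use Phi_spec[of S m] in auto)

lemma lp_gen_letter: "x \<in> S \<Longrightarrow> k \<in> {1..m} \<Longrightarrow> lp_gen S m x k \<in> skew_linear (S \<times> {1..m})"
  unfolding lp_gen_def by (intro skew_linear.letter) simp

lemma lp_gen_closed [simp]: "x \<in> S \<Longrightarrow> k \<in> {1..m} \<Longrightarrow> lp_gen S m x k \<in> carrier (Skew (S \<times> {1..m}))"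
  by (rule skew_linear_closed[OF lp_gen_letter])

lemma lp_mon_eq:
  assumes "w \<in> lists S" "i \<in> {1..m}"
  shows "lp_mon S m w i = skew_mon (S \<times> {1..m}) (place_word i w)"
  unfolding skew_mon_list_prod[OF place_word_lists[OF assms]]
  by (simp add: lp_mon_def letterplace_def lp_gen_def place_word_def comp_def)

lemma lp_prod_eq:
  assumes "V \<in> {1..m} \<rightarrow> lists S"
  shows "ring_list_prod (letterplace S m) (map (\<lambda>k. lp_mon S m (V k) k) [1..<Suc m]) =
    skew_mon (S \<times> {1..m}) (places_word m V)"
proof -
  have eq: "map (\<lambda>k. lp_mon S m (V k) k) [1..<Suc m] =
      map (\<lambda>k. skew_mon (S \<times> {1..m}) (place_word k (V k))) [1..<Suc m]"
    using assms by (auto simp: Pi_iff intro!: lp_mon_eq)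
  show ?thesis
    unfolding eq using list_prod_place_words[of "[1..<Suc m]" m V S] assms
    by (simp add: letterplace_def places_word_def atLeastLessThanSuc_atLeastAtMost)
qed

lemma nths_lists: "w \<in> lists S \<Longrightarrow> nths w A \<in> lists S"
  using set_nths_subset[of w A] by (auto simp: in_lists_conv_set)

lemma slice_sum_add_hom:
  assumes "ring R" "ring R'" "add_hom R R' f"
    and F: "\<And>I. I \<in> ordered_partitions m P (length w) \<Longrightarrow> F (\<lambda>k. nths w (I k)) \<in> carrier R"
  shows "f (slice_sum R m P w F) = slice_sum R' m P w (\<lambda>V. f (F V))"
proof -
  interpret R: ring R by fact
  interpret R': ring R' by fact
  have F': "f (F (\<lambda>k. nths w (I k))) \<in> carrier R'" if "I \<in> ordered_partitions m P (length w)" for I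
    using add_hom_closed[OF assms(3) F[OF that]] .
  show ?thesis
    unfolding slice_sum_def
    by (subst add_hom_finsum[OF assms(1-3)])
      (use F F' in \<open>auto intro!: R'.finsum_cong' simp: add_hom_int[OF assms(1-3)]\<close>)
qed

lemma slice_sum_cong:
  assumes "ring R"
    and "\<And>I. I \<in> ordered_partitions m P (length w) \<Longrightarrow> F (\<lambda>k. nths w (I k)) = G (\<lambda>k. nths w (I k))"
    and "\<And>I. I \<in> ordered_partitions m P (length w) \<Longrightarrow> G (\<lambda>k. nths w (I k)) \<in> carrier R"
  shows "slice_sum R m P w F = slice_sum R m P w G"
proof -
  interpret R: ring R by fact
  show ?thesis unfolding slice_sum_def by (rule R.finsum_cong') (use assms(2,3) in auto)
qed

lemma biproduct_eq:
  assumes w: "w \<in> lists S"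
  shows "biproduct S m P w = slice_sum (letterplace S m) m P w (\<lambda>V. skew_mon (S \<times> {1..m}) (places_word m V))"
  unfolding biproduct_def
  by (rule slice_sum_cong[OF letterplace_ring])
    (use w in \<open>auto simp: letterplace_def nths_lists intro!: lp_prod_eq[unfolded letterplace_def] places_word_lists skew_mon_closed\<close>)

lemma Phi_biproduct:
  assumes w: "w \<in> lists S" shows "Phi S m (biproduct S m P w) = slice S m P w"
proof -
  have "Phi S m (biproduct S m P w) =
      slice_sum (SkewT S m) m P w (\<lambda>V. Phi S m (skew_mon (S \<times> {1..m}) (places_word m V)))"
    unfolding biproduct_eq[OF w]
    by (rule slice_sum_add_hom[OF letterplace_ring Te.ring_axioms Phi_add_hom])
      (use w in \<open>auto simp: letterplace_def nths_lists intro!: places_word_lists skew_mon_closed\<close>)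
  also have "\<dots> = slice S m P w"
    unfolding slice_def
    by (rule slice_sum_cong[OF Te.ring_axioms])
      (use w in \<open>auto simp: nths_lists intro!: Phi_mon tensor_mon_closed\<close>)
  finally show ?thesis .
qed

lemma lp_gen_anti:
  "x \<in> S \<Longrightarrow> y \<in> S \<Longrightarrow> k \<in> {1..m} \<Longrightarrow> l \<in> {1..m} \<Longrightarrow>
    lp_gen S m x k \<otimes>\<^bsub>Skew (S \<times> {1..m})\<^esub> lp_gen S m y l =
    \<ominus>\<^bsub>Skew (S \<times> {1..m})\<^esub> (lp_gen S m y l \<otimes>\<^bsub>Skew (S \<times> {1..m})\<^esub> lp_gen S m x k)"
  by (intro skew_linear_anti lp_gen_letter)

lemma
  assumes w: "w \<in> lists S"
  shows biproduct_placements: "biproduct S m P w =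
      (\<Oplus>\<^bsub>Skew (S \<times> {1..m})\<^esub>ks\<in>placements m P (length w). placed_prod (Skew (S \<times> {1..m})) (lp_gen S m) w ks)"
    and biproduct_placement_sum: "biproduct S m P w = placement_sum (Skew (S \<times> {1..m})) (lp_gen S m) m P w"
proof -
  have S: "x \<in> S" if "x \<in> set w" for x using that w by (auto simp: in_lists_conv_set)
  show "biproduct S m P w =
      (\<Oplus>\<^bsub>Skew (S \<times> {1..m})\<^esub>ks\<in>placements m P (length w). placed_prod (Skew (S \<times> {1..m})) (lp_gen S m) w ks)"
    unfolding biproduct_def lp_mon_def letterplace_def
    by (rule Sk.slice_sum_placements[OF lp_gen_closed lp_gen_anti]) (auto intro: S)
  also have "\<dots> = placement_sum (Skew (S \<times> {1..m})) (lp_gen S m) m P w"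
    by (rule Sk.finsum_placements) (use S in \<open>auto intro!: lp_gen_closed\<close>)
  finally show "biproduct S m P w = placement_sum (Skew (S \<times> {1..m})) (lp_gen S m) m P w" .
qed

lemma biproduct_closed:
  assumes "w \<in> lists S" shows "biproduct S m P w \<in> carrier (letterplace S m)"
  unfolding biproduct_placement_sum[OF assms] letterplace_def
  by (rule Sk.placement_sum_closed) (use assms in \<open>auto simp: in_lists_conv_set intro!: lp_gen_closed\<close>)

text \<open>
  Exchanging the places of two equal letters permutes the placements and reverses the sign of each
  product. The biproduct thus equals its negative, and there is no \<open>2\<close>-torsion.
\<close>

lemma biproduct_repeated:
  assumes w: "w \<in> lists S" and rep: "\<not> distinct w"
  shows "biproduct S m P w = \<zero>\<^bsub>letterplace S m\<^esub>"
proof -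
  let ?X = "S \<times> {1..m}" and ?p = "length w" and ?g = "lp_gen S m"
  let ?C = "placements m P ?p"
  obtain a b where ab: "a < ?p" "b < ?p" "a \<noteq> b" "w ! a = w ! b"
    using rep by (auto simp: distinct_conv_nth)
  let ?\<tau> = "transpose a b"
  have \<tau>: "?\<tau> permutes {..<?p}" using ab by (intro permutes_swap_id) auto
  have S: "w ! s \<in> S" if "s < ?p" for s using w that by (auto simp: in_lists_conv_set)
  have cl: "placed_prod (Skew ?X) ?g w ks \<in> carrier (Skew ?X)" if "ks \<in> ?C" for ks
    by (rule Sk.placed_prod_closed[OF _ that]) (use w in \<open>auto simp: in_lists_conv_set intro!: lp_gen_closed\<close>)
  have perm: "permute_list ?\<tau> ks \<in> ?C" if ks: "ks \<in> ?C" for ks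
  proof -
    have "mset (permute_list ?\<tau> ks) = mset ks"
      using \<tau> placements_length[OF ks] by (intro mset_permute_list) simp
    then have "set (permute_list ?\<tau> ks) = set ks" "\<And>k. count_list (permute_list ?\<tau> ks) k = count_list ks k"
      using mset_eq_setD by (blast, metis count_mset)
    then show ?thesis using ks by (simp add: placements_def)
  qed
  have invol: "permute_list ?\<tau> (permute_list ?\<tau> ks) = ks" if "ks \<in> ?C" for ks
    using permute_list_compose[of ?\<tau> ks ?\<tau>] \<tau> placements_length[OF that] by simp
  have bij: "bij_betw (permute_list ?\<tau>) ?C ?C"
    by (rule bij_betw_byWitness[of _ "permute_list ?\<tau>"]) (use perm invol in auto)
  have neg: "placed_prod (Skew ?X) ?g w (permute_list ?\<tau> ks) = \<ominus>\<^bsub>Skew ?X\<^esub> placed_prod (Skew ?X) ?g w ks"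
    if ks: "ks \<in> ?C" for ks
  proof -
    let ?z = "\<lambda>s. ?g (w ! s) (ks ! s)"
    have len: "length ks = ?p" by (rule placements_length[OF ks])
    have "w ! (?\<tau> s) = w ! s" for s using ab(4) by (simp add: transpose_def)
    then have "map (\<lambda>s. ?g (w ! s) (permute_list ?\<tau> ks ! s)) [0..<?p] = map (?z \<circ> ?\<tau>) [0..<?p]"
      by (simp add: permute_list_def len)
    moreover have "ring_list_prod (Skew ?X) (map (?z \<circ> ?\<tau>) [0..<?p]) =
        \<ominus>\<^bsub>Skew ?X\<^esub> ring_list_prod (Skew ?X) (map ?z [0..<?p])"
    proof (rule Sk.list_prod_transpose[OF _ _ ab(1-3)])
      fix s t assume s: "s < ?p" and t: "t < ?p"
      show "?z s \<in> carrier (Skew ?X)" by (rule lp_gen_closed[OF S[OF s] placements_nth[OF ks s]])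
      show "?z s \<otimes>\<^bsub>Skew ?X\<^esub> ?z t = \<ominus>\<^bsub>Skew ?X\<^esub> (?z t \<otimes>\<^bsub>Skew ?X\<^esub> ?z s)"
        by (rule lp_gen_anti[OF S[OF s] S[OF t] placements_nth[OF ks s] placements_nth[OF ks t]])
    qed
    ultimately show ?thesis by (simp only: placed_prod_def)
  qed
  let ?b = "\<Oplus>\<^bsub>Skew ?X\<^esub>ks\<in>?C. placed_prod (Skew ?X) ?g w ks"
  have b: "?b \<in> carrier (Skew ?X)" using cl by (intro Sk.finsum_closed) auto
  have "?b = (\<Oplus>\<^bsub>Skew ?X\<^esub>ks\<in>permute_list ?\<tau> ` ?C. placed_prod (Skew ?X) ?g w ks)"
    using bij by (simp add: bij_betw_def)
  also have "\<dots> = (\<Oplus>\<^bsub>Skew ?X\<^esub>ks\<in>?C. placed_prod (Skew ?X) ?g w (permute_list ?\<tau> ks))"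
    using bij cl by (intro Sk.finsum_reindex) (auto simp: bij_betw_def)
  also have "\<dots> = (\<Oplus>\<^bsub>Skew ?X\<^esub>ks\<in>?C. \<ominus>\<^bsub>Skew ?X\<^esub> placed_prod (Skew ?X) ?g w ks)"
    by (rule Sk.finsum_cong'[OF refl _ neg]) (use cl in auto)
  also have "\<dots> = \<ominus>\<^bsub>Skew ?X\<^esub> ?b"
    using cl by (intro add_hom_finsum[OF Sk.ring_axioms Sk.ring_axioms, symmetric] add_homI) (auto simp: Sk.minus_add)
  finally have "?b = \<zero>\<^bsub>Skew ?X\<^esub>" using skew_self_neg_zero[OF b] by blast
  then show ?thesis by (simp add: biproduct_placements[OF w] letterplace_def)
qed

text \<open>
  The generators need not correspond exactly: \<open>f ` G\<close> may contain further elements of the ideal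
  generated by \<open>G'\<close>. This accounts for the biproducts of words with repeated letters.
\<close>

lemma ring_iso_image_Idl:
  assumes R: "ring R" "ring R'" and f: "f \<in> ring_iso R R'"
    and G: "G \<subseteq> carrier R" "G' \<subseteq> carrier R'"
    and GG': "f ` G \<subseteq> Idl\<^bsub>R'\<^esub> G'" "G' \<subseteq> f ` G"
  shows "f ` (Idl\<^bsub>R\<^esub> G) = Idl\<^bsub>R'\<^esub> G'"
proof -
  interpret R: ring R by fact
  interpret R': ring R' by fact
  have hom: "f \<in> Ring.ring_hom R R'" and bij: "bij_betw f (carrier R) (carrier R')"
    using f by (auto simp: ring_iso_def)
  note cl = ring_hom_closed[OF hom] and neg = add_hom_neg[OF R ring_hom_add_hom[OF hom]]
    and zero = add_hom_zero[OF R ring_hom_add_hom[OF hom]]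
  interpret J: ideal "Idl\<^bsub>R\<^esub> G" R by (rule R.genideal_ideal[OF G(1)])
  interpret I: ideal "Idl\<^bsub>R'\<^esub> G'" R' by (rule R'.genideal_ideal[OF G(2)])
  show ?thesis
  proof
    have "ideal {x \<in> carrier R. f x \<in> Idl\<^bsub>R'\<^esub> G'} R"
    proof (rule idealI[OF R(1)])
      show "subgroup {x \<in> carrier R. f x \<in> Idl\<^bsub>R'\<^esub> G'} (add_monoid R)"
        by (rule R.add.subgroupI)
          (use ring_hom_add[OF hom] neg zero in \<open>auto simp flip: a_inv_def intro: exI[of _ "\<zero>\<^bsub>R\<^esub>"]\<close>)
    qed (auto simp: ring_hom_mult[OF hom] cl I.I_l_closed I.I_r_closed)
    then have "Idl\<^bsub>R\<^esub> G \<subseteq> {x \<in> carrier R. f x \<in> Idl\<^bsub>R'\<^esub> G'}"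
      by (rule R.genideal_minimal) (use G GG'(1) in auto)
    then show "f ` (Idl\<^bsub>R\<^esub> G) \<subseteq> Idl\<^bsub>R'\<^esub> G'" by auto
    have surj: "\<exists>z\<in>carrier R. y = f z" if "y \<in> carrier R'" for y
      using that bij by (auto simp: bij_betw_def)
    have "ideal (f ` (Idl\<^bsub>R\<^esub> G)) R'"
    proof (rule idealI[OF R(2)])
      show "subgroup (f ` (Idl\<^bsub>R\<^esub> G)) (add_monoid R')"
      proof (rule R'.add.subgroupI)
        show "f ` (Idl\<^bsub>R\<^esub> G) \<subseteq> carrier R'" using cl J.a_Hcarr by auto
        show "f ` (Idl\<^bsub>R\<^esub> G) \<noteq> {}" using J.zero_closed by blast
        fix x assume "x \<in> f ` (Idl\<^bsub>R\<^esub> G)"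
        then obtain x' where x': "x' \<in> Idl\<^bsub>R\<^esub> G" "x = f x'" by blast
        show "\<ominus>\<^bsub>R'\<^esub> x \<in> f ` (Idl\<^bsub>R\<^esub> G)"
          using x' neg[of x'] J.a_Hcarr by (auto simp flip: a_inv_def intro!: image_eqI[of _ f "\<ominus>\<^bsub>R\<^esub> x'"])
        fix y assume "y \<in> f ` (Idl\<^bsub>R\<^esub> G)"
        then obtain y' where y': "y' \<in> Idl\<^bsub>R\<^esub> G" "y = f y'" by blast
        show "x \<oplus>\<^bsub>R'\<^esub> y \<in> f ` (Idl\<^bsub>R\<^esub> G)"
          using x' y' ring_hom_add[OF hom, of x' y'] J.a_Hcarr by (auto intro!: image_eqI[of _ f "x' \<oplus>\<^bsub>R\<^esub> y'"])
      qed
      fix x y assume "x \<in> f ` (Idl\<^bsub>R\<^esub> G)" "y \<in> carrier R'"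
      then obtain x' y' where "x' \<in> Idl\<^bsub>R\<^esub> G" "x = f x'" "y' \<in> carrier R" "y = f y'" using surj by blast
      then show "y \<otimes>\<^bsub>R'\<^esub> x \<in> f ` (Idl\<^bsub>R\<^esub> G)" "x \<otimes>\<^bsub>R'\<^esub> y \<in> f ` (Idl\<^bsub>R\<^esub> G)"
        using ring_hom_mult[OF hom] J.a_Hcarr J.I_l_closed J.I_r_closed by (metis image_eqI)+
    qed
    then show "Idl\<^bsub>R'\<^esub> G' \<subseteq> f ` (Idl\<^bsub>R\<^esub> G)"
      by (rule R'.genideal_minimal) (use GG'(2) R.genideal_self[OF G(1)] in blast)
  qed
qed

lemma ring_iso_induced:
  assumes I: "ideal J R" "ideal I R'" and f: "f \<in> ring_iso R R'" and img: "f ` J = I"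
  shows "induced_map R J R' I f \<in> ring_iso (R Quot J) (R' Quot I)"
proof -
  interpret J: ideal J R by fact
  interpret I: ideal I R' by fact
  have hom: "f \<in> Ring.ring_hom R R'" and bij: "bij_betw f (carrier R) (carrier R')"
    using f by (auto simp: ring_iso_def)
  note cl = ring_hom_closed[OF hom]
  let ?F = "induced_map R J R' I f"
  have val: "?F (J +>\<^bsub>R\<^esub> a) = I +>\<^bsub>R'\<^esub> f a" if "a \<in> carrier R" for a
    by (rule induced_map_coset[OF I ring_hom_add_hom[OF hom] _ that]) (simp add: img)
  have "?F \<in> Ring.ring_hom (R Quot J) (R' Quot I)"
  proof (rule ring_hom_memI)
    fix x y assume "x \<in> carrier (R Quot J)" "y \<in> carrier (R Quot J)"
    then obtain a b where ab: "a \<in> carrier R" "x = J +>\<^bsub>R\<^esub> a" "b \<in> carrier R" "y = J +>\<^bsub>R\<^esub> b"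
      by (auto simp: J.quot_carrier)
    show "?F x \<in> carrier (R' Quot I)" using ab by (simp add: val I.quot_closed cl)
    show "?F (x \<otimes>\<^bsub>R Quot J\<^esub> y) = ?F x \<otimes>\<^bsub>R' Quot I\<^esub> ?F y"
      using ab by (simp add: J.quot_mult I.quot_mult val cl ring_hom_mult[OF hom])
    show "?F (x \<oplus>\<^bsub>R Quot J\<^esub> y) = ?F x \<oplus>\<^bsub>R' Quot I\<^esub> ?F y"
      using ab by (simp add: J.quot_add I.quot_add val cl ring_hom_add[OF hom])
  qed (simp add: val ring_hom_one[OF hom])
  moreover have "inj_on ?F (carrier (R Quot J))"
  proof (rule inj_onI)
    fix x y assume "x \<in> carrier (R Quot J)" "y \<in> carrier (R Quot J)" and eq: "?F x = ?F y"
    then obtain a b where ab: "a \<in> carrier R" "x = J +>\<^bsub>R\<^esub> a" "b \<in> carrier R" "y = J +>\<^bsub>R\<^esub> b"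
      by (auto simp: J.quot_carrier)
    have "f a \<ominus>\<^bsub>R'\<^esub> f b \<in> I" by (rule I.coset_eqD) (use ab eq cl in \<open>simp_all add: val\<close>)
    then have "f (a \<ominus>\<^bsub>R\<^esub> b) \<in> f ` J"
      using ab ring_hom_add[OF hom] add_hom_neg[OF J.ring_axioms I.ring_axioms ring_hom_add_hom[OF hom]]
      by (simp add: img a_minus_def)
    then obtain c where "c \<in> J" "f (a \<ominus>\<^bsub>R\<^esub> b) = f c" by blast
    then have "a \<ominus>\<^bsub>R\<^esub> b \<in> J"
      using bij ab J.a_Hcarr[of c] by (auto simp: bij_betw_def dest!: inj_onD)
    then show "x = y" using ab J.coset_eqI by simp
  qed
  moreover have "?F ` carrier (R Quot J) = carrier (R' Quot I)"
  proof -
    have "carrier R' = f ` carrier R" using bij by (simp add: bij_betw_def)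
    then show ?thesis by (auto simp: I.quot_carrier J.quot_carrier val image_iff) (metis val)
  qed
  ultimately show ?thesis by (simp add: ring_iso_def bij_betw_def)
qed

locale letterplace_ideals =
  fixes S :: "'a set" and indep :: "'a set \<Rightarrow> bool" and m :: nat
begin

abbreviation "X \<equiv> S \<times> {1..m}"
abbreviation "J \<equiv> biproduct_ideal S indep m"
abbreviation "I \<equiv> whitney_ideal S indep m"

definition "biproduct_gens = {biproduct S m P w | P w. dependent_in S indep (set w) \<and> (\<Sum>k\<in>{1..m}. P k) = length w}"
definition "slice_gens = {slice S m P v | P v. distinct v \<and> dependent_in S indep (set v) \<and> (\<Sum>k\<in>{1..m}. P k) = length v}"

lemma dependent_lists: "dependent_in S indep (set w) \<Longrightarrow> w \<in> lists S"
  by (auto simp: dependent_in_def in_lists_conv_set)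

lemma biproduct_gens_closed: "biproduct_gens \<subseteq> carrier (letterplace S m)"
  by (auto simp: biproduct_gens_def intro!: biproduct_closed dependent_lists)

lemma slice_closed: "w \<in> lists S \<Longrightarrow> slice S m P w \<in> carrier (SkewT S m)"
  unfolding Phi_biproduct[symmetric] by (intro ring_hom_closed[OF Phi_hom] biproduct_closed)

lemma slice_gens_closed: "slice_gens \<subseteq> carrier (SkewT S m)"
  by (auto simp: slice_gens_def intro!: slice_closed dependent_lists)

lemma J_eq: "J = Idl\<^bsub>letterplace S m\<^esub> biproduct_gens"
  by (simp add: biproduct_ideal_def biproduct_gens_def)

lemma I_eq: "I = Idl\<^bsub>SkewT S m\<^esub> slice_gens"
  by (simp add: whitney_ideal_def slice_gens_def)

lemma J_ideal: "ideal J (letterplace S m)"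
  unfolding J_eq by (rule ring.genideal_ideal[OF letterplace_ring biproduct_gens_closed])

lemma I_ideal: "ideal I (SkewT S m)"
  unfolding I_eq by (rule Te.genideal_ideal[OF slice_gens_closed])

lemma Phi_image_J: "Phi S m ` J = I"
  unfolding J_eq I_eq
proof (rule ring_iso_image_Idl[OF letterplace_ring Te.ring_axioms Phi_iso biproduct_gens_closed slice_gens_closed])
  interpret I: ideal "Idl\<^bsub>SkewT S m\<^esub> slice_gens" "SkewT S m" by (rule I_ideal[unfolded I_eq])
  show "Phi S m ` biproduct_gens \<subseteq> Idl\<^bsub>SkewT S m\<^esub> slice_gens"
  proof
    fix t assume "t \<in> Phi S m ` biproduct_gens"
    then obtain P w where w: "t = Phi S m (biproduct S m P w)" "dependent_in S indep (set w)"
      "(\<Sum>k\<in>{1..m}. P k) = length w" by (auto simp: biproduct_gens_def)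
    show "t \<in> Idl\<^bsub>SkewT S m\<^esub> slice_gens"
    proof (cases "distinct w")
      case True
      then have "t \<in> slice_gens"
        unfolding slice_gens_def using w Phi_biproduct[OF dependent_lists[OF w(2)]] by auto
      then show ?thesis using Te.genideal_self[OF slice_gens_closed] by blast
    next
      case False
      then have "t = \<zero>\<^bsub>SkewT S m\<^esub>"
        using w biproduct_repeated[OF dependent_lists[OF w(2)]]
          add_hom_zero[OF letterplace_ring Te.ring_axioms Phi_add_hom] by simp
      then show ?thesis using I.zero_closed by simp
    qed
  qed
  show "slice_gens \<subseteq> Phi S m ` biproduct_gens"
  proof
    fix t assume "t \<in> slice_gens"
    then obtain P v where v: "t = slice S m P v" "dependent_in S indep (set v)" "(\<Sum>k\<in>{1..m}. P k) = length v"
      by (auto simp: slice_gens_def)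
    then show "t \<in> Phi S m ` biproduct_gens"
      using Phi_biproduct[OF dependent_lists[OF v(2)]] unfolding biproduct_gens_def by blast
  qed
qed

end

section \<open>Place polarizations\<close>

text \<open>
  The column of \<open>M\<close> belonging to the place \<open>k\<close> gives the image of \<open>(x|k)\<close>; places start at \<open>1\<close>
  and matrix indices at \<open>0\<close>.
\<close>

definition mat_direction :: "'a set \<Rightarrow> nat \<Rightarrow> int mat \<Rightarrow> 'a \<times> nat \<Rightarrow> ('a \<times> nat) skew_elem" where
  "mat_direction S m M p =
    (\<Oplus>\<^bsub>Skew (S \<times> {1..m})\<^esub>l\<in>{1..m}. [(M $$ (l - 1, snd p - 1))] \<cdot>\<^bsub>Skew (S \<times> {1..m})\<^esub> lp_gen S m (fst p) l)"

interpretation MD: skew_direction "S \<times> {1..m}" "mat_direction S m M" for S :: "'a set" and m M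
  by unfold_locales (auto simp: mat_direction_def intro!: skew_linear_finsum skew_linear_int lp_gen_letter)

abbreviation mat_deriv :: "'a set \<Rightarrow> nat \<Rightarrow> int mat \<Rightarrow> nat \<Rightarrow> ('a \<times> nat) skew_elem \<Rightarrow> ('a \<times> nat) skew_elem" where
  "mat_deriv S m M \<equiv> higher_deriv (S \<times> {1..m}) (mat_direction S m M)"

lemma mat_deriv_1_gen:
  "x \<in> S \<Longrightarrow> k \<in> {1..m} \<Longrightarrow> mat_deriv S m M 1 (lp_gen S m x k) = mat_direction S m M (x, k)"
  using MD.D_letter[of "(x, k)" S m M 1] by (simp add: lp_gen_def)

lemma elementary_mat_entry:
  "l \<in> {1..m} \<Longrightarrow> k \<in> {1..m} \<Longrightarrow> elementary_mat m j i $$ (l - 1, k - 1) = (if l = j \<and> k = i then 1 else 0)"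
  by (auto simp: elementary_mat_def)

lemma mat_direction_elementary:
  assumes "x \<in> S" "j \<in> {1..m}" "k \<in> {1..m}"
  shows "mat_direction S m (elementary_mat m j i) (x, k) =
    (if k = i then lp_gen S m x j else \<zero>\<^bsub>Skew (S \<times> {1..m})\<^esub>)"
proof -
  let ?L = "Skew (S \<times> {1..m})"
  have "mat_direction S m (elementary_mat m j i) (x, k) =
      (\<Oplus>\<^bsub>?L\<^esub>l\<in>{1..m}. if j = l then (if k = i then lp_gen S m x l else \<zero>\<^bsub>?L\<^esub>) else \<zero>\<^bsub>?L\<^esub>)"
    unfolding mat_direction_def
  proof (rule Sk.finsum_cong')
    fix l assume l: "l \<in> {1..m}"
    then show "[(elementary_mat m j i $$ (l - 1, snd (x, k) - 1))] \<cdot>\<^bsub>?L\<^esub> lp_gen S m (fst (x, k)) l =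
        (if j = l then (if k = i then lp_gen S m x l else \<zero>\<^bsub>?L\<^esub>) else \<zero>\<^bsub>?L\<^esub>)"
      using elementary_mat_entry[OF l assms(3), of j i] lp_gen_closed[OF assms(1) l] by simp
  qed (use assms in \<open>auto intro!: lp_gen_closed\<close>)
  also have "\<dots> = (if k = i then lp_gen S m x j else \<zero>\<^bsub>?L\<^esub>)"
    by (rule Sk.add.finprod_singleton) (use assms in \<open>auto intro!: lp_gen_closed\<close>)
  finally show ?thesis .
qed

lemma derivation_mat_deriv:
  "derivation (letterplace S m) (restrict (mat_deriv S m M 1) (carrier (letterplace S m)))"
  unfolding derivation_def additive_map_add_hom letterplace_def
  by (simp add: add_hom_restrict[OF Sk.ring_axioms] MD.D_add_hom MD.D_1_mult)

lemma derivation_unique: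
  assumes "derivation (letterplace S m) d" "derivation (letterplace S m) d'"
    and "\<And>x k. x \<in> S \<Longrightarrow> k \<in> {1..m} \<Longrightarrow> d (lp_gen S m x k) = d' (lp_gen S m x k)"
  shows "d = d'"
proof (rule extensionalityI[of _ "carrier (letterplace S m)"])
  show "d a = d' a" if "a \<in> carrier (letterplace S m)" for a
  proof (rule skew_derivation_eqI[of "S \<times> {1..m}" d d'])
    show "d (skew_mon (S \<times> {1..m}) [p]) = d' (skew_mon (S \<times> {1..m}) [p])" if "p \<in> S \<times> {1..m}" for p
    proof -
      obtain x k where "p = (x, k)" by (cases p)
      then show ?thesis using that assms(3)[of x k] by (simp add: lp_gen_def)
    qed
  qed (use assms(1,2) that in \<open>simp_all add: derivation_def additive_map_add_hom letterplace_def\<close>)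
qed (use assms(1,2) in \<open>simp_all add: derivation_def additive_map_add_hom\<close>)

lemma polarization_eq:
  assumes "j \<in> {1..m}"
  shows "polarization S m j i = restrict (mat_deriv S m (elementary_mat m j i) 1) (carrier (letterplace S m))"
  unfolding polarization_def
proof (rule the_equality)
  let ?D = "restrict (mat_deriv S m (elementary_mat m j i) 1) (carrier (letterplace S m))"
  have gen: "?D (lp_gen S m x k) = (if k = i then lp_gen S m x j else \<zero>\<^bsub>letterplace S m\<^esub>)"
    if "x \<in> S" "k \<in> {1..m}" for x k
    using that assms lp_gen_closed[OF that] mat_deriv_1_gen[OF that, of "elementary_mat m j i"]
    by (simp add: letterplace_def mat_direction_elementary)
  then show "derivation (letterplace S m) ?D \<and> (\<forall>x\<in>S. \<forall>k\<in>{1..m}.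
      ?D (lp_gen S m x k) = (if k = i then lp_gen S m x j else \<zero>\<^bsub>letterplace S m\<^esub>))"
    using derivation_mat_deriv by blast
  fix D assume D: "derivation (letterplace S m) D \<and> (\<forall>x\<in>S. \<forall>k\<in>{1..m}.
      D (lp_gen S m x k) = (if k = i then lp_gen S m x j else \<zero>\<^bsub>letterplace S m\<^esub>))"
  show "D = ?D"
  proof (rule derivation_unique)
    show "D (lp_gen S m x k) = ?D (lp_gen S m x k)" if "x \<in> S" "k \<in> {1..m}" for x k
      unfolding gen[OF that] using D that by blast
  qed (use D derivation_mat_deriv in blast)+
qed

text \<open>
  For \<open>i \<noteq> j\<close> a letter moved from place \<open>i\<close> to place \<open>j\<close> cannot be moved again, so the \<open>h\<close>-th
  power of the polarization is \<open>h!\<close> times the higher derivation. Division by \<open>h!\<close> is unique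
  because there is no torsion.
\<close>

lemma divided_power_eq:
  assumes ij: "i \<in> {1..m}" "j \<in> {1..m}" "i \<noteq> j" and f: "f \<in> carrier (letterplace S m)"
  shows "divided_power (letterplace S m) (polarization S m j i) h f = mat_deriv S m (elementary_mat m j i) h f"
proof -
  let ?L = "letterplace S m" and ?D = "mat_deriv S m (elementary_mat m j i)"
  have f': "f \<in> carrier (Skew (S \<times> {1..m}))" using f by (simp add: letterplace_def)
  have vanish: "?D 1 (mat_direction S m (elementary_mat m j i) p) = \<zero>\<^bsub>Skew (S \<times> {1..m})\<^esub>"
    if "p \<in> S \<times> {1..m}" for p
  proof -
    obtain x k where "p = (x, k)" by (cases p)
    then have p: "p = (x, k)" "x \<in> S" "k \<in> {1..m}" using that by simp_all
    then show ?thesis using ij mat_deriv_1_gen[OF p(2) ij(2), of "elementary_mat m j i"]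
      by (simp add: mat_direction_elementary MD.D_zero)
  qed
  have pow: "(polarization S m j i ^^ n) f = (?D 1 ^^ n) f \<and> (?D 1 ^^ n) f \<in> carrier ?L" for n
    using f' by (induction n) (simp_all add: polarization_eq[OF ij(2)] letterplace_def)
  have int_nat: "[int n] \<cdot>\<^bsub>Skew (S \<times> {1..m})\<^esub> a = [n] \<cdot>\<^bsub>Skew (S \<times> {1..m})\<^esub> a" for n a
    by (simp add: add_pow_int_ge)
  have fact: "[(fact h :: nat)] \<cdot>\<^bsub>?L\<^esub> ?D h f = (polarization S m j i ^^ h) f"
    using MD.D_1_funpow[OF vanish f', of h] pow[of h] int_nat[of "fact h"] by (simp add: letterplace_def)
  have "(THE g. g \<in> carrier ?L \<and> [(fact h :: nat)] \<cdot>\<^bsub>?L\<^esub> g = (polarization S m j i ^^ h) f) = ?D h f"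
  proof (rule the_equality)
    fix g assume g: "g \<in> carrier ?L \<and> [(fact h :: nat)] \<cdot>\<^bsub>?L\<^esub> g = (polarization S m j i ^^ h) f"
    let ?d = "g \<ominus>\<^bsub>Skew (S \<times> {1..m})\<^esub> ?D h f"
    have g': "g \<in> carrier (Skew (S \<times> {1..m}))" using g by (simp add: letterplace_def)
    have "[(fact h :: int)] \<cdot>\<^bsub>Skew (S \<times> {1..m})\<^esub> g = [(fact h :: int)] \<cdot>\<^bsub>Skew (S \<times> {1..m})\<^esub> ?D h f"
      using g fact int_nat[of "fact h"] by (simp add: letterplace_def)
    then have "[(fact h :: int)] \<cdot>\<^bsub>Skew (S \<times> {1..m})\<^esub> ?d = \<zero>\<^bsub>Skew (S \<times> {1..m})\<^esub>"
      using g' f' by (simp add: a_minus_def Sk.int_mult_add_right Sk.int_mult_minus_right Sk.r_neg)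
    from skew_torsion_free[OF _ _ this] have "?d = \<zero>\<^bsub>Skew (S \<times> {1..m})\<^esub>"
      using g' f' by simp
    moreover have "?d \<oplus>\<^bsub>Skew (S \<times> {1..m})\<^esub> ?D h f = g"
      using g' f' by (simp add: a_minus_def Sk.a_assoc Sk.l_neg)
    ultimately show "g = ?D h f" using f' by simp
  qed (use fact f' in \<open>simp add: letterplace_def\<close>)
  then show ?thesis using f by (simp add: divided_power_def)
qed

subsection \<open>Polarization of biproducts\<close>

lemma placement_sum_lp_closed:
  "w \<in> lists S \<Longrightarrow> placement_sum (Skew (S \<times> {1..m})) (lp_gen S m) m P w \<in> carrier (Skew (S \<times> {1..m}))"
  by (rule Sk.placement_sum_closed) (auto simp: in_lists_conv_set intro!: lp_gen_closed)

lemma mat_deriv_gen_mult: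
  assumes "x \<in> S" "k \<in> {1..m}" "j \<in> {1..m}" "a \<in> carrier (Skew (S \<times> {1..m}))"
  shows "mat_deriv S m (elementary_mat m j i) (Suc h) (lp_gen S m x k \<otimes>\<^bsub>Skew (S \<times> {1..m})\<^esub> a) =
    (lp_gen S m x k \<otimes>\<^bsub>Skew (S \<times> {1..m})\<^esub> mat_deriv S m (elementary_mat m j i) (Suc h) a) \<oplus>\<^bsub>Skew (S \<times> {1..m})\<^esub>
    (if k = i then lp_gen S m x j \<otimes>\<^bsub>Skew (S \<times> {1..m})\<^esub> mat_deriv S m (elementary_mat m j i) h a
      else \<zero>\<^bsub>Skew (S \<times> {1..m})\<^esub>)"
proof -
  have "(x, k) \<in> S \<times> {1..m}" using assms by simp
  from MD.D_letter_mult[OF this assms(4), of "elementary_mat m j i" h] show ?thesis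
    using assms lp_gen_closed[OF assms(1,3)] by (simp add: lp_gen_def mat_direction_elementary[unfolded lp_gen_def])
qed

text \<open>
  The operator moves \<open>h\<close> letters from place \<open>i\<close> to place \<open>j\<close> in all ways. A resulting placement
  arises once for each choice of the \<open>h\<close> moved letters among the \<open>P j + h\<close> letters that are now
  in place \<open>j\<close>, hence the binomial coefficient. Along the word this becomes Pascal's rule,
  applied when the first letter ends up in place \<open>j\<close>.
\<close>

lemma mat_deriv_placement_sum:
  assumes ij: "i \<in> {1..m}" "j \<in> {1..m}" "i \<noteq> j" and w: "w \<in> lists S"
  shows "mat_deriv S m (elementary_mat m j i) h (placement_sum (Skew (S \<times> {1..m})) (lp_gen S m) m P w) =
    (if h \<le> P i then [int ((P j + h) choose h)] \<cdot>\<^bsub>Skew (S \<times> {1..m})\<^esub>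
        placement_sum (Skew (S \<times> {1..m})) (lp_gen S m) m (P(i := P i - h, j := P j + h)) w
      else \<zero>\<^bsub>Skew (S \<times> {1..m})\<^esub>)"
  using w
proof (induction w arbitrary: P h rule: list.induct)
  case Nil
  let ?L = "Skew (S \<times> {1..m})"
  show ?case
  proof (cases h)
    case 0
    then show ?thesis by (simp add: MD.D_0)
  next
    case (Suc h')
    then have "\<not> (\<forall>k\<in>{1..m}. (P(i := P i - h, j := P j + h)) k = 0)" using ij by (auto intro!: bexI[of _ j])
    then show ?thesis using Suc ij by (auto simp: MD.D_one MD.D_zero)
  qed
next
  case (Cons x w)
  let ?L = "Skew (S \<times> {1..m})" and ?D = "mat_deriv S m (elementary_mat m j i)"
  let ?B = "\<lambda>P. placement_sum ?L (lp_gen S m) m P w"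
  let ?c = "lp_gen S m x"
  have x: "x \<in> S" and w: "w \<in> lists S" using Cons.prems by simp_all
  have c: "?c k \<in> carrier ?L" if "k \<in> {1..m}" for k using lp_gen_closed[OF x that] .
  have B: "?B P \<in> carrier ?L" for P by (rule placement_sum_lp_closed[OF w])
  have IH: "?D h (?B P) = (if h \<le> P i then [int ((P j + h) choose h)] \<cdot>\<^bsub>?L\<^esub> ?B (P(i := P i - h, j := P j + h)) else \<zero>\<^bsub>?L\<^esub>)"
    for h P by (rule Cons.IH[OF w])
  show ?case
  proof (cases h)
    case 0
    then show ?thesis using placement_sum_lp_closed[OF Cons.prems] by (simp add: MD.D_0 del: placement_sum.simps)
  next
    case (Suc h')
    let ?Q = "\<lambda>k. P(k := P k - 1)"
    let ?P = "P(i := P i - h, j := P j + h)"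
    define u where "u k = (if P k = 0 then \<zero>\<^bsub>?L\<^esub> else ?c k \<otimes>\<^bsub>?L\<^esub> ?D h (?B (?Q k)))" for k
    define e where "e = (if P i = 0 then \<zero>\<^bsub>?L\<^esub> else ?c j \<otimes>\<^bsub>?L\<^esub> ?D h' (?B (?Q i)))"
    have u: "u k \<in> carrier ?L" if "k \<in> {1..m}" for k using c[OF that] B by (simp add: u_def)
    have e: "e \<in> carrier ?L" using c[OF ij(2)] B by (simp add: e_def)
    have "?D h (placement_sum ?L (lp_gen S m) m P (x # w)) =
        (\<Oplus>\<^bsub>?L\<^esub>k\<in>{1..m}. ?D h (if P k = 0 then \<zero>\<^bsub>?L\<^esub> else ?c k \<otimes>\<^bsub>?L\<^esub> ?B (?Q k)))"
      unfolding placement_sum.simps using c B by (intro MD.D_finsum) auto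
    also have "\<dots> = (\<Oplus>\<^bsub>?L\<^esub>k\<in>{1..m}. u k \<oplus>\<^bsub>?L\<^esub> (if i = k then e else \<zero>\<^bsub>?L\<^esub>))"
    proof (rule Sk.finsum_cong')
      fix k assume k: "k \<in> {1..m}"
      show "?D h (if P k = 0 then \<zero>\<^bsub>?L\<^esub> else ?c k \<otimes>\<^bsub>?L\<^esub> ?B (?Q k)) = u k \<oplus>\<^bsub>?L\<^esub> (if i = k then e else \<zero>\<^bsub>?L\<^esub>)"
        using mat_deriv_gen_mult[OF x k ij(2) B, of i h'] c[OF k] B by (auto simp: u_def e_def Suc MD.D_zero)
    qed (use u e in auto)
    also have "\<dots> = (\<Oplus>\<^bsub>?L\<^esub>k\<in>{1..m}. u k) \<oplus>\<^bsub>?L\<^esub> (\<Oplus>\<^bsub>?L\<^esub>k\<in>{1..m}. if i = k then e else \<zero>\<^bsub>?L\<^esub>)"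
      using u e by (intro Sk.finsum_addf) auto
    also have "(\<Oplus>\<^bsub>?L\<^esub>k\<in>{1..m}. if i = k then e else \<zero>\<^bsub>?L\<^esub>) = e"
      using ij e by (intro Sk.add.finprod_singleton) auto
    \<comment> \<open>The term with the first letter moved from \<open>i\<close> to \<open>j\<close> is regrouped with the letter in place \<open>j\<close>.\<close>
    also have "e = (\<Oplus>\<^bsub>?L\<^esub>k\<in>{1..m}. if j = k then e else \<zero>\<^bsub>?L\<^esub>)"
      using ij e by (intro Sk.add.finprod_singleton[symmetric]) auto
    also have "(\<Oplus>\<^bsub>?L\<^esub>k\<in>{1..m}. u k) \<oplus>\<^bsub>?L\<^esub> \<dots> = (\<Oplus>\<^bsub>?L\<^esub>k\<in>{1..m}. u k \<oplus>\<^bsub>?L\<^esub> (if j = k then e else \<zero>\<^bsub>?L\<^esub>))"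
      using u e by (intro Sk.finsum_addf[symmetric]) auto
    finally have lhs: "?D h (placement_sum ?L (lp_gen S m) m P (x # w)) =
        (\<Oplus>\<^bsub>?L\<^esub>k\<in>{1..m}. u k \<oplus>\<^bsub>?L\<^esub> (if j = k then e else \<zero>\<^bsub>?L\<^esub>))" .
    show ?thesis
    proof (cases "h \<le> P i")
      case False
      have "(\<Oplus>\<^bsub>?L\<^esub>k\<in>{1..m}. u k \<oplus>\<^bsub>?L\<^esub> (if j = k then e else \<zero>\<^bsub>?L\<^esub>)) = (\<Oplus>\<^bsub>?L\<^esub>k\<in>{1..m}. \<zero>\<^bsub>?L\<^esub>)"
      proof (rule Sk.finsum_cong')
        fix k assume k: "k \<in> {1..m}"
        have "u k = \<zero>\<^bsub>?L\<^esub>" using False c[OF k] ij by (auto simp: u_def IH)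
        moreover have "e = \<zero>\<^bsub>?L\<^esub>" using False c[OF ij(2)] Suc by (auto simp: e_def IH)
        ultimately show "u k \<oplus>\<^bsub>?L\<^esub> (if j = k then e else \<zero>\<^bsub>?L\<^esub>) = \<zero>\<^bsub>?L\<^esub>" by simp
      qed auto
      then show ?thesis using False by (simp only: lhs if_False) simp
    next
      case True
      define C where "C = int ((P j + h) choose h)"
      define b where "b k = (if ?P k = 0 then \<zero>\<^bsub>?L\<^esub> else ?c k \<otimes>\<^bsub>?L\<^esub> ?B (?P(k := ?P k - 1)))" for k
      have b: "b k \<in> carrier ?L" if "k \<in> {1..m}" for k using c[OF that] B by (simp add: b_def)
      have "(\<Oplus>\<^bsub>?L\<^esub>k\<in>{1..m}. u k \<oplus>\<^bsub>?L\<^esub> (if j = k then e else \<zero>\<^bsub>?L\<^esub>)) = (\<Oplus>\<^bsub>?L\<^esub>k\<in>{1..m}. [C] \<cdot>\<^bsub>?L\<^esub> b k)"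
      proof (rule Sk.finsum_cong')
        fix k assume k: "k \<in> {1..m}"
        consider "k \<noteq> i" "k \<noteq> j" | "k = i" | "k = j" by blast
        then show "u k \<oplus>\<^bsub>?L\<^esub> (if j = k then e else \<zero>\<^bsub>?L\<^esub>) = [C] \<cdot>\<^bsub>?L\<^esub> b k"
        proof cases
          case 1
          have "(?Q k)(i := (?Q k) i - h, j := (?Q k) j + h) = ?P(k := ?P k - 1)"
            using 1 ij by (auto simp: fun_eq_iff)
          then show ?thesis using 1 True c[OF k] B ij u[OF k]
            by (auto simp: u_def b_def IH C_def Sk.add_pow_rdistr_int)
        next
          case 2
          have "P i \<noteq> 0" using True Suc by simp
          show ?thesis
          proof (cases "h = P i")
            case True
            then show ?thesis using 2 ij \<open>P i \<noteq> 0\<close> c[OF k] by (auto simp: u_def b_def IH)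
          next
            case False
            have "(?Q i)(i := (?Q i) i - h, j := (?Q i) j + h) = ?P(i := ?P i - 1)"
              using ij by (auto simp: fun_eq_iff)
            moreover have "h \<le> P i - 1" using False True by simp
            ultimately show ?thesis using 2 False ij \<open>P i \<noteq> 0\<close> c[OF k] B True u[OF k]
              by (auto simp: u_def b_def IH C_def Sk.add_pow_rdistr_int)
          qed
        next
          case 3
          have Pi: "P i \<noteq> 0" using True Suc by simp
          let ?y = "?c j \<otimes>\<^bsub>?L\<^esub> ?B (P(i := P i - h, j := P j + h'))"
          have y: "?y \<in> carrier ?L" using c[OF ij(2)] B by simp
          have "(?Q i)(i := (?Q i) i - h', j := (?Q i) j + h') = P(i := P i - h, j := P j + h')"
            using ij Suc by (auto simp: fun_eq_iff)
          moreover have "h' \<le> P i - 1" using True Suc by simp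
          ultimately have e_eq: "e = [int ((P j + h') choose h')] \<cdot>\<^bsub>?L\<^esub> ?y"
            using Pi ij True Suc c[OF ij(2)] B by (simp add: e_def IH Sk.add_pow_rdistr_int)
          have u_eq: "u j = [int (if P j = 0 then 0 else (P j + h') choose h)] \<cdot>\<^bsub>?L\<^esub> ?y"
          proof (cases "P j = 0")
            case False
            have "(?Q j)(i := (?Q j) i - h, j := (?Q j) j + h) = P(i := P i - h, j := P j + h')"
              using ij Suc False by (auto simp: fun_eq_iff)
            moreover have "P j - 1 + h = P j + h'" using False Suc by simp
            ultimately show ?thesis using False ij True c[OF ij(2)] B by (simp add: u_def IH Sk.add_pow_rdistr_int)
          qed (simp add: u_def)
          have b_eq: "b j = ?y"
          proof -
            have "?P(j := ?P j - 1) = P(i := P i - h, j := P j + h')" using ij Suc by (auto simp: fun_eq_iff)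
            then show ?thesis using Suc by (simp add: b_def)
          qed
          have "C = int (if P j = 0 then 0 else (P j + h') choose h) + int ((P j + h') choose h')"
            unfolding C_def Suc by (cases "P j") simp_all
          then show ?thesis using 3 y by (simp add: e_eq u_eq b_eq Sk.int_mult_add_left)
        qed
      qed (use b in auto)
      also have "\<dots> = [C] \<cdot>\<^bsub>?L\<^esub> (\<Oplus>\<^bsub>?L\<^esub>k\<in>{1..m}. b k)"
        using b by (intro add_hom_finsum[OF Sk.ring_axioms Sk.ring_axioms Sk.int_mult_add_hom, symmetric]) auto
      also have "(\<Oplus>\<^bsub>?L\<^esub>k\<in>{1..m}. b k) = placement_sum ?L (lp_gen S m) m ?P (x # w)"
        by (simp only: b_def placement_sum.simps)
      finally show ?thesis unfolding lhs C_def using True by (simp only: if_True)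
    qed
  qed
qed

text \<open>
  Each product in the sum has exactly \<open>P i\<close> letters in place \<open>i\<close>.
\<close>

lemma mat_deriv_placement_sum_diag:
  assumes i: "i \<in> {1..m}" and w: "w \<in> lists S"
  shows "mat_deriv S m (elementary_mat m i i) 1 (placement_sum (Skew (S \<times> {1..m})) (lp_gen S m) m P w) =
    [int (P i)] \<cdot>\<^bsub>Skew (S \<times> {1..m})\<^esub> placement_sum (Skew (S \<times> {1..m})) (lp_gen S m) m P w"
  using w
proof (induction w arbitrary: P rule: list.induct)
  case Nil
  then show ?case using i by (auto simp: MD.D_one MD.D_zero)
next
  case (Cons x w)
  let ?L = "Skew (S \<times> {1..m})" and ?D = "mat_deriv S m (elementary_mat m i i)"
  let ?B = "\<lambda>P. placement_sum ?L (lp_gen S m) m P w"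
  let ?c = "lp_gen S m x" and ?Q = "\<lambda>k. P(k := P k - 1)"
  have x: "x \<in> S" and w: "w \<in> lists S" using Cons.prems by simp_all
  have c: "?c k \<in> carrier ?L" if "k \<in> {1..m}" for k using lp_gen_closed[OF x that] .
  have B: "?B P \<in> carrier ?L" for P by (rule placement_sum_lp_closed[OF w])
  let ?b = "\<lambda>k. if P k = 0 then \<zero>\<^bsub>?L\<^esub> else ?c k \<otimes>\<^bsub>?L\<^esub> ?B (?Q k)"
  have b: "?b k \<in> carrier ?L" if "k \<in> {1..m}" for k using c[OF that] B by simp
  have "?D 1 (placement_sum ?L (lp_gen S m) m P (x # w)) = (\<Oplus>\<^bsub>?L\<^esub>k\<in>{1..m}. ?D 1 (?b k))"
    unfolding placement_sum.simps using b by (intro MD.D_finsum) auto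
  also have "\<dots> = (\<Oplus>\<^bsub>?L\<^esub>k\<in>{1..m}. [int (P i)] \<cdot>\<^bsub>?L\<^esub> ?b k)"
  proof (rule Sk.finsum_cong')
    fix k assume k: "k \<in> {1..m}"
    have IH: "?D 1 (?B (?Q k)) = [int (?Q k i)] \<cdot>\<^bsub>?L\<^esub> ?B (?Q k)" by (rule Cons.IH[OF w])
    have D: "?D 1 (?c k \<otimes>\<^bsub>?L\<^esub> ?B (?Q k)) = (?c k \<otimes>\<^bsub>?L\<^esub> ([int (?Q k i)] \<cdot>\<^bsub>?L\<^esub> ?B (?Q k))) \<oplus>\<^bsub>?L\<^esub>
        (if k = i then ?c i \<otimes>\<^bsub>?L\<^esub> ?B (?Q k) else \<zero>\<^bsub>?L\<^esub>)"
      using mat_deriv_gen_mult[OF x k i B[of "?Q k"], where i = i and h = 0, folded One_nat_def]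
      by (simp only: IH MD.D_0[OF B])
    show "?D 1 (?b k) = [int (P i)] \<cdot>\<^bsub>?L\<^esub> ?b k"
    proof (cases "P k = 0")
      case True
      then show ?thesis by (simp add: MD.D_zero)
    next
      case False
      let ?y = "?c k \<otimes>\<^bsub>?L\<^esub> ?B (?Q k)"
      have y: "?y \<in> carrier ?L" using c[OF k] B by simp
      have "k = i \<Longrightarrow> int (P i) = int (P i - 1) + 1" using False by simp
      then have "k = i \<Longrightarrow> [int (P i)] \<cdot>\<^bsub>?L\<^esub> ?y = [int (P i - 1)] \<cdot>\<^bsub>?L\<^esub> ?y \<oplus>\<^bsub>?L\<^esub> ?y"
        using y by (simp only: Sk.int_mult_add_left Sk.int_mult_1)
      then show ?thesis using False y c[OF k] B by (auto simp: D Sk.add_pow_rdistr_int)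
    qed
  qed (use b in auto)
  also have "\<dots> = [int (P i)] \<cdot>\<^bsub>?L\<^esub> (\<Oplus>\<^bsub>?L\<^esub>k\<in>{1..m}. ?b k)"
    using b by (intro add_hom_finsum[OF Sk.ring_axioms Sk.ring_axioms Sk.int_mult_add_hom, symmetric]) auto
  finally show ?case by simp
qed

context letterplace_ideals
begin

lemma int_mult_J: "a \<in> J \<Longrightarrow> [(k::int)] \<cdot>\<^bsub>letterplace S m\<^esub> a \<in> J"
proof -
  interpret L: ring "letterplace S m" by (rule letterplace_ring)
  interpret J: ideal J "letterplace S m" by (rule J_ideal)
  assume a: "a \<in> J"
  have "[k] \<cdot>\<^bsub>letterplace S m\<^esub> a = ([k] \<cdot>\<^bsub>letterplace S m\<^esub> \<one>\<^bsub>letterplace S m\<^esub>) \<otimes>\<^bsub>letterplace S m\<^esub> a"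
    using J.a_Hcarr[OF a] by (simp add: L.add_pow_ldistr_int)
  then show ?thesis using J.I_l_closed[OF a] by simp
qed

lemma biproduct_in_J:
  "dependent_in S indep (set w) \<Longrightarrow> (\<Sum>k\<in>{1..m}. P k) = length w \<Longrightarrow> biproduct S m P w \<in> J"
  unfolding J_eq
  by (rule subsetD[OF ring.genideal_self[OF letterplace_ring biproduct_gens_closed]]) (auto simp: biproduct_gens_def)

text \<open>
  The Leibniz rule for \<open>D h\<close> involves all \<open>D i\<close> with \<open>i \<le> h\<close>, so invariance passes from the
  generators to the ideal only for an initial segment of orders at once.
\<close>

lemma mat_deriv_J:
  assumes gens: "\<And>h P w. dependent_in S indep (set w) \<Longrightarrow> (\<Sum>k\<in>{1..m}. P k) = length w \<Longrightarrow> h \<le> N \<Longrightarrow>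
      mat_deriv S m M h (biproduct S m P w) \<in> J"
    and a: "a \<in> J" and h: "h \<le> N"
  shows "mat_deriv S m M h a \<in> J"
proof -
  let ?L = "letterplace S m" and ?D = "mat_deriv S m M"
  interpret L: ring ?L by (rule letterplace_ring)
  interpret J: ideal J ?L by (rule J_ideal)
  have D_cl: "?D h a \<in> carrier ?L" if "a \<in> carrier ?L" for a h using that by (simp add: letterplace_def)
  note D_mult = MD.D_mult[where S = S and m = m, folded letterplace_def]
  have fin: "(\<Oplus>\<^bsub>?L\<^esub>i\<in>I. f i) \<in> J" if "\<And>i. i \<in> I \<Longrightarrow> f i \<in> J" for I :: "nat set" and f
    using that
  proof (induction I rule: infinite_finite_induct)
    case (insert i I)
    then have "f \<in> insert i I \<rightarrow> carrier ?L" using J.a_Hcarr by blast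
    then show ?case using insert by simp
  qed simp_all
  let ?K = "{a \<in> J. \<forall>h\<le>N. ?D h a \<in> J}"
  have "ideal ?K ?L"
  proof (rule idealI[OF letterplace_ring])
    show "subgroup ?K (add_monoid ?L)"
    proof (rule L.add.subgroupI)
      show "?K \<noteq> {}" using J.zero_closed MD.D_zero[of S m M] by (auto simp: letterplace_def)
      fix a assume a: "a \<in> ?K"
      then have "a \<in> carrier ?L" using J.a_Hcarr by blast
      then show "\<ominus>\<^bsub>?L\<^esub> a \<in> ?K"
        using a MD.D_neg[of a S m M] by (simp add: letterplace_def J.a_inv_closed[unfolded letterplace_def])
      fix b assume b: "b \<in> ?K"
      then have "b \<in> carrier ?L" using J.a_Hcarr by blast
      with \<open>a \<in> carrier ?L\<close> show "a \<oplus>\<^bsub>?L\<^esub> b \<in> ?K"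
        using a b MD.D_add[of a S m b M] by (simp add: letterplace_def J.a_closed[unfolded letterplace_def])
    qed (use J.a_Hcarr in auto)
    fix a x assume a: "a \<in> ?K" and x: "x \<in> carrier ?L"
    then have a_cl: "a \<in> carrier ?L" using J.a_Hcarr by blast
    show "x \<otimes>\<^bsub>?L\<^esub> a \<in> ?K"
      using a x a_cl by (auto simp: D_mult D_cl intro!: fin J.I_l_closed)
    show "a \<otimes>\<^bsub>?L\<^esub> x \<in> ?K"
      using a x a_cl by (auto simp: D_mult D_cl intro!: fin J.I_r_closed)
  qed
  moreover have "biproduct_gens \<subseteq> ?K"
    using gens biproduct_in_J by (auto simp: biproduct_gens_def)
  ultimately have "J \<subseteq> ?K" unfolding J_eq by (rule L.genideal_minimal)
  then show ?thesis using a h by blast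
qed

lemma sum_move:
  fixes P :: "nat \<Rightarrow> nat"
  assumes "i \<in> {1..m}" "j \<in> {1..m}" "i \<noteq> j" "h \<le> P i"
  shows "(\<Sum>k\<in>{1..m}. (P(i := P i - h, j := P j + h)) k) = (\<Sum>k\<in>{1..m}. P k)"
proof -
  have split: "(\<Sum>k\<in>{1..m}. f k) = f i + f j + (\<Sum>k\<in>{1..m} - {i, j}. f k)" for f :: "nat \<Rightarrow> nat"
  proof -
    have "(\<Sum>k\<in>{1..m}. f k) = (\<Sum>k\<in>{i, j}. f k) + (\<Sum>k\<in>{1..m} - {i, j}. f k)"
      using assms(1,2) by (intro sum.subset_diff[THEN trans, OF _ _ add.commute]) auto
    then show ?thesis using assms(3) by simp
  qed
  have "(\<Sum>k\<in>{1..m} - {i, j}. (P(i := P i - h, j := P j + h)) k) = (\<Sum>k\<in>{1..m} - {i, j}. P k)"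
    by (rule sum.cong) auto
  then show ?thesis unfolding split[of P] split[of "P(i := P i - h, j := P j + h)"] using assms(3,4) by simp
qed

lemma elementary_deriv_J:
  assumes ij: "i \<in> {1..m}" "j \<in> {1..m}" "i \<noteq> j" and a: "a \<in> J"
  shows "mat_deriv S m (elementary_mat m j i) h a \<in> J"
proof (rule mat_deriv_J[OF _ a order_refl])
  interpret J: ideal J "letterplace S m" by (rule J_ideal)
  fix h P w assume w: "dependent_in S indep (set w)" "(\<Sum>k\<in>{1..m}. P k) = length w"
  note wl = dependent_lists[OF w(1)]
  show "mat_deriv S m (elementary_mat m j i) h (biproduct S m P w) \<in> J"
  proof (cases "h \<le> P i")
    case True
    then have "mat_deriv S m (elementary_mat m j i) h (biproduct S m P w) =
        [int ((P j + h) choose h)] \<cdot>\<^bsub>letterplace S m\<^esub> biproduct S m (P(i := P i - h, j := P j + h)) w"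
      by (simp only: biproduct_placement_sum[OF wl] mat_deriv_placement_sum[OF ij wl] letterplace_def if_True)
    moreover have "biproduct S m (P(i := P i - h, j := P j + h)) w \<in> J"
      using sum_move[of i j h P] ij True w by (intro biproduct_in_J) simp_all
    ultimately show ?thesis by (simp only: int_mult_J)
  next
    case False
    then have "mat_deriv S m (elementary_mat m j i) h (biproduct S m P w) = \<zero>\<^bsub>letterplace S m\<^esub>"
      by (simp only: biproduct_placement_sum[OF wl] mat_deriv_placement_sum[OF ij wl] letterplace_def if_False)
    then show ?thesis using J.zero_closed by simp
  qed
qed

lemma elementary_deriv_1_J:
  assumes i: "i \<in> {1..m}" and j: "j \<in> {1..m}" and a: "a \<in> J"
  shows "mat_deriv S m (elementary_mat m j i) 1 a \<in> J"
proof (cases "i = j")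
  case False
  then show ?thesis using elementary_deriv_J assms by blast
next
  case True
  show ?thesis
  proof (rule mat_deriv_J[OF _ a order_refl])
    fix h P w assume w: "dependent_in S indep (set w)" "(\<Sum>k\<in>{1..m}. P k) = length w" and h: "h \<le> (1::nat)"
    note wl = dependent_lists[OF w(1)]
    have in_J: "biproduct S m P w \<in> J" by (rule biproduct_in_J[OF w])
    have "h = 0 \<or> h = 1" using h by linarith
    then show "mat_deriv S m (elementary_mat m j i) h (biproduct S m P w) \<in> J"
    proof
      assume "h = 0"
      then show ?thesis using in_J biproduct_closed[OF wl, of m P] by (simp add: letterplace_def MD.D_0)
    next
      assume "h = 1"
      moreover have "mat_deriv S m (elementary_mat m j i) 1 (biproduct S m P w) =
          [int (P i)] \<cdot>\<^bsub>letterplace S m\<^esub> biproduct S m P w"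
        using True i mat_deriv_placement_sum_diag[OF i wl]
        by (simp add: biproduct_placement_sum[OF wl] letterplace_def)
      ultimately show ?thesis using int_mult_J[OF in_J] by simp
    qed
  qed
qed

end

section \<open>Geometric products\<close>

lemma (in skew_direction) D_word_eq_zero:
  "w \<in> lists X \<Longrightarrow> length w < h \<Longrightarrow> D h (skew_mon X w) = \<zero>\<^bsub>Skew X\<^esub>"
proof (induction w arbitrary: h rule: list.induct)
  case Nil
  then show ?case by (simp add: skew_mon_Nil D_one)
next
  case (Cons x w)
  then obtain h' where h: "h = Suc h'" "length w < h'" by (cases h) auto
  have "x \<in> X" "w \<in> lists X" using Cons.prems by simp_all
  then show ?case using Cons.IH[of h'] Cons.IH[of "Suc h'"] h skew_mon_Cons[of x X w]
    by (simp add: D_letter_mult)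
qed

text \<open>
  The two parts of a slice occupy the places \<open>a\<close> and \<open>b\<close> in either order, according to whether
  \<open>a < b\<close>; the map \<open>\<sigma>\<close> from the slots \<open>1\<close>, \<open>2\<close> to places covers both cases.
\<close>

lemma mat_deriv_place_word_placement_sum:
  assumes ab: "a \<in> {1..m}" "b \<in> {1..m}" "a \<noteq> b" and slots: "{sa, sb} = {1..2::nat}" "\<sigma> sa = a" "\<sigma> sb = b"
    and w: "w \<in> lists S"
  shows "placement_sum (Skew (S \<times> {1..m})) (\<lambda>y r. lp_gen S m y (\<sigma> r)) 2 P w =
    (if P sa + P sb = length w
     then mat_deriv S m (elementary_mat m b a) (P sb) (skew_mon (S \<times> {1..m}) (place_word a w))
     else \<zero>\<^bsub>Skew (S \<times> {1..m})\<^esub>)"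
  using w
proof (induction w arbitrary: P rule: list.induct)
  case Nil
  have "(\<forall>k\<in>{1..2}. P k = 0) \<longleftrightarrow> P sa + P sb = 0" unfolding slots(1)[symmetric] by simp
  then show ?case by (simp add: skew_mon_Nil MD.D_one)
next
  case (Cons x w)
  let ?X = "S \<times> {1..m}" and ?L = "Skew (S \<times> {1..m})" and ?D = "mat_deriv S m (elementary_mat m b a)"
  let ?w = "skew_mon ?X (place_word a w)"
  have x: "x \<in> S" and w: "w \<in> lists S" using Cons.prems by simp_all
  have s: "sa \<noteq> sb" using slots(2,3) ab(3) by auto
  have wc: "?w \<in> carrier ?L" by (intro skew_mon_closed place_word_lists w ab)
  note cl = lp_gen_closed[OF x ab(1)] lp_gen_closed[OF x ab(2)] wc
  have xa: "(x, a) \<in> ?X" using x ab by simp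
  have mon: "skew_mon ?X (place_word a (x # w)) = lp_gen S m x a \<otimes>\<^bsub>?L\<^esub> ?w"
    unfolding place_word_simps lp_gen_def by (rule skew_mon_Cons[OF xa place_word_lists[OF w ab(1)]])
  define f where "f r = (if P r = 0 then \<zero>\<^bsub>?L\<^esub> else lp_gen S m x (\<sigma> r) \<otimes>\<^bsub>?L\<^esub>
      placement_sum ?L (\<lambda>y r. lp_gen S m y (\<sigma> r)) 2 (P(r := P r - 1)) w)" for r
  have fa: "f sa = (if P sa = 0 then \<zero>\<^bsub>?L\<^esub> else if P sa - 1 + P sb = length w then lp_gen S m x a \<otimes>\<^bsub>?L\<^esub> ?D (P sb) ?w else \<zero>\<^bsub>?L\<^esub>)"
    using s cl by (simp add: f_def Cons.IH[OF w] slots(2,3))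
  have fb: "f sb = (if P sb = 0 then \<zero>\<^bsub>?L\<^esub> else if P sa + (P sb - 1) = length w then lp_gen S m x b \<otimes>\<^bsub>?L\<^esub> ?D (P sb - 1) ?w else \<zero>\<^bsub>?L\<^esub>)"
    using s cl by (simp add: f_def Cons.IH[OF w] slots(2,3))
  have fc: "f sa \<in> carrier ?L" "f sb \<in> carrier ?L" unfolding fa fb using cl by simp_all
  have "placement_sum ?L (\<lambda>y r. lp_gen S m y (\<sigma> r)) 2 P (x # w) = (\<Oplus>\<^bsub>?L\<^esub>r\<in>{sa, sb}. f r)"
    by (simp only: placement_sum.simps f_def slots(1))
  also have "\<dots> = f sa \<oplus>\<^bsub>?L\<^esub> f sb" using s fc by simp
  also have "\<dots> = (if P sa + P sb = length (x # w) then ?D (P sb) (lp_gen S m x a \<otimes>\<^bsub>?L\<^esub> ?w) else \<zero>\<^bsub>?L\<^esub>)"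
  proof (cases "P sa + P sb = length (x # w)")
    case False
    then have "f sa = \<zero>\<^bsub>?L\<^esub>" "f sb = \<zero>\<^bsub>?L\<^esub>" unfolding fa fb by auto
    then show ?thesis using False by simp
  next
    case True
    show ?thesis
    proof (cases "P sb")
      case 0
      then show ?thesis using True cl by (simp add: fa fb MD.D_0)
    next
      case (Suc h')
      have "?D (Suc h') ?w = \<zero>\<^bsub>?L\<^esub>" if "P sa = 0"
        using that True Suc by (intro MD.D_word_eq_zero place_word_lists w ab) simp
      then have "f sa = lp_gen S m x a \<otimes>\<^bsub>?L\<^esub> ?D (P sb) ?w"
        using True Suc cl by (auto simp: fa)
      moreover have "f sb = lp_gen S m x b \<otimes>\<^bsub>?L\<^esub> ?D h' ?w" using True Suc by (auto simp: fb)
      ultimately show ?thesis using True Suc mat_deriv_gen_mult[OF x ab(1,2) wc, of a h'] by simp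
    qed
  qed
  finally show ?case unfolding mon .
qed

lemma mat_deriv_place_word:
  assumes ab: "a \<in> {1..m}" "b \<in> {1..m}" "a \<noteq> b" and slots: "{sa, sb} = {1..2::nat}" "\<sigma> sa = a" "\<sigma> sb = b"
    and w: "w \<in> lists S" and P: "P sa = length w - h" "P sb = h"
  shows "mat_deriv S m (elementary_mat m b a) h (skew_mon (S \<times> {1..m}) (place_word a w)) =
    slice_sum (Skew (S \<times> {1..m})) 2 P w
      (\<lambda>V. skew_mon (S \<times> {1..m}) (place_word (\<sigma> 1) (V 1) @ place_word (\<sigma> 2) (V 2)))"
proof -
  let ?X = "S \<times> {1..m}" and ?L = "Skew (S \<times> {1..m})"
  let ?g = "\<lambda>y r. lp_gen S m y (\<sigma> r)"
  have \<sigma>: "\<sigma> r \<in> {1..m}" if "r \<in> {1..2}" for r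
    using that ab slots(2,3) unfolding slots(1)[symmetric] by auto
  have S: "x \<in> S" if "x \<in> set w" for x using that w by (auto simp: in_lists_conv_set)
  have "mat_deriv S m (elementary_mat m b a) h (skew_mon ?X (place_word a w)) = placement_sum ?L ?g 2 P w"
    unfolding mat_deriv_place_word_placement_sum[OF ab slots w] P
    by (cases "h \<le> length w") (auto intro!: MD.D_word_eq_zero place_word_lists w ab)
  also have "\<dots> = slice_sum ?L 2 P w (\<lambda>V. ring_list_prod ?L (map (\<lambda>k. ring_list_prod ?L (map (\<lambda>y. ?g y k) (V k))) [1..<Suc 2]))"
    by (rule Sk.slice_sum_placement_sum[symmetric]) (intro lp_gen_closed lp_gen_anti S \<sigma>; assumption)+
  also have "\<dots> = slice_sum ?L 2 P w (\<lambda>V. skew_mon ?X (place_word (\<sigma> 1) (V 1) @ place_word (\<sigma> 2) (V 2)))"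
  proof (rule slice_sum_cong[OF Sk.ring_axioms])
    fix I :: "nat \<Rightarrow> nat set"
    have \<sigma>12: "\<sigma> 1 \<in> {1..m}" "\<sigma> 2 \<in> {1..m}" using \<sigma> by simp_all
    have wl: "nths w (I k) \<in> lists S" for k by (rule nths_lists[OF w])
    have upt: "[1..<Suc 2] = [1, 2::nat]" by (simp add: upt_rec)
    have prod: "ring_list_prod ?L (map (\<lambda>y. lp_gen S m y k) u) = skew_mon ?X (place_word k u)"
      if "k \<in> {1..m}" "u \<in> lists S" for k u
      using lp_mon_eq[OF that(2,1)] by (simp add: lp_mon_def letterplace_def)
    note pl = place_word_lists[OF wl \<sigma>12(1)] place_word_lists[OF wl \<sigma>12(2)]
    show "ring_list_prod ?L (map (\<lambda>k. ring_list_prod ?L (map (\<lambda>y. ?g y k) (nths w (I k)))) [1..<Suc 2]) =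
        skew_mon ?X (place_word (\<sigma> 1) (nths w (I 1)) @ place_word (\<sigma> 2) (nths w (I 2)))"
      unfolding upt list.map prod[OF \<sigma>12(1) wl] prod[OF \<sigma>12(2) wl] skew_mon_append[OF pl]
      using pl by simp
    show "skew_mon ?X (place_word (\<sigma> 1) (nths w (I 1)) @ place_word (\<sigma> 2) (nths w (I 2))) \<in> carrier ?L"
      using pl by simp
  qed
  finally show ?thesis .
qed

definition segment :: "(nat \<Rightarrow> 'a list) \<Rightarrow> nat list \<Rightarrow> ('a \<times> nat) list" where
  "segment A ks = concat (map (\<lambda>k. place_word k (A k)) ks)"

lemma segment_lists: "A \<in> {1..m} \<rightarrow> lists S \<Longrightarrow> set ks \<subseteq> {1..m} \<Longrightarrow> segment A ks \<in> lists (S \<times> {1..m})"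
  unfolding segment_def by (rule concat_lists) (auto simp: Pi_iff subset_iff intro!: place_word_lists)

lemma segment_places: "p \<in> set (segment A ks) \<Longrightarrow> snd p \<in> set ks"
  by (auto simp: segment_def place_word_def)

lemma segment_cong: "(\<And>k. k \<in> set ks \<Longrightarrow> A k = B k) \<Longrightarrow> segment A ks = segment B ks"
  unfolding segment_def by (rule arg_cong[where f = concat]) simp

lemma length_segment: "distinct ks \<Longrightarrow> length (segment A ks) = (\<Sum>k\<in>set ks. length (A k))"
  by (induction ks) (simp_all add: segment_def)

lemma places_word_split2:
  assumes "c \<in> {1..m}" "d \<in> {1..m}" "c < d"
  shows "places_word m A = segment A [1..<c] @ place_word c (A c) @ segment A [Suc c..<d] @ place_word d (A d) @
    segment A [Suc d..<Suc m]"
proof -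
  have "[1..<Suc m] = [1..<c] @ c # [Suc c..<d] @ d # [Suc d..<Suc m]"
    using assms upt_split[of c m] upt_add_eq_append[of "Suc c" d "Suc m - d"] upt_conv_Cons[of d "Suc m"] by simp
  then show ?thesis by (simp add: places_word_def segment_def)
qed

text \<open>
  The words \<open>U\<close> and \<open>Z\<close> have no letter in place \<open>a\<close>, so the operator treats them as scalars.
\<close>

lemma Phi_mat_deriv_sandwich:
  assumes ab: "a \<in> {1..m}" "b \<in> {1..m}" "a \<noteq> b" and slots: "{sa, sb} = {1..2::nat}" "\<sigma> sa = a" "\<sigma> sb = b"
    and w: "w \<in> lists S" and P: "P sa = length w - h" "P sb = h"
    and U: "U \<in> lists (S \<times> {1..m})" "\<And>p. p \<in> set U \<Longrightarrow> snd p \<noteq> a"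
    and Z: "Z \<in> lists (S \<times> {1..m})" "\<And>p. p \<in> set Z \<Longrightarrow> snd p \<noteq> a"
  shows "Phi S m (mat_deriv S m (elementary_mat m b a) h (skew_mon (S \<times> {1..m}) (U @ place_word a w @ Z))) =
    slice_sum (SkewT S m) 2 P w
      (\<lambda>V. Phi S m (skew_mon (S \<times> {1..m}) (U @ (place_word (\<sigma> 1) (V 1) @ place_word (\<sigma> 2) (V 2)) @ Z)))"
proof -
  let ?X = "S \<times> {1..m}" and ?L = "Skew (S \<times> {1..m})" and ?D = "mat_deriv S m (elementary_mat m b a)"
  have free: "MD.parameter_free S m (elementary_mat m b a) (skew_mon ?X v)"
    if "v \<in> lists ?X" "\<And>p. p \<in> set v \<Longrightarrow> snd p \<noteq> a" for v
  proof (rule MD.parameter_free_word[OF that(1)])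
    fix p assume p: "p \<in> set v"
    obtain x k where xk: "p = (x, k)" by (cases p)
    have "p \<in> ?X" using p that(1) by (auto simp: in_lists_conv_set)
    then show "mat_direction S m (elementary_mat m b a) p = \<zero>\<^bsub>?L\<^esub>"
      using that(2)[OF p] ab(2) by (simp add: xk mat_direction_elementary)
  qed
  have \<sigma>: "\<sigma> 1 \<in> {1..m}" "\<sigma> 2 \<in> {1..m}"
  proof -
    have "1 \<in> {sa, sb}" "2 \<in> {sa, sb}" unfolding slots(1) by simp_all
    then show "\<sigma> 1 \<in> {1..m}" "\<sigma> 2 \<in> {1..m}" using ab slots(2,3) by auto
  qed
  have wa: "place_word a w \<in> lists ?X" by (rule place_word_lists[OF w ab(1)])
  have mon: "skew_mon ?X (U @ v @ Z) = skew_mon ?X U \<otimes>\<^bsub>?L\<^esub> (skew_mon ?X v \<otimes>\<^bsub>?L\<^esub> skew_mon ?X Z)"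
    if "v \<in> lists ?X" for v using that U(1) Z(1) by (simp add: skew_mon_append)
  let ?f = "\<lambda>x. Phi S m (skew_mon ?X U \<otimes>\<^bsub>?L\<^esub> (x \<otimes>\<^bsub>?L\<^esub> skew_mon ?X Z))"
  have f: "add_hom ?L (SkewT S m) ?f"
  proof (rule add_hom_compose[of _ ?L])
    show "add_hom ?L ?L (\<lambda>x. skew_mon ?X U \<otimes>\<^bsub>?L\<^esub> (x \<otimes>\<^bsub>?L\<^esub> skew_mon ?X Z))"
      using U(1) Z(1) by (intro add_homI) (simp_all add: Sk.l_distr Sk.r_distr)
    show "add_hom ?L (SkewT S m) (Phi S m)" using Phi_add_hom[of S m] by (simp add: letterplace_def)
  qed
  have pl: "place_word (\<sigma> 1) (nths w (I 1)) @ place_word (\<sigma> 2) (nths w (I 2)) \<in> lists ?X" for I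
    using place_word_lists[OF nths_lists[OF w] \<sigma>(1)] place_word_lists[OF nths_lists[OF w] \<sigma>(2)] by simp
  have "?D h (skew_mon ?X (U @ place_word a w @ Z)) =
      skew_mon ?X U \<otimes>\<^bsub>?L\<^esub> (?D h (skew_mon ?X (place_word a w)) \<otimes>\<^bsub>?L\<^esub> skew_mon ?X Z)"
    unfolding mon[OF wa]
    using MD.D_mult_const_left[OF free[OF U]] MD.D_mult_const_right[OF _ free[OF Z]] wa Z(1) by simp
  then have "Phi S m (?D h (skew_mon ?X (U @ place_word a w @ Z))) = ?f (?D h (skew_mon ?X (place_word a w)))"
    by simp
  also have "\<dots> = slice_sum (SkewT S m) 2 P w (\<lambda>V. ?f (skew_mon ?X (place_word (\<sigma> 1) (V 1) @ place_word (\<sigma> 2) (V 2))))"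
    unfolding mat_deriv_place_word[OF ab slots w P]
    by (rule slice_sum_add_hom[OF Sk.ring_axioms Te.ring_axioms f]) (rule skew_mon_closed[OF pl])
  also have "\<dots> = slice_sum (SkewT S m) 2 P w
      (\<lambda>V. Phi S m (skew_mon ?X (U @ (place_word (\<sigma> 1) (V 1) @ place_word (\<sigma> 2) (V 2)) @ Z)))"
  proof (rule slice_sum_cong[OF Te.ring_axioms])
    fix I
    show "?f (skew_mon ?X (place_word (\<sigma> 1) (nths w (I 1)) @ place_word (\<sigma> 2) (nths w (I 2)))) =
        Phi S m (skew_mon ?X (U @ (place_word (\<sigma> 1) (nths w (I 1)) @ place_word (\<sigma> 2) (nths w (I 2))) @ Z))"
      by (simp only: mon[OF pl])
    have "U @ (place_word (\<sigma> 1) (nths w (I 1)) @ place_word (\<sigma> 2) (nths w (I 2))) @ Z \<in> lists ?X"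
      using U(1) Z(1) pl[of I] by simp
    then show "Phi S m (skew_mon ?X (U @ (place_word (\<sigma> 1) (nths w (I 1)) @ place_word (\<sigma> 2) (nths w (I 2))) @ Z)) \<in> carrier (SkewT S m)"
      using ring_hom_closed[OF Phi_hom, of _ S m] by (simp add: letterplace_def)
  qed
  finally show ?thesis .
qed

lemma length_nths_partition:
  assumes "I \<in> ordered_partitions m P (length w)" "k \<in> {1..m}"
  shows "length (nths w (I k)) = P k"
proof -
  have "I k \<subseteq> {..<length w}" "card (I k) = P k" using assms by (auto simp: ordered_partitions_def)
  moreover from this have "{i. i < length w \<and> i \<in> I k} = I k" by auto
  ultimately show ?thesis by (simp add: length_nths)
qed

lemma slice_sum_scaled:
  assumes "ring R"
    and FG: "\<And>I. I \<in> ordered_partitions m P (length w) \<Longrightarrow> F (\<lambda>k. nths w (I k)) = [(c::int)] \<cdot>\<^bsub>R\<^esub> G (\<lambda>k. nths w (I k))"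
    and G: "\<And>I. I \<in> ordered_partitions m P (length w) \<Longrightarrow> G (\<lambda>k. nths w (I k)) \<in> carrier R"
  shows "slice_sum R m P w F = [c] \<cdot>\<^bsub>R\<^esub> slice_sum R m P w G"
proof -
  interpret R: ring R by fact
  have "slice_sum R m P w F = slice_sum R m P w (\<lambda>V. [c] \<cdot>\<^bsub>R\<^esub> G V)"
    by (rule slice_sum_cong[OF assms(1)]) (simp_all add: FG G)
  also have "\<dots> = [c] \<cdot>\<^bsub>R\<^esub> slice_sum R m P w G"
    by (rule slice_sum_add_hom[OF assms(1,1) R.int_mult_add_hom, symmetric]) (rule G)
  finally show ?thesis .
qed

lemma Phi_int:
  "w \<in> lists (S \<times> {1..m}) \<Longrightarrow> Phi S m ([(c::int)] \<cdot>\<^bsub>Skew (S \<times> {1..m})\<^esub> skew_mon (S \<times> {1..m}) w) =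
    [c] \<cdot>\<^bsub>SkewT S m\<^esub> Phi S m (skew_mon (S \<times> {1..m}) w)"
  using add_hom_int[OF letterplace_ring Te.ring_axioms Phi_add_hom, of "skew_mon (S \<times> {1..m}) w" S m c]
  by (simp add: letterplace_def)

text \<open>
  The \<open>h\<close> letters moved to place \<open>b\<close> first stand next to the remaining letters of place \<open>a\<close>.
  Sorting the word by places takes them past the factors strictly between \<open>a\<close> and \<open>b\<close>, which
  produces the sign in the geometric product.
\<close>

lemma Phi_mat_deriv_eq_geometric_mon:
  assumes ab: "a \<in> {1..m}" "b \<in> {1..m}" "a \<noteq> b" and A: "A \<in> {1..m} \<rightarrow> lists S"
  shows "Phi S m (mat_deriv S m (elementary_mat m b a) h (skew_mon (S \<times> {1..m}) (places_word m A))) =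
    geometric_mon S m h b a A"
proof -
  let ?X = "S \<times> {1..m}" and ?T = "SkewT S m" and ?w = "A a"
  have Aa: "A a \<in> lists S" and Ab: "A b \<in> lists S" using A ab by auto
  have nl: "nths ?w (I k) \<in> lists S" for I :: "nat \<Rightarrow> nat set" and k by (rule nths_lists[OF Aa])
  have seg: "segment A ks \<in> lists ?X" if "set ks \<subseteq> {1..m}" for ks by (rule segment_lists[OF A that])
  show ?thesis
  proof (cases "a < b")
    case True
    let ?U = "segment A [1..<a]" and ?M = "segment A [Suc a..<b]" and ?Y = "segment A [Suc b..<Suc m]"
    let ?Z = "?M @ place_word b (A b) @ ?Y"
    let ?P = "\<lambda>r. if r = 1 then length ?w - h else h"
    let ?\<sigma> = "\<lambda>r. if r = (1::nat) then a else b"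
    have lists: "?U \<in> lists ?X" "?M \<in> lists ?X" "?Y \<in> lists ?X" using ab by (auto intro!: seg)
    have len: "length ?M = (\<Sum>k\<in>{a<..<b}. length (A k))"
      by (simp add: length_segment atLeastSucLessThan_greaterThanLessThan)
    have slots: "{1, 2} = {1..2::nat}" by auto
    have "Phi S m (mat_deriv S m (elementary_mat m b a) h (skew_mon ?X (?U @ place_word a ?w @ ?Z))) =
        slice_sum ?T 2 ?P ?w (\<lambda>V. Phi S m (skew_mon ?X (?U @ (place_word (?\<sigma> 1) (V 1) @ place_word (?\<sigma> 2) (V 2)) @ ?Z)))"
    proof (rule Phi_mat_deriv_sandwich[OF ab slots _ _ Aa])
      show "?Z \<in> lists ?X" using lists place_word_lists[OF Ab ab(2)] by simp
      show "snd p \<noteq> a" if "p \<in> set ?U" for p using segment_places[OF that] by auto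
      show "snd p \<noteq> a" if "p \<in> set ?Z" for p
        using that ab(3) True by (auto simp: place_word_def dest!: segment_places)
    qed (use lists in auto)
    also have "\<dots> = [((-1::int) ^ (h * (\<Sum>k\<in>{a<..<b}. length (A k))))] \<cdot>\<^bsub>?T\<^esub>
        slice_sum ?T 2 ?P ?w (\<lambda>V. tensor_mon S m (A(a := V 1, b := V 2 @ A b)))"
    proof (rule slice_sum_scaled[OF Te.ring_axioms])
      fix I assume I: "I \<in> ordered_partitions 2 ?P (length ?w)"
      let ?v = "nths ?w (I 1)" and ?u = "nths ?w (I 2)"
      let ?B = "A(a := ?v, b := ?u @ A b)"
      have B: "?B \<in> {1..m} \<rightarrow> lists S" using A Ab nl by (auto simp: Pi_iff)
      show "tensor_mon S m ?B \<in> carrier ?T" by (rule tensor_mon_closed[OF B])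
      have lu: "length ?u = h" using length_nths_partition[OF I, of 2] by simp
      note pl = place_word_lists[OF nl ab(1)] place_word_lists[OF nl ab(2)] place_word_lists[OF Ab ab(2)]
      have "skew_mon ?X (?U @ (place_word a ?v @ place_word b ?u) @ ?Z) =
          skew_mon ?X ((?U @ place_word a ?v) @ place_word b ?u @ ?M @ (place_word b (A b) @ ?Y))" by simp
      also have "\<dots> = [((-1::int) ^ (length (place_word b ?u) * length ?M))] \<cdot>\<^bsub>Skew ?X\<^esub>
          skew_mon ?X ((?U @ place_word a ?v) @ ?M @ place_word b ?u @ (place_word b (A b) @ ?Y))"
        by (rule skew_mon_commute) (use pl lists in simp_all)
      also have "(?U @ place_word a ?v) @ ?M @ place_word b ?u @ (place_word b (A b) @ ?Y) = places_word m ?B"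
      proof -
        have "segment ?B [1..<a] = ?U" "segment ?B [Suc a..<b] = ?M" "segment ?B [Suc b..<Suc m] = ?Y"
          using True by (auto intro!: segment_cong)
        then show ?thesis unfolding places_word_split2[OF ab(1,2) True] using ab(3) by simp
      qed
      finally show "Phi S m (skew_mon ?X (?U @ (place_word (?\<sigma> 1) ?v @ place_word (?\<sigma> 2) ?u) @ ?Z)) =
          [((-1::int) ^ (h * (\<Sum>k\<in>{a<..<b}. length (A k))))] \<cdot>\<^bsub>?T\<^esub> tensor_mon S m ?B"
        using Phi_mon[OF B] Phi_int[OF places_word_lists[OF B]] by (simp add: lu len)
    qed
    finally show ?thesis
      unfolding places_word_split2[OF ab(1,2) True] geometric_mon_def using True by simp
  next
    case False
    then have ba: "b < a" using ab(3) by simp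
    let ?V = "segment A [1..<b]" and ?M = "segment A [Suc b..<a]" and ?Y = "segment A [Suc a..<Suc m]"
    let ?U = "?V @ place_word b (A b) @ ?M"
    let ?P = "\<lambda>r. if r = 1 then h else length ?w - h"
    let ?\<sigma> = "\<lambda>r. if r = (1::nat) then b else a"
    have lists: "?V \<in> lists ?X" "?M \<in> lists ?X" "?Y \<in> lists ?X" using ab by (auto intro!: seg)
    have len: "length ?M = (\<Sum>k\<in>{b<..<a}. length (A k))"
      by (simp add: length_segment atLeastSucLessThan_greaterThanLessThan)
    have slots: "{2, 1} = {1..2::nat}" by auto
    have "Phi S m (mat_deriv S m (elementary_mat m b a) h (skew_mon ?X (?U @ place_word a ?w @ ?Y))) =
        slice_sum ?T 2 ?P ?w (\<lambda>V. Phi S m (skew_mon ?X (?U @ (place_word (?\<sigma> 1) (V 1) @ place_word (?\<sigma> 2) (V 2)) @ ?Y)))"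
    proof (rule Phi_mat_deriv_sandwich[OF ab slots _ _ Aa])
      show "?U \<in> lists ?X" using lists place_word_lists[OF Ab ab(2)] by simp
      show "snd p \<noteq> a" if "p \<in> set ?Y" for p using segment_places[OF that] by auto
      show "snd p \<noteq> a" if "p \<in> set ?U" for p
        using that ab(3) ba by (auto simp: place_word_def dest!: segment_places)
    qed (use lists in auto)
    also have "\<dots> = [((-1::int) ^ (h * (\<Sum>k\<in>{b<..<a}. length (A k))))] \<cdot>\<^bsub>?T\<^esub>
        slice_sum ?T 2 ?P ?w (\<lambda>V. tensor_mon S m (A(b := A b @ V 1, a := V 2)))"
    proof (rule slice_sum_scaled[OF Te.ring_axioms])
      fix I assume I: "I \<in> ordered_partitions 2 ?P (length ?w)"
      let ?v = "nths ?w (I 1)" and ?u = "nths ?w (I 2)"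
      let ?B = "A(b := A b @ ?v, a := ?u)"
      have B: "?B \<in> {1..m} \<rightarrow> lists S" using A Ab nl by (auto simp: Pi_iff)
      show "tensor_mon S m ?B \<in> carrier ?T" by (rule tensor_mon_closed[OF B])
      have lv: "length ?v = h" using length_nths_partition[OF I, of 1] by simp
      note pl = place_word_lists[OF nl ab(1)] place_word_lists[OF nl ab(2)] place_word_lists[OF Ab ab(2)]
      have "skew_mon ?X (?U @ (place_word b ?v @ place_word a ?u) @ ?Y) =
          skew_mon ?X ((?V @ place_word b (A b)) @ ?M @ place_word b ?v @ (place_word a ?u @ ?Y))" by simp
      also have "\<dots> = [((-1::int) ^ (length ?M * length (place_word b ?v)))] \<cdot>\<^bsub>Skew ?X\<^esub>
          skew_mon ?X ((?V @ place_word b (A b)) @ place_word b ?v @ ?M @ (place_word a ?u @ ?Y))"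
        by (rule skew_mon_commute) (use pl lists in simp_all)
      also have "(?V @ place_word b (A b)) @ place_word b ?v @ ?M @ (place_word a ?u @ ?Y) = places_word m ?B"
      proof -
        have "segment ?B [1..<b] = ?V" "segment ?B [Suc b..<a] = ?M" "segment ?B [Suc a..<Suc m] = ?Y"
          using ba by (auto intro!: segment_cong)
        then show ?thesis unfolding places_word_split2[OF ab(2,1) ba] using ab(3) by simp
      qed
      finally show "Phi S m (skew_mon ?X (?U @ (place_word (?\<sigma> 1) ?v @ place_word (?\<sigma> 2) ?u) @ ?Y)) =
          [((-1::int) ^ (h * (\<Sum>k\<in>{b<..<a}. length (A k))))] \<cdot>\<^bsub>?T\<^esub> tensor_mon S m ?B"
        using Phi_mon[OF B] Phi_int[OF places_word_lists[OF B]] by (simp add: lv len mult.commute)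
    qed
    finally show ?thesis
      unfolding places_word_split2[OF ab(2,1) ba] geometric_mon_def using False by simp
  qed
qed

definition transport :: "'a set \<Rightarrow> nat \<Rightarrow> (('a \<times> nat) skew_elem \<Rightarrow> ('a \<times> nat) skew_elem) \<Rightarrow>
    'a tensor_elem \<Rightarrow> 'a tensor_elem" where
  "transport S m D = (\<lambda>t\<in>carrier (SkewT S m). Phi S m (D (inv_into (carrier (letterplace S m)) (Phi S m) t)))"

lemma transport_Phi:
  assumes "a \<in> carrier (letterplace S m)"
  shows "transport S m D (Phi S m a) = Phi S m (D a)"
  using assms bij_betw_inv_into_left[OF Phi_bij assms] ring_hom_closed[OF Phi_hom assms]
  by (simp add: transport_def)

lemma tensor_cases:
  assumes "t \<in> carrier (SkewT S m)"
  obtains a where "a \<in> carrier (letterplace S m)" "t = Phi S m a"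
  using assms Phi_bij[of S m] by (auto simp: bij_betw_def)

lemma transport_add_hom:
  assumes "add_hom (letterplace S m) (letterplace S m) D"
  shows "add_hom (SkewT S m) (SkewT S m) (transport S m D)"
proof (rule add_homI)
  interpret L: ring "letterplace S m" by (rule letterplace_ring)
  fix s t assume "s \<in> carrier (SkewT S m)" "t \<in> carrier (SkewT S m)"
  then obtain a b where a: "a \<in> carrier (letterplace S m)" "s = Phi S m a"
    and b: "b \<in> carrier (letterplace S m)" "t = Phi S m b" by (elim tensor_cases)
  show "transport S m D (s \<oplus>\<^bsub>SkewT S m\<^esub> t) = transport S m D s \<oplus>\<^bsub>SkewT S m\<^esub> transport S m D t"
    using a b add_hom_closed[OF assms]
    by (simp add: transport_Phi add_hom_add[OF assms] flip: ring_hom_add[OF Phi_hom])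
next
  fix s assume "s \<in> carrier (SkewT S m)"
  then obtain a where a: "a \<in> carrier (letterplace S m)" "s = Phi S m a" by (rule tensor_cases)
  then show "transport S m D s \<in> carrier (SkewT S m)"
    using ring_hom_closed[OF Phi_hom add_hom_closed[OF assms a(1)]] by (simp only: transport_Phi)
qed

lemma mat_deriv_add_hom: "add_hom (letterplace S m) (letterplace S m) (mat_deriv S m M h)"
  unfolding letterplace_def by (rule MD.D_add_hom)

lemma geometric_product_eq:
  assumes ab: "a \<in> {1..m}" "b \<in> {1..m}" "a \<noteq> b"
  shows "geometric_product S m h b a = transport S m (mat_deriv S m (elementary_mat m b a) h)"
  unfolding geometric_product_def
proof (rule the_equality)
  let ?g = "transport S m (mat_deriv S m (elementary_mat m b a) h)"
  have hom: "add_hom (SkewT S m) (SkewT S m) ?g" by (rule transport_add_hom[OF mat_deriv_add_hom])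
  have val: "?g (tensor_mon S m A) = geometric_mon S m h b a A" if A: "A \<in> {1..m} \<rightarrow> lists S" for A
  proof -
    have "skew_mon (S \<times> {1..m}) (places_word m A) \<in> carrier (letterplace S m)"
      using places_word_lists[OF A] by (simp add: letterplace_def)
    from transport_Phi[OF this] show ?thesis
      unfolding Phi_mon[OF A, symmetric] by (simp add: Phi_mat_deriv_eq_geometric_mon[OF ab A])
  qed
  have ext: "?g \<in> extensional (carrier (SkewT S m))" by (simp add: transport_def)
  show "additive_map (SkewT S m) (SkewT S m) ?g \<and> (\<forall>A\<in>{1..m} \<rightarrow> lists S. ?g (tensor_mon S m A) = geometric_mon S m h b a A)"
    using hom val ext by (simp add: additive_map_add_hom)
  fix g assume g: "additive_map (SkewT S m) (SkewT S m) g \<and> (\<forall>A\<in>{1..m} \<rightarrow> lists S. g (tensor_mon S m A) = geometric_mon S m h b a A)"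
  show "g = ?g"
  proof (rule extensionalityI[of _ "carrier (SkewT S m)"])
    show "g t = ?g t" if "t \<in> carrier (SkewT S m)" for t
      by (rule tensor_add_hom_eqI[OF Te.ring_axioms _ hom _ that]) (use g val in \<open>auto simp: additive_map_add_hom\<close>)
  qed (use g ext in \<open>simp_all add: additive_map_add_hom\<close>)
qed

lemma simple_geometric_product_eq:
  assumes ij: "i \<in> {1..m}" "j \<in> {1..m}"
  shows "simple_geometric_product S m i j = transport S m (mat_deriv S m (elementary_mat m i j) 1)"
proof (cases "i = j")
  case False
  then show ?thesis using geometric_product_eq[of j m i S 1] ij by (simp add: simple_geometric_product_def)
next
  case True
  have inv: "inv_into (carrier (letterplace S m)) (Phi S m) t \<in> carrier (letterplace S m)"
    if "t \<in> carrier (SkewT S m)" for t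
    using that Phi_bij[of S m] by (intro inv_into_into) (auto simp: bij_betw_def)
  have "simple_geometric_product S m i j = (\<lambda>t\<in>carrier (SkewT S m).
      Phi S m (polarization S m i i (inv_into (carrier (letterplace S m)) (Phi S m) t)))"
    using True by (simp add: simple_geometric_product_def)
  also have "\<dots> = transport S m (mat_deriv S m (elementary_mat m i j) 1)"
    unfolding transport_def
  proof (rule restrict_ext)
    show "Phi S m (polarization S m i i (inv_into (carrier (letterplace S m)) (Phi S m) t)) =
        Phi S m (mat_deriv S m (elementary_mat m i j) 1 (inv_into (carrier (letterplace S m)) (Phi S m) t))"
      if "t \<in> carrier (SkewT S m)" for t
      unfolding polarization_eq[OF ij(1)] restrict_apply'[OF inv[OF that]] by (simp only: True)
  qed
  finally show ?thesis .
qed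

section \<open>The Lie representation\<close>

lemma (in abelian_monoid) finsum_swap:
  assumes "finite A" "finite B" "\<And>a b. a \<in> A \<Longrightarrow> b \<in> B \<Longrightarrow> f a b \<in> carrier G"
  shows "(\<Oplus>a\<in>A. \<Oplus>b\<in>B. f a b) = (\<Oplus>b\<in>B. \<Oplus>a\<in>A. f a b)"
  using assms(1,3)
proof (induction A rule: finite_induct)
  case (insert x A)
  have cl: "f x b \<in> carrier G" "(\<Oplus>a\<in>A. f a b) \<in> carrier G" if "b \<in> B" for b
    using insert.prems that by (auto intro!: finsum_closed)
  have "(\<Oplus>a\<in>insert x A. \<Oplus>b\<in>B. f a b) = (\<Oplus>b\<in>B. f x b) \<oplus> (\<Oplus>a\<in>A. \<Oplus>b\<in>B. f a b)"
    using insert.hyps insert.prems by (subst finsum_insert) (auto intro!: finsum_closed)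
  also have "\<dots> = (\<Oplus>b\<in>B. f x b \<oplus> (\<Oplus>a\<in>A. f a b))"
    using insert cl by (subst finsum_addf) auto
  also have "\<dots> = (\<Oplus>b\<in>B. \<Oplus>a\<in>insert x A. f a b)"
    using insert.hyps insert.prems by (intro finsum_cong') (auto simp: finsum_insert intro!: finsum_closed)
  finally show ?case .
qed simp

text \<open>
  The elementary matrices generate the additive group of integer matrices.
\<close>

lemma additive_on_matrices:
  assumes R: "ring R" and H: "additive_subgroup H R"
    and cl: "\<And>M. M \<in> carrier_mat m m \<Longrightarrow> f M \<in> carrier R"
    and add: "\<And>M N. M \<in> carrier_mat m m \<Longrightarrow> N \<in> carrier_mat m m \<Longrightarrow> f (M + N) = f M \<oplus>\<^bsub>R\<^esub> f N"
    and elem: "\<And>i j. i \<in> {1..m} \<Longrightarrow> j \<in> {1..m} \<Longrightarrow> f (elementary_mat m i j) \<in> H"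
    and M: "(M :: int mat) \<in> carrier_mat m m"
  shows "f M \<in> H"
proof -
  interpret R: ring R by fact
  interpret H: additive_subgroup H R by fact
  have "f (0\<^sub>m m m) = f (0\<^sub>m m m) \<oplus>\<^bsub>R\<^esub> f (0\<^sub>m m m)" using add[of "0\<^sub>m m m" "0\<^sub>m m m"] by simp
  then have zero: "f (0\<^sub>m m m) = \<zero>\<^bsub>R\<^esub>" using cl[of "0\<^sub>m m m"] R.add.l_cancel_one[of "f (0\<^sub>m m m)" "f (0\<^sub>m m m)"] by simp
  define s :: "nat \<times> nat \<Rightarrow> int \<Rightarrow> int mat" where "s p c = mat m m (\<lambda>q. if q = p then c else 0)" for p c
  have s_cl: "s p c \<in> carrier_mat m m" for p c by (simp add: s_def)
  have single: "f (s (i, j) c) \<in> H" if ij: "i < m" "j < m" for i j c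
  proof -
    have s1: "s (i, j) 1 = elementary_mat m (Suc i) (Suc j)"
      unfolding s_def elementary_mat_def by (rule cong_mat) auto
    have e: "f (s (i, j) 1) \<in> H" unfolding s1 by (rule elem) (use ij in auto)
    have step: "f (s (i, j) (c + 1)) = f (s (i, j) c) \<oplus>\<^bsub>R\<^esub> f (s (i, j) 1)" for c
    proof -
      have "s (i, j) (c + 1) = s (i, j) c + s (i, j) 1" by (rule eq_matI) (auto simp: s_def)
      then show ?thesis by (simp add: add s_cl)
    qed
    show ?thesis
    proof (induction c rule: int_induct[where k = 0])
      case base
      have "s (i, j) 0 = 0\<^sub>m m m" by (rule eq_matI) (auto simp: s_def)
      then show ?case using zero H.zero_closed by simp
    next
      case (step1 c)
      then show ?case using step[of c] e H.a_closed by simp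
    next
      case (step2 c)
      note clc = cl[OF s_cl[of "(i, j)" c]] cl[OF s_cl[of "(i, j)" "c - 1"]] cl[OF s_cl[of "(i, j)" 1]]
      have "f (s (i, j) c) = f (s (i, j) (c - 1)) \<oplus>\<^bsub>R\<^esub> f (s (i, j) 1)" using step[of "c - 1"] by simp
      then have "f (s (i, j) (c - 1)) = f (s (i, j) c) \<oplus>\<^bsub>R\<^esub> \<ominus>\<^bsub>R\<^esub> f (s (i, j) 1)"
        using clc by (simp add: R.a_assoc R.r_neg)
      then show ?case using step2 e H.a_closed H.a_inv_closed by simp
    qed
  qed
  have part: "f (mat m m (\<lambda>q. if q \<in> K then M $$ q else 0)) \<in> H" if "K \<subseteq> {..<m} \<times> {..<m}" for K :: "(nat \<times> nat) set"
    using finite_subset[OF that finite_cartesian_product[OF finite_lessThan finite_lessThan]] that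
  proof (induction K rule: finite_induct)
    case empty
    have "mat m m (\<lambda>q. if q \<in> {} then M $$ q else 0) = 0\<^sub>m m m" by (rule eq_matI) auto
    then show ?case using zero H.zero_closed by simp
  next
    case (insert p K)
    obtain i j where p: "p = (i, j)" by (cases p)
    let ?K = "mat m m (\<lambda>q. if q \<in> K then M $$ q else 0)"
    have "mat m m (\<lambda>q. if q \<in> insert p K then M $$ q else 0) = ?K + s p (M $$ p)"
      by (rule eq_matI) (use insert.hyps in \<open>auto simp: s_def\<close>)
    moreover have "f ?K \<in> H" "f (s p (M $$ p)) \<in> H"
      using insert single[of i j "M $$ p"] by (auto simp: p)
    ultimately show ?case using add[of ?K "s p (M $$ p)"] s_cl H.a_closed by simp
  qed
  have "mat m m (\<lambda>q. if q \<in> {..<m} \<times> {..<m} then M $$ q else 0) = M" by (rule eq_matI) (use M in auto)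
  then show ?thesis using part[OF order_refl] by simp
qed

lemma mat_entry_add:
  "M \<in> carrier_mat m m \<Longrightarrow> N \<in> carrier_mat m m \<Longrightarrow> l \<in> {1..m} \<Longrightarrow> k \<in> {1..m} \<Longrightarrow>
    ((M + N) :: int mat) $$ (l - 1, k - 1) = M $$ (l - 1, k - 1) + N $$ (l - 1, k - 1)"
  by auto

lemma mat_entry_mult:
  assumes "M \<in> carrier_mat m m" "N \<in> carrier_mat m m" "p \<in> {1..m}" "k \<in> {1..m}"
  shows "((M * N) :: int mat) $$ (p - 1, k - 1) = (\<Sum>l\<in>{1..m}. N $$ (l - 1, k - 1) * M $$ (p - 1, l - 1))"
proof -
  have pk: "p - 1 < m" "k - 1 < m" using assms(3,4) by auto
  have "(M * N) $$ (p - 1, k - 1) = (\<Sum>l<m. M $$ (p - 1, l) * N $$ (l, k - 1))"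
    using assms(1,2) pk by (simp add: scalar_prod_def atLeast0LessThan)
  also have "\<dots> = (\<Sum>l\<in>{1..m}. N $$ (l - 1, k - 1) * M $$ (p - 1, l - 1))"
    unfolding sum.atLeast1_atMost_eq[folded One_nat_def] by (simp add: mult.commute)
  finally show ?thesis .
qed

lemma mat_direction_add:
  assumes M: "M \<in> carrier_mat m m" "N \<in> carrier_mat m m" and p: "p \<in> S \<times> {1..m}"
  shows "mat_direction S m (M + N) p = mat_direction S m M p \<oplus>\<^bsub>Skew (S \<times> {1..m})\<^esub> mat_direction S m N p"
proof -
  let ?L = "Skew (S \<times> {1..m})"
  obtain x k where "p = (x, k)" by (cases p)
  then have xk: "p = (x, k)" "x \<in> S" "k \<in> {1..m}" using p by simp_all
  have c: "lp_gen S m x l \<in> carrier ?L" if "l \<in> {1..m}" for l by (rule lp_gen_closed[OF xk(2) that])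
  have "mat_direction S m (M + N) p = (\<Oplus>\<^bsub>?L\<^esub>l\<in>{1..m}.
      [(M $$ (l - 1, k - 1))] \<cdot>\<^bsub>?L\<^esub> lp_gen S m x l \<oplus>\<^bsub>?L\<^esub> [(N $$ (l - 1, k - 1))] \<cdot>\<^bsub>?L\<^esub> lp_gen S m x l)"
    unfolding mat_direction_def xk(1) fst_conv snd_conv
  proof (rule Sk.finsum_cong'[OF refl])
    fix l assume l: "l \<in> {1..m}"
    show "[((M + N) $$ (l - 1, k - 1))] \<cdot>\<^bsub>?L\<^esub> lp_gen S m x l =
        [(M $$ (l - 1, k - 1))] \<cdot>\<^bsub>?L\<^esub> lp_gen S m x l \<oplus>\<^bsub>?L\<^esub> [(N $$ (l - 1, k - 1))] \<cdot>\<^bsub>?L\<^esub> lp_gen S m x l"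
      unfolding mat_entry_add[OF M l xk(3)] by (rule Sk.int_mult_add_left[OF c[OF l]])
  qed (auto intro!: c)
  also have "\<dots> = mat_direction S m M p \<oplus>\<^bsub>?L\<^esub> mat_direction S m N p"
    unfolding mat_direction_def xk(1) fst_conv snd_conv by (rule Sk.finsum_addf) (auto intro!: c)
  finally show ?thesis .
qed

lemma mat_deriv_letter: "p \<in> S \<times> {1..m} \<Longrightarrow> mat_deriv S m M 1 (skew_mon (S \<times> {1..m}) [p]) = mat_direction S m M p"
  using MD.D_letter[of p S m M 1] by simp

lemma mat_deriv_add:
  assumes M: "M \<in> carrier_mat m m" "N \<in> carrier_mat m m" and a: "a \<in> carrier (Skew (S \<times> {1..m}))"
  shows "mat_deriv S m (M + N) 1 a = mat_deriv S m M 1 a \<oplus>\<^bsub>Skew (S \<times> {1..m})\<^esub> mat_deriv S m N 1 a"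
proof (rule skew_derivation_eqI[OF MD.D_add_hom _ _ _ _ a])
  show "add_hom (Skew (S \<times> {1..m})) (Skew (S \<times> {1..m}))
      (\<lambda>a. mat_deriv S m M 1 a \<oplus>\<^bsub>Skew (S \<times> {1..m})\<^esub> mat_deriv S m N 1 a)"
    by (rule add_homI) (simp_all add: MD.D_add Sk.a_ac)
next
  fix a b assume "a \<in> carrier (Skew (S \<times> {1..m}))" "b \<in> carrier (Skew (S \<times> {1..m}))"
  then show "mat_deriv S m M 1 (a \<otimes>\<^bsub>Skew (S \<times> {1..m})\<^esub> b) \<oplus>\<^bsub>Skew (S \<times> {1..m})\<^esub> mat_deriv S m N 1 (a \<otimes>\<^bsub>Skew (S \<times> {1..m})\<^esub> b) =
      ((mat_deriv S m M 1 a \<oplus>\<^bsub>Skew (S \<times> {1..m})\<^esub> mat_deriv S m N 1 a) \<otimes>\<^bsub>Skew (S \<times> {1..m})\<^esub> b) \<oplus>\<^bsub>Skew (S \<times> {1..m})\<^esub>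
      (a \<otimes>\<^bsub>Skew (S \<times> {1..m})\<^esub> (mat_deriv S m M 1 b \<oplus>\<^bsub>Skew (S \<times> {1..m})\<^esub> mat_deriv S m N 1 b))"
    by (simp add: MD.D_1_mult Sk.l_distr Sk.r_distr Sk.a_ac)
next
  show "mat_deriv S m (M + N) 1 (skew_mon (S \<times> {1..m}) [p]) =
      mat_deriv S m M 1 (skew_mon (S \<times> {1..m}) [p]) \<oplus>\<^bsub>Skew (S \<times> {1..m})\<^esub> mat_deriv S m N 1 (skew_mon (S \<times> {1..m}) [p])"
    if "p \<in> S \<times> {1..m}" for p
    unfolding mat_deriv_letter[OF that] by (rule mat_direction_add[OF M that])
qed (rule MD.D_1_mult)

text \<open>
  As the images of the letters are read off from columns, composition of the operators on letters
  is the matrix product in the same order.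
\<close>

lemma mat_deriv_mat_direction:
  assumes M: "M \<in> carrier_mat m m" "N \<in> carrier_mat m m" and p: "p \<in> S \<times> {1..m}"
  shows "mat_deriv S m M 1 (mat_direction S m N p) = mat_direction S m (M * N) p"
proof -
  let ?L = "Skew (S \<times> {1..m})"
  obtain x k where "p = (x, k)" by (cases p)
  then have xk: "p = (x, k)" "x \<in> S" "k \<in> {1..m}" using p by simp_all
  have c: "lp_gen S m x l \<in> carrier ?L" if "l \<in> {1..m}" for l by (rule lp_gen_closed[OF xk(2) that])
  let ?N = "\<lambda>l. N $$ (l - 1, k - 1)" and ?M = "\<lambda>q l. M $$ (q - 1, l - 1)"
  have dir: "mat_direction S m K (x, l) = (\<Oplus>\<^bsub>?L\<^esub>q\<in>{1..m}. [(K $$ (q - 1, l - 1))] \<cdot>\<^bsub>?L\<^esub> lp_gen S m x q)" for K l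
    by (simp add: mat_direction_def)
  have "mat_deriv S m M 1 (mat_direction S m N p) =
      (\<Oplus>\<^bsub>?L\<^esub>l\<in>{1..m}. mat_deriv S m M 1 ([(?N l)] \<cdot>\<^bsub>?L\<^esub> lp_gen S m x l))"
    unfolding xk(1) dir[of N] by (rule MD.D_finsum) (auto intro!: c)
  also have "\<dots> = (\<Oplus>\<^bsub>?L\<^esub>l\<in>{1..m}. \<Oplus>\<^bsub>?L\<^esub>q\<in>{1..m}. [(?N l * ?M q l)] \<cdot>\<^bsub>?L\<^esub> lp_gen S m x q)"
  proof (rule Sk.finsum_cong'[OF refl])
    fix l assume l: "l \<in> {1..m}"
    have "mat_deriv S m M 1 ([(?N l)] \<cdot>\<^bsub>?L\<^esub> lp_gen S m x l) = [(?N l)] \<cdot>\<^bsub>?L\<^esub> mat_direction S m M (x, l)"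
      unfolding mat_deriv_1_gen[OF xk(2) l, symmetric] by (rule MD.D_int[OF c[OF l]])
    also have "\<dots> = (\<Oplus>\<^bsub>?L\<^esub>q\<in>{1..m}. [(?N l)] \<cdot>\<^bsub>?L\<^esub> ([(?M q l)] \<cdot>\<^bsub>?L\<^esub> lp_gen S m x q))"
      unfolding dir
      by (rule add_hom_finsum[OF Sk.ring_axioms Sk.ring_axioms Sk.int_mult_add_hom]) (auto intro!: c)
    also have "\<dots> = (\<Oplus>\<^bsub>?L\<^esub>q\<in>{1..m}. [(?N l * ?M q l)] \<cdot>\<^bsub>?L\<^esub> lp_gen S m x q)"
      by (rule Sk.finsum_cong'[OF refl]) (auto intro!: c Sk.int_mult_int_mult)
    finally show "mat_deriv S m M 1 ([(?N l)] \<cdot>\<^bsub>?L\<^esub> lp_gen S m x l) =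
        (\<Oplus>\<^bsub>?L\<^esub>q\<in>{1..m}. [(?N l * ?M q l)] \<cdot>\<^bsub>?L\<^esub> lp_gen S m x q)" .
  qed (auto intro!: c Sk.finsum_closed)
  also have "\<dots> = (\<Oplus>\<^bsub>?L\<^esub>q\<in>{1..m}. \<Oplus>\<^bsub>?L\<^esub>l\<in>{1..m}. [(?N l * ?M q l)] \<cdot>\<^bsub>?L\<^esub> lp_gen S m x q)"
    by (rule Sk.finsum_swap) (auto intro!: c)
  also have "\<dots> = (\<Oplus>\<^bsub>?L\<^esub>q\<in>{1..m}. [((M * N) $$ (q - 1, k - 1))] \<cdot>\<^bsub>?L\<^esub> lp_gen S m x q)"
  proof (rule Sk.finsum_cong'[OF refl])
    fix q assume q: "q \<in> {1..m}"
    have sum: "(\<Oplus>\<^bsub>?L\<^esub>l\<in>K. [(f l :: int)] \<cdot>\<^bsub>?L\<^esub> lp_gen S m x q) = [(\<Sum>l\<in>K. f l)] \<cdot>\<^bsub>?L\<^esub> lp_gen S m x q"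
      if "finite K" for K :: "nat set" and f
      using that by (induction K rule: finite_induct) (simp_all add: c[OF q] Sk.int_mult_add_left)
    show "(\<Oplus>\<^bsub>?L\<^esub>l\<in>{1..m}. [(?N l * ?M q l)] \<cdot>\<^bsub>?L\<^esub> lp_gen S m x q) = [((M * N) $$ (q - 1, k - 1))] \<cdot>\<^bsub>?L\<^esub> lp_gen S m x q"
      unfolding mat_entry_mult[OF M q xk(3)] by (rule sum) simp
  qed (auto intro!: c)
  also have "\<dots> = mat_direction S m (M * N) p"
    unfolding xk(1) dir ..
  finally show ?thesis .
qed

lemma (in ring) derivation_commutator_identity:
  assumes "a \<in> carrier R" "b \<in> carrier R" "x \<in> carrier R" "y \<in> carrier R" "u \<in> carrier R" "v \<in> carrier R"
    "p \<in> carrier R" "q \<in> carrier R" "r \<in> carrier R" "s \<in> carrier R"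
  shows "((p \<otimes> b \<oplus> y \<otimes> u) \<oplus> (x \<otimes> v \<oplus> a \<otimes> q)) \<ominus> ((r \<otimes> b \<oplus> x \<otimes> v) \<oplus> (y \<otimes> u \<oplus> a \<otimes> s)) =
    ((p \<ominus> r) \<otimes> b) \<oplus> (a \<otimes> (q \<ominus> s))"
  using assms by algebra

text \<open>
  The commutator of two derivations is a derivation although their composites are not, so the
  comparison reduces to letters.
\<close>

lemma mat_deriv_commutator:
  assumes M: "M \<in> carrier_mat m m" "N \<in> carrier_mat m m" and a: "a \<in> carrier (Skew (S \<times> {1..m}))"
  shows "mat_deriv S m (M * N - N * M) 1 a =
    mat_deriv S m M 1 (mat_deriv S m N 1 a) \<ominus>\<^bsub>Skew (S \<times> {1..m})\<^esub> mat_deriv S m N 1 (mat_deriv S m M 1 a)"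
proof (rule skew_derivation_eqI[OF MD.D_add_hom _ _ _ _ a])
  let ?L = "Skew (S \<times> {1..m})" and ?D = "mat_deriv S m M 1" and ?E = "mat_deriv S m N 1"
  show "add_hom ?L ?L (\<lambda>a. ?D (?E a) \<ominus>\<^bsub>?L\<^esub> ?E (?D a))"
    by (rule add_homI) (simp_all add: MD.D_add a_minus_def Sk.minus_add Sk.a_ac)
  fix a b assume ab: "a \<in> carrier ?L" "b \<in> carrier ?L"
  have "?D (?E (a \<otimes>\<^bsub>?L\<^esub> b)) = (?D (?E a) \<otimes>\<^bsub>?L\<^esub> b \<oplus>\<^bsub>?L\<^esub> ?E a \<otimes>\<^bsub>?L\<^esub> ?D b) \<oplus>\<^bsub>?L\<^esub> (?D a \<otimes>\<^bsub>?L\<^esub> ?E b \<oplus>\<^bsub>?L\<^esub> a \<otimes>\<^bsub>?L\<^esub> ?D (?E b))"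
    "?E (?D (a \<otimes>\<^bsub>?L\<^esub> b)) = (?E (?D a) \<otimes>\<^bsub>?L\<^esub> b \<oplus>\<^bsub>?L\<^esub> ?D a \<otimes>\<^bsub>?L\<^esub> ?E b) \<oplus>\<^bsub>?L\<^esub> (?E a \<otimes>\<^bsub>?L\<^esub> ?D b \<oplus>\<^bsub>?L\<^esub> a \<otimes>\<^bsub>?L\<^esub> ?E (?D b))"
    using ab by (simp_all only: MD.D_1_mult MD.D_add MD.D_closed Sk.m_closed)
  then show "?D (?E (a \<otimes>\<^bsub>?L\<^esub> b)) \<ominus>\<^bsub>?L\<^esub> ?E (?D (a \<otimes>\<^bsub>?L\<^esub> b)) =
      ((?D (?E a) \<ominus>\<^bsub>?L\<^esub> ?E (?D a)) \<otimes>\<^bsub>?L\<^esub> b) \<oplus>\<^bsub>?L\<^esub> (a \<otimes>\<^bsub>?L\<^esub> (?D (?E b) \<ominus>\<^bsub>?L\<^esub> ?E (?D b)))"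
    using ab by (simp only:) (rule Sk.derivation_commutator_identity; simp)
next
  let ?L = "Skew (S \<times> {1..m})"
  fix p assume p: "p \<in> S \<times> {1..m}"
  have MN: "M * N \<in> carrier_mat m m" "N * M \<in> carrier_mat m m" "M * N - N * M \<in> carrier_mat m m" using M by auto
  have "(M * N - N * M) + N * M = M * N" by (rule eq_matI) (use M in auto)
  then have "mat_direction S m (M * N) p = mat_direction S m (M * N - N * M) p \<oplus>\<^bsub>?L\<^esub> mat_direction S m (N * M) p"
    using mat_direction_add[OF MN(3,2) p] by simp
  then have "mat_direction S m (M * N - N * M) p = mat_direction S m (M * N) p \<ominus>\<^bsub>?L\<^esub> mat_direction S m (N * M) p"
    using MD.direction_closed[OF p] by (simp add: a_minus_def Sk.a_assoc Sk.r_neg)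
  then show "mat_deriv S m (M * N - N * M) 1 (skew_mon (S \<times> {1..m}) [p]) =
      mat_deriv S m M 1 (mat_deriv S m N 1 (skew_mon (S \<times> {1..m}) [p])) \<ominus>\<^bsub>?L\<^esub>
      mat_deriv S m N 1 (mat_deriv S m M 1 (skew_mon (S \<times> {1..m}) [p]))"
    unfolding mat_deriv_letter[OF p] mat_deriv_mat_direction[OF M p] mat_deriv_mat_direction[OF M(2,1) p] .
qed (rule MD.D_1_mult)

context letterplace_ideals
begin

abbreviation "T \<equiv> SkewT S m"
abbreviation "W \<equiv> T Quot I"
abbreviation "tensor_deriv M \<equiv> transport S m (mat_deriv S m M 1)"

lemma mat_deriv_1_J:
  assumes M: "M \<in> carrier_mat m m" and a: "a \<in> J"
  shows "mat_deriv S m M 1 a \<in> J"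
proof (rule additive_on_matrices[OF letterplace_ring ideal.axioms(1)[OF J_ideal] _ _ _ M])
  have a_cl: "a \<in> carrier (Skew (S \<times> {1..m}))"
    using additive_subgroup.a_Hcarr[OF ideal.axioms(1)[OF J_ideal] a] by (simp add: letterplace_def)
  show "mat_deriv S m M 1 a \<in> carrier (letterplace S m)" for M using a_cl by (simp add: letterplace_def)
  show "mat_deriv S m (M + N) 1 a = mat_deriv S m M 1 a \<oplus>\<^bsub>letterplace S m\<^esub> mat_deriv S m N 1 a"
    if "M \<in> carrier_mat m m" "N \<in> carrier_mat m m" for M N
    using mat_deriv_add[OF that a_cl] by (simp add: letterplace_def)
qed (rule elementary_deriv_1_J[OF _ _ a])

lemma transport_I:
  assumes "\<And>a. a \<in> J \<Longrightarrow> D a \<in> J"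
  shows "transport S m D ` I \<subseteq> I"
proof -
  interpret J: ideal J "letterplace S m" by (rule J_ideal)
  show ?thesis
    unfolding Phi_image_J[symmetric] using assms J.a_Hcarr by (auto simp: transport_Phi)
qed

lemma tensor_deriv_add_hom: "add_hom T T (tensor_deriv M)"
  by (rule transport_add_hom[OF mat_deriv_add_hom])

lemma tensor_deriv_closed: "t \<in> carrier T \<Longrightarrow> tensor_deriv M t \<in> carrier T"
  by (rule add_hom_closed[OF tensor_deriv_add_hom])

lemma mat_deriv_L: "a \<in> carrier (letterplace S m) \<Longrightarrow> mat_deriv S m M h a \<in> carrier (letterplace S m)"
  by (rule add_hom_closed[OF mat_deriv_add_hom])

lemma tensor_deriv_mult:
  assumes "s \<in> carrier T" "t \<in> carrier T"
  shows "tensor_deriv M (s \<otimes>\<^bsub>T\<^esub> t) = (tensor_deriv M s \<otimes>\<^bsub>T\<^esub> t) \<oplus>\<^bsub>T\<^esub> (s \<otimes>\<^bsub>T\<^esub> tensor_deriv M t)"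
proof -
  interpret L: ring "letterplace S m" by (rule letterplace_ring)
  obtain a where a: "a \<in> carrier (letterplace S m)" "s = Phi S m a" using assms(1) by (rule tensor_cases)
  obtain b where b: "b \<in> carrier (letterplace S m)" "t = Phi S m b" using assms(2) by (rule tensor_cases)
  have "mat_deriv S m M 1 (a \<otimes>\<^bsub>letterplace S m\<^esub> b) =
      (mat_deriv S m M 1 a \<otimes>\<^bsub>letterplace S m\<^esub> b) \<oplus>\<^bsub>letterplace S m\<^esub> (a \<otimes>\<^bsub>letterplace S m\<^esub> mat_deriv S m M 1 b)"
    unfolding letterplace_def by (rule MD.D_1_mult) (use a b in \<open>simp_all add: letterplace_def\<close>)
  then have "Phi S m (mat_deriv S m M 1 (a \<otimes>\<^bsub>letterplace S m\<^esub> b)) = (tensor_deriv M s \<otimes>\<^bsub>T\<^esub> t) \<oplus>\<^bsub>T\<^esub> (s \<otimes>\<^bsub>T\<^esub> tensor_deriv M t)"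
    using a b by (simp add: transport_Phi mat_deriv_L ring_hom_add[OF Phi_hom] ring_hom_mult[OF Phi_hom])
  then have "tensor_deriv M (Phi S m (a \<otimes>\<^bsub>letterplace S m\<^esub> b)) = (tensor_deriv M s \<otimes>\<^bsub>T\<^esub> t) \<oplus>\<^bsub>T\<^esub> (s \<otimes>\<^bsub>T\<^esub> tensor_deriv M t)"
    using a b by (simp only: transport_Phi L.m_closed)
  then show ?thesis
    using a b by (simp only: ring_hom_mult[OF Phi_hom])
qed

lemma tensor_deriv_add:
  assumes M: "M \<in> carrier_mat m m" "N \<in> carrier_mat m m" and t: "t \<in> carrier T"
  shows "tensor_deriv (M + N) t = tensor_deriv M t \<oplus>\<^bsub>T\<^esub> tensor_deriv N t"
proof -
  obtain a where a: "a \<in> carrier (letterplace S m)" "t = Phi S m a" using t by (rule tensor_cases)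
  then show ?thesis
    using mat_deriv_add[OF M, of a S] mat_deriv_L[of a] ring_hom_add[OF Phi_hom, of "mat_deriv S m M 1 a" S m "mat_deriv S m N 1 a"]
    by (simp add: transport_Phi) (simp add: letterplace_def)
qed

lemma tensor_deriv_commutator:
  assumes M: "M \<in> carrier_mat m m" "N \<in> carrier_mat m m" and t: "t \<in> carrier T"
  shows "tensor_deriv (M * N - N * M) t = tensor_deriv M (tensor_deriv N t) \<ominus>\<^bsub>T\<^esub> tensor_deriv N (tensor_deriv M t)"
proof -
  interpret L: ring "letterplace S m" by (rule letterplace_ring)
  obtain a where a: "a \<in> carrier (letterplace S m)" "t = Phi S m a" using t by (rule tensor_cases)
  let ?x = "mat_deriv S m M 1 (mat_deriv S m N 1 a)" and ?y = "mat_deriv S m N 1 (mat_deriv S m M 1 a)"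
  have xy: "?x \<in> carrier (letterplace S m)" "?y \<in> carrier (letterplace S m)" by (intro mat_deriv_L a)+
  have "mat_deriv S m (M * N - N * M) 1 a = ?x \<ominus>\<^bsub>letterplace S m\<^esub> ?y"
    using mat_deriv_commutator[OF M, of a S] a by (simp add: letterplace_def)
  then have "tensor_deriv (M * N - N * M) t = Phi S m (?x \<ominus>\<^bsub>letterplace S m\<^esub> ?y)"
    by (simp add: a transport_Phi)
  also have "\<dots> = Phi S m ?x \<ominus>\<^bsub>T\<^esub> Phi S m ?y"
    using xy by (simp add: a_minus_def ring_hom_add[OF Phi_hom] add_hom_neg[OF letterplace_ring Te.ring_axioms Phi_add_hom])
  finally show ?thesis using a by (simp add: transport_Phi mat_deriv_L)
qed

definition whitney_rep :: "int mat \<Rightarrow> 'a tensor_elem set \<Rightarrow> 'a tensor_elem set" where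
  "whitney_rep = (\<lambda>M\<in>carrier_mat m m. induced_map T I T I (tensor_deriv M))"

lemma tensor_deriv_I: "M \<in> carrier_mat m m \<Longrightarrow> tensor_deriv M ` I \<subseteq> I"
  by (intro transport_I mat_deriv_1_J)

lemma whitney_rep_coset: "M \<in> carrier_mat m m \<Longrightarrow> t \<in> carrier T \<Longrightarrow> whitney_rep M (I +>\<^bsub>T\<^esub> t) = I +>\<^bsub>T\<^esub> tensor_deriv M t"
  by (simp add: whitney_rep_def induced_map_coset[OF I_ideal I_ideal tensor_deriv_add_hom tensor_deriv_I])

lemma W_ring: "ring W"
  by (rule ideal.quotient_is_ring[OF I_ideal])

lemma W_cases:
  assumes "C \<in> carrier W" obtains t where "t \<in> carrier T" "C = I +>\<^bsub>T\<^esub> t"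
  using assms by (auto simp: ideal.quot_carrier[OF I_ideal])

lemmas W_simps = ideal.quot_add[OF I_ideal] ideal.quot_mult[OF I_ideal] ideal.quot_closed[OF I_ideal]

lemma whitney_rep_derivation:
  assumes M: "M \<in> carrier_mat m m" shows "derivation W (whitney_rep M)"
  unfolding derivation_def additive_map_add_hom
proof (intro conjI ballI)
  show "whitney_rep M \<in> extensional (carrier W)" using M by (simp add: whitney_rep_def induced_map_def)
  show "add_hom W W (whitney_rep M)"
  proof (rule add_homI)
    fix C assume "C \<in> carrier W"
    then obtain s where s: "s \<in> carrier T" "C = I +>\<^bsub>T\<^esub> s" by (rule W_cases)
    show "whitney_rep M C \<in> carrier W" by (simp add: s whitney_rep_coset[OF M] W_simps tensor_deriv_closed)
    fix D assume "D \<in> carrier W"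
    then obtain t where t: "t \<in> carrier T" "D = I +>\<^bsub>T\<^esub> t" by (rule W_cases)
    show "whitney_rep M (C \<oplus>\<^bsub>W\<^esub> D) = whitney_rep M C \<oplus>\<^bsub>W\<^esub> whitney_rep M D"
      by (simp add: s t whitney_rep_coset[OF M] W_simps tensor_deriv_closed add_hom_add[OF tensor_deriv_add_hom])
  qed
  fix C D assume "C \<in> carrier W" "D \<in> carrier W"
  then obtain s t where st: "s \<in> carrier T" "C = I +>\<^bsub>T\<^esub> s" "t \<in> carrier T" "D = I +>\<^bsub>T\<^esub> t" by (elim W_cases)
  show "whitney_rep M (C \<otimes>\<^bsub>W\<^esub> D) = whitney_rep M C \<otimes>\<^bsub>W\<^esub> D \<oplus>\<^bsub>W\<^esub> C \<otimes>\<^bsub>W\<^esub> whitney_rep M D"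
    by (simp add: st whitney_rep_coset[OF M] W_simps tensor_deriv_closed tensor_deriv_mult)
qed

lemma lie_hom_whitney_rep: "lie_hom (gl_int m) (der_lie W) whitney_rep"
  unfolding lie_hom_def
proof (intro conjI ballI)
  show "whitney_rep \<in> carrier (gl_int m) \<rightarrow>\<^sub>E carrier (der_lie W)"
    using whitney_rep_derivation by (auto simp: gl_int_def der_lie_def) (simp add: whitney_rep_def)
  fix M N assume "M \<in> carrier (gl_int m)" "N \<in> carrier (gl_int m)"
  then have M: "M \<in> carrier_mat m m" "N \<in> carrier_mat m m" by (simp_all add: gl_int_def)
  have ext: "whitney_rep K \<in> extensional (carrier W)" if "K \<in> carrier_mat m m" for K
    using that by (simp add: whitney_rep_def induced_map_def)
  have "whitney_rep (M + N) = (\<lambda>C\<in>carrier W. whitney_rep M C \<oplus>\<^bsub>W\<^esub> whitney_rep N C)"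
  proof (rule extensionalityI[of _ "carrier W"])
    fix C assume C: "C \<in> carrier W"
    then obtain t where t: "t \<in> carrier T" "C = I +>\<^bsub>T\<^esub> t" by (rule W_cases)
    have "M + N \<in> carrier_mat m m" using M by simp
    then show "whitney_rep (M + N) C = (\<lambda>C\<in>carrier W. whitney_rep M C \<oplus>\<^bsub>W\<^esub> whitney_rep N C) C"
      using C t by (simp add: whitney_rep_coset M tensor_deriv_add[OF M] W_simps tensor_deriv_closed)
  qed (use ext M in simp_all)
  then show "whitney_rep (lie_add (gl_int m) M N) = lie_add (der_lie W) (whitney_rep M) (whitney_rep N)"
    by (simp add: gl_int_def der_lie_def)
  have "whitney_rep (M * N - N * M) = (\<lambda>C\<in>carrier W. whitney_rep M (whitney_rep N C) \<ominus>\<^bsub>W\<^esub> whitney_rep N (whitney_rep M C))"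
  proof (rule extensionalityI[of _ "carrier W"])
    have MN: "M * N - N * M \<in> carrier_mat m m" using M by auto
    then show "whitney_rep (M * N - N * M) \<in> extensional (carrier W)" by (rule ext)
    fix C assume C: "C \<in> carrier W"
    then obtain t where t: "t \<in> carrier T" "C = I +>\<^bsub>T\<^esub> t" by (rule W_cases)
    have minus: "I +>\<^bsub>T\<^esub> (x \<ominus>\<^bsub>T\<^esub> y) = (I +>\<^bsub>T\<^esub> x) \<ominus>\<^bsub>W\<^esub> (I +>\<^bsub>T\<^esub> y)" if "x \<in> carrier T" "y \<in> carrier T" for x y
      using that by (simp add: a_minus_def W_simps ideal.rcos_neg[OF I_ideal, symmetric])
    show "whitney_rep (M * N - N * M) C = (\<lambda>C\<in>carrier W. whitney_rep M (whitney_rep N C) \<ominus>\<^bsub>W\<^esub> whitney_rep N (whitney_rep M C)) C"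
      using C t by (simp add: whitney_rep_coset[OF MN] whitney_rep_coset[OF M(1)] whitney_rep_coset[OF M(2)] tensor_deriv_commutator[OF M] tensor_deriv_closed minus)
  qed simp
  then show "whitney_rep (lie_bracket (gl_int m) M N) = lie_bracket (der_lie W) (whitney_rep M) (whitney_rep N)"
    by (simp add: gl_int_def der_lie_def)
qed

lemma whitney_rep_elementary:
  assumes "i \<in> {1..m}" "j \<in> {1..m}"
  shows "whitney_rep (elementary_mat m i j) = induced_map T I T I (simple_geometric_product S m i j)"
  unfolding simple_geometric_product_eq[OF assms] by (simp add: whitney_rep_def elementary_mat_def)

text \<open>
  The difference of two representations at a fixed coset is additive in the matrix.
\<close>

lemma whitney_rep_unique:
  assumes hom: "lie_hom (gl_int m) (der_lie W) \<rho>'"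
    and elem: "\<And>i j. i \<in> {1..m} \<Longrightarrow> j \<in> {1..m} \<Longrightarrow> \<rho>' (elementary_mat m i j) = whitney_rep (elementary_mat m i j)"
  shows "\<rho>' = whitney_rep"
proof (rule extensionalityI[of _ "carrier_mat m m"])
  interpret W: ring W by (rule W_ring)
  have props: "\<rho>'' \<in> extensional (carrier_mat m m)" "\<And>M. M \<in> carrier_mat m m \<Longrightarrow> derivation W (\<rho>'' M)"
    "\<And>M N. M \<in> carrier_mat m m \<Longrightarrow> N \<in> carrier_mat m m \<Longrightarrow> \<rho>'' (M + N) = (\<lambda>C\<in>carrier W. \<rho>'' M C \<oplus>\<^bsub>W\<^esub> \<rho>'' N C)"
    if "lie_hom (gl_int m) (der_lie W) \<rho>''" for \<rho>''
    using that by (auto simp: lie_hom_def gl_int_def der_lie_def PiE_def)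
  note p = props[OF hom] and q = props[OF lie_hom_whitney_rep]
  show "\<rho>' \<in> extensional (carrier_mat m m)" "whitney_rep \<in> extensional (carrier_mat m m)" by (rule p(1), rule q(1))
  fix M assume M: "(M :: int mat) \<in> carrier_mat m m"
  have ext: "\<rho>' M \<in> extensional (carrier W)" "whitney_rep M \<in> extensional (carrier W)"
    using p(2)[OF M] q(2)[OF M] by (simp_all add: derivation_def additive_map_add_hom)
  show "\<rho>' M = whitney_rep M"
  proof (rule extensionalityI[OF ext])
    fix C assume C: "C \<in> carrier W"
    have cl: "\<rho>' N C \<in> carrier W" "whitney_rep N C \<in> carrier W" if "N \<in> carrier_mat m m" for N
      using p(2)[OF that] q(2)[OF that] C by (auto simp: derivation_def additive_map_add_hom intro: add_hom_closed)
    have sub: "additive_subgroup {\<zero>\<^bsub>W\<^esub>} W" using ideal.axioms(1)[OF W.zeroideal] .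
    have "\<rho>' M C \<ominus>\<^bsub>W\<^esub> whitney_rep M C \<in> {\<zero>\<^bsub>W\<^esub>}"
    proof (rule additive_on_matrices[OF W_ring sub _ _ _ M])
      show "\<rho>' (N + K) C \<ominus>\<^bsub>W\<^esub> whitney_rep (N + K) C = (\<rho>' N C \<ominus>\<^bsub>W\<^esub> whitney_rep N C) \<oplus>\<^bsub>W\<^esub> (\<rho>' K C \<ominus>\<^bsub>W\<^esub> whitney_rep K C)"
        if "N \<in> carrier_mat m m" "K \<in> carrier_mat m m" for N K
        using C cl[OF that(1)] cl[OF that(2)] p(3)[OF that] q(3)[OF that]
        by (simp add: a_minus_def W.minus_add[symmetric] W.a_ac del: quot_simps)
      show "\<rho>' (elementary_mat m i j) C \<ominus>\<^bsub>W\<^esub> whitney_rep (elementary_mat m i j) C \<in> {\<zero>\<^bsub>W\<^esub>}"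
        if "i \<in> {1..m}" "j \<in> {1..m}" for i j
        using cl[of "elementary_mat m i j"] elem[OF that] by (simp add: a_minus_def W.r_neg elementary_mat_def del: quot_simps)
    qed (use cl in simp)
    then have z: "\<rho>' M C \<ominus>\<^bsub>W\<^esub> whitney_rep M C = \<zero>\<^bsub>W\<^esub>" by blast
    have "\<rho>' M C = (\<rho>' M C \<ominus>\<^bsub>W\<^esub> whitney_rep M C) \<oplus>\<^bsub>W\<^esub> whitney_rep M C"
      using cl[OF M] by (simp add: a_minus_def W.a_assoc W.l_neg del: quot_simps)
    then show "\<rho>' M C = whitney_rep M C" unfolding z using cl[OF M] by (simp del: quot_simps)
  qed
qed

lemma geometric_product_I:
  assumes "i \<in> {1..m}" "j \<in> {1..m}" "i \<noteq> j"
  shows "geometric_product S m h j i ` I \<subseteq> I"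
  unfolding geometric_product_eq[OF assms] by (intro transport_I elementary_deriv_J assms)

lemma divided_power_J:
  assumes "i \<in> {1..m}" "j \<in> {1..m}" "i \<noteq> j"
  shows "divided_power (letterplace S m) (polarization S m j i) h ` J \<subseteq> J"
proof -
  interpret J: ideal J "letterplace S m" by (rule J_ideal)
  show ?thesis
    using elementary_deriv_J[OF assms] by (auto simp: divided_power_eq[OF assms J.a_Hcarr])
qed

end

theorem mainTheorem7:
  fixes S :: "'a set" and indep :: "'a set \<Rightarrow> bool" and n m :: nat
  assumes "matroid S indep" and "has_rank indep n" and "m \<ge> 1"
  shows
    "let L = letterplace S m; J = biproduct_ideal S indep m;
         T = SkewT S m; I = whitney_ideal S indep m; W = whitney_algebra S indep m
     in
     (Phi S m \<in> ring_iso L T \<and>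
      Phi S m ` J = I \<and>
      well_defined_on_quotient L J T I (Phi S m) \<and>
      induced_map L J T I (Phi S m) \<in> ring_iso (L Quot J) W)
     \<and>
     (\<forall>i\<in>{1..m}. \<forall>j\<in>{1..m}. \<forall>h\<ge>1. i \<noteq> j \<longrightarrow>
        divided_power L (polarization S m j i) h ` J \<subseteq> J \<and>
        geometric_product S m h j i ` I \<subseteq> I \<and>
        well_defined_on_quotient T I T I (geometric_product S m h j i))
     \<and>
     ((\<forall>i\<in>{1..m}. \<forall>j\<in>{1..m}.
         well_defined_on_quotient T I T I (simple_geometric_product S m i j)) \<and>
      (\<exists>!\<rho>. lie_hom (gl_int m) (der_lie W) \<rho> \<and>
         (\<forall>i\<in>{1..m}. \<forall>j\<in>{1..m}.
            \<rho> (elementary_mat m i j) = induced_map T I T I (simple_geometric_product S m i j))))"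
proof -
  interpret letterplace_ideals S indep m .
  have W: "whitney_algebra S indep m = W" by (simp add: whitney_algebra_def)
  have wd: "well_defined_on_quotient T I T I (transport S m (mat_deriv S m M h))"
    if "transport S m (mat_deriv S m M h) ` I \<subseteq> I" for M h
    by (rule well_defined_on_quotientI[OF I_ideal I_ideal transport_add_hom[OF mat_deriv_add_hom] that])
  have iso: "Phi S m \<in> ring_iso (letterplace S m) T \<and> Phi S m ` J = I \<and>
      well_defined_on_quotient (letterplace S m) J T I (Phi S m) \<and>
      induced_map (letterplace S m) J T I (Phi S m) \<in> ring_iso (letterplace S m Quot J) W"
    using Phi_iso Phi_image_J well_defined_on_quotientI[OF J_ideal I_ideal Phi_add_hom]
      ring_iso_induced[OF J_ideal I_ideal Phi_iso Phi_image_J] by simp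
  have products: "divided_power (letterplace S m) (polarization S m j i) h ` J \<subseteq> J \<and>
      geometric_product S m h j i ` I \<subseteq> I \<and> well_defined_on_quotient T I T I (geometric_product S m h j i)"
    if "i \<in> {1..m}" "j \<in> {1..m}" "i \<noteq> j" for i j h
    using divided_power_J[OF that] geometric_product_I[OF that] wd[of "elementary_mat m j i" h]
    unfolding geometric_product_eq[OF that] by blast
  have simple: "well_defined_on_quotient T I T I (simple_geometric_product S m i j)"
    if "i \<in> {1..m}" "j \<in> {1..m}" for i j
    unfolding simple_geometric_product_eq[OF that] by (rule wd[OF tensor_deriv_I]) (simp add: elementary_mat_def)
  have rep: "\<exists>!\<rho>. lie_hom (gl_int m) (der_lie W) \<rho> \<and> (\<forall>i\<in>{1..m}. \<forall>j\<in>{1..m}.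
      \<rho> (elementary_mat m i j) = induced_map T I T I (simple_geometric_product S m i j))"
  proof (rule ex1I[of _ whitney_rep])
    show "lie_hom (gl_int m) (der_lie W) whitney_rep \<and> (\<forall>i\<in>{1..m}. \<forall>j\<in>{1..m}.
        whitney_rep (elementary_mat m i j) = induced_map T I T I (simple_geometric_product S m i j))"
      using lie_hom_whitney_rep whitney_rep_elementary by blast
    show "\<rho>' = whitney_rep" if "lie_hom (gl_int m) (der_lie W) \<rho>' \<and> (\<forall>i\<in>{1..m}. \<forall>j\<in>{1..m}.
        \<rho>' (elementary_mat m i j) = induced_map T I T I (simple_geometric_product S m i j))" for \<rho>'
      by (rule whitney_rep_unique) (use that whitney_rep_elementary in auto)
  qed
  show ?thesis
    unfolding Let_def W
  proof (intro conjI)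
    show "\<forall>i\<in>{1..m}. \<forall>j\<in>{1..m}. \<forall>h\<ge>1. i \<noteq> j \<longrightarrow>
        divided_power (letterplace S m) (polarization S m j i) h ` J \<subseteq> J \<and>
        geometric_product S m h j i ` I \<subseteq> I \<and> well_defined_on_quotient T I T I (geometric_product S m h j i)"
      by (intro ballI allI impI) (rule products)
    show "\<forall>i\<in>{1..m}. \<forall>j\<in>{1..m}. well_defined_on_quotient T I T I (simple_geometric_product S m i j)"
      by (intro ballI) (rule simple)
  qed (use iso rep in \<open>simp_all only:\<close>)
qed

end
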